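(* There are exactly 167 score sequences of tournaments on 8 vertices. At least 147 of them are linkless, and at least 15 of them have an intrinsically linked representative.
   Context: A tournament is a directed graph with exactly one directed edge between each pair of distinct vertices. Its score sequence is the list of outdegrees of its vertices in non-decreasing order. A cycle in a directed graph is consistently oriented if it is a directed cycle. A directed graph $G$ is intrinsically linked as a directed graph if every (tame) embedding of $G$ into $S^3$ contains two vertex-disjoint consistently oriented cycles that form a non-split link. A score sequence $S$ is linkless if every tournament with score sequence $S$ has an embedding into $S^3$ that contains no non-split consistently oriented link (that is, it is not intrinsically linked as a directed graph). A score sequence $S$ has an intrinsically linked representative if there exists a tournament with score sequence $S$ that is intrinsically linked as a directed graph. *)

theory Defs
  imports
    "HOL-Analysis.Analysis"
    "HOL-Library.Multiset"
    "Graph_Theory.Digraph"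
    "Graph_Theory.Arc_Walk"
    "Graph_Theory.Pair_Digraph"
begin

section \<open>Tournaments and score sequences\<close>

locale tournament = pair_digraph +
  assumes exactly_one_arc:
    "\<lbrakk>u \<in> pverts G; v \<in> pverts G; u \<noteq> v\<rbrakk> \<Longrightarrow> ((u, v) \<in> parcs G) \<noteq> ((v, u) \<in> parcs G)"

definition score_sequence :: "'a pair_pre_digraph \<Rightarrow> nat list" where
  "score_sequence G =
     sorted_list_of_multiset (image_mset (out_degree (with_proj G)) (mset_set (pverts G)))"

text \<open>Every finite tournament is isomorphic to one whose vertices are natural numbers, so
  score sequences are collected from those.\<close>

definition score_sequences :: "nat \<Rightarrow> nat list set" where
  "score_sequences n =
     {score_sequence G | G :: nat pair_pre_digraph. tournament G \<and> card (pverts G) = n}"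


section \<open>Tame embeddings of digraphs into the 3-sphere\<close>

abbreviation S3 :: "(real^4) set" where
  "S3 \<equiv> sphere 0 1"

text \<open>A proper compact subset of the 3-sphere is tame if some homeomorphism from the complement
  of a point off the set onto Euclidean 3-space carries it to a compact polyhedron, that is, to a
  finite union of polytopes.\<close>

definition tame :: "(real^4) set \<Rightarrow> bool" where
  "tame X \<longleftrightarrow> X \<subseteq> S3 \<and>
     (\<exists>p h k. p \<in> S3 - X \<and> homeomorphism (S3 - {p}) (UNIV :: (real^3) set) h k \<and>
        (\<exists>\<P>. finite \<P> \<and> (\<forall>P\<in>\<P>. polytope P) \<and> h ` X = \<Union>\<P>))"

text \<open>An embedding of (the geometric realization of) a finite digraph is given by the positions
  \<open>f\<close> of its vertices and a parametrized curve \<open>\<gamma> e\<close> for each arc \<open>e\<close>. A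
  \<^const>\<open>simple_path\<close> may close up only at its endpoints, which for injective \<open>f\<close>
  happens only for loops; in particular the arcs of a tournament are embedded as topological
  arcs.\<close>

definition embedding_S3 ::
    "('a, 'b) pre_digraph \<Rightarrow> ('a \<Rightarrow> real^4) \<Rightarrow> ('b \<Rightarrow> real \<Rightarrow> real^4) \<Rightarrow> bool" where
  "embedding_S3 G f \<gamma> \<longleftrightarrow>
     inj_on f (verts G) \<and> f ` verts G \<subseteq> S3 \<and>
     (\<forall>e\<in>arcs G. simple_path (\<gamma> e) \<and> path_image (\<gamma> e) \<subseteq> S3 \<and>
        pathstart (\<gamma> e) = f (tail G e) \<and> pathfinish (\<gamma> e) = f (head G e)) \<and>
     (\<forall>e\<in>arcs G. \<forall>v\<in>verts G. f v \<in> path_image (\<gamma> e) \<longrightarrow> v = tail G e \<or> v = head G e) \<and>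
     (\<forall>e\<in>arcs G. \<forall>e'\<in>arcs G. e \<noteq> e' \<longrightarrow>
        path_image (\<gamma> e) \<inter> path_image (\<gamma> e') \<subseteq> f ` verts G)"

definition tame_embedding_S3 ::
    "('a, 'b) pre_digraph \<Rightarrow> ('a \<Rightarrow> real^4) \<Rightarrow> ('b \<Rightarrow> real \<Rightarrow> real^4) \<Rightarrow> bool" where
  "tame_embedding_S3 G f \<gamma> \<longleftrightarrow>
     embedding_S3 G f \<gamma> \<and> tame (f ` verts G \<union> (\<Union>e\<in>arcs G. path_image (\<gamma> e)))"


section \<open>Split links and intrinsic linking\<close>

text \<open>A two-component link is split if a tamely embedded 2-sphere in its complement separates
  its components.\<close>

definition split_link :: "(real^4) set \<Rightarrow> (real^4) set \<Rightarrow> bool" where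
  "split_link K L \<longleftrightarrow>
     (\<exists>\<Sigma>. tame \<Sigma> \<and> \<Sigma> homeomorphic (sphere 0 1 :: (real^3) set) \<and> \<Sigma> \<inter> (K \<union> L) = {} \<and>
        (\<exists>U\<in>components (S3 - \<Sigma>). \<exists>V\<in>components (S3 - \<Sigma>). U \<noteq> V \<and> K \<subseteq> U \<and> L \<subseteq> V))"

text \<open>Cycles are lists of arcs that are consistently oriented by definition; the vertices of a
  cycle are the tails of its arcs.\<close>

definition contains_nonsplit_oriented_link ::
    "('a, 'b) pre_digraph \<Rightarrow> ('b \<Rightarrow> real \<Rightarrow> real^4) \<Rightarrow> bool" where
  "contains_nonsplit_oriented_link G \<gamma> \<longleftrightarrow>
     (\<exists>c d. pre_digraph.cycle G c \<and> pre_digraph.cycle G d \<and>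
        tail G ` set c \<inter> tail G ` set d = {} \<and>
        \<not> split_link (\<Union>e\<in>set c. path_image (\<gamma> e)) (\<Union>e\<in>set d. path_image (\<gamma> e)))"

definition intrinsically_linked_digraph :: "('a, 'b) pre_digraph \<Rightarrow> bool" where
  "intrinsically_linked_digraph G \<longleftrightarrow>
     (\<forall>f \<gamma>. tame_embedding_S3 G f \<gamma> \<longrightarrow> contains_nonsplit_oriented_link G \<gamma>)"

definition linkless :: "nat list \<Rightarrow> bool" where
  "linkless S \<longleftrightarrow>
     (\<forall>G :: nat pair_pre_digraph. tournament G \<and> score_sequence G = S \<longrightarrow>
        (\<exists>f \<gamma>. tame_embedding_S3 (with_proj G) f \<gamma> \<and>
           \<not> contains_nonsplit_oriented_link (with_proj G) \<gamma>))"

definition has_intrinsically_linked_representative :: "nat list \<Rightarrow> bool" where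
  "has_intrinsically_linked_representative S \<longleftrightarrow>
     (\<exists>G :: nat pair_pre_digraph. tournament G \<and> score_sequence G = S \<and>
        intrinsically_linked_digraph (with_proj G))"

end

theory Submission
  imports Defs
begin

text \<open>Why the theorem holds.

  \<^bold>\<open>Intrinsic linking.\<close> Fifteen tournaments are given together with a family of pairs of disjoint
  directed cycles in which every pair of disjoint arcs is met an even number of times
  (\<open>odd_certificate\<close>). In a generic projection, the linking number modulo 2 of two cycles is the number
  of crossings at which the first one is the upper one. Summing over the family, the crossings cancel
  up to a term that does not depend on the drawing, as in the classical argument of Conway, Gordon and
  Sachs for the complete graph on six vertices; here the term is odd. So every
  drawing contains a pair of cycles that cannot be separated
  (\<open>separated_certificate_contradiction\<close>, \<open>certificate_intrinsically_linked\<close>).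

  That split cycles have even crossing numbers has to be shown for an arbitrary separating 2-sphere. Instead of
  homology this uses a function on the complement of a closed polygon \<open>L\<close>: the trace of the product of the spin
  projections in the directions of the vertices of \<open>L\<close>. It has no zeros off \<open>L\<close>, tends to 1 at infinity, and
  its argument is half of the solid angle of \<open>L\<close>. If a sphere separates \<open>L\<close> from a polygon \<open>K\<close>, then on the side
  of \<open>K\<close> the function has a logarithm, hence a square root, because the 2-sphere and
  the 3-sphere are simply connected (\<open>sphere_side_log\<close>). Written as a product over the edges of \<open>L\<close>, the
  square root changes its sign relative to principal roots exactly when \<open>K\<close> passes over an edge of
  \<open>L\<close> (\<open>root_flip\<close>), so the number of overcrossings is even (\<open>overcrossings_even\<close>,
  \<open>separated_even\<close>). Curves are replaced by polygons in general position.

  \<^bold>\<open>Linkless sequences.\<close> All tournaments are drawn with straight edges on the same eight points of space. Two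
  disjoint cycles form a split link if one of them lies above the other (\<open>split_if_above\<close>), so it
  suffices to place the vertices in such a way that this holds for all pairs of disjoint directed cycles
  (\<open>layered_embedding\<close>). Six of the points form a prism that, seen from above, has only three crossings, and the
  other two are high above it. If a tournament has a vertex \<open>v\<close> of score at most 1, then \<open>v\<close> and its
  out-neighbour take the high points; directed cycles through the high points meet the prism only in paths that start
  at an out-neighbour of the latter. A check of the tournaments on the six remaining vertices, sorted
  by score, leaves three of them for closer inspection and shows that a placement exists unless the
  score sequence is one of the five listed as \<open>obstructed\<close> (\<open>low_vertex\<close>). Reversing all
  arcs gives the same for a vertex of score at least 6. One further sequence, 2,2,2,2,5,5,5,5, belongs to four tournaments
  only, which have suitable placements (\<open>two_five\<close>). Together these are 147 sequences.

  \<^bold>\<open>Counting.\<close> Landau's condition is necessary by counting arcs and sufficient by a recursive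
  construction (\<open>score_sequences_8\<close>), and an enumeration finds 167 sequences that satisfy it.\<close>

section \<open>The spin holonomy of a closed polygon\<close>

definition hor :: "real^3 \<Rightarrow> complex" where "hor x = Complex (x$1) (x$2)"

lemma hor_diff: "hor (x - y) = hor x - hor y"
  by (simp add: hor_def complex_eq_iff)

lemma linear_hor: "linear hor"
  by (rule linearI) (simp_all add: hor_def complex_eq_iff)

lemma bounded_linear_hor: "bounded_linear hor"
  using linear_hor linear_conv_bounded_linear by blast

lemma norm_hor: "(norm x)\<^sup>2 = (cmod (hor x))\<^sup>2 + (x$3)\<^sup>2" for x :: "real^3"
  unfolding norm_vec_def L2_set_def hor_def cmod_power2
  by (simp add: sum_3 real_sqrt_pow2)

lemma continuous_on_hor [continuous_intros]: "continuous_on S f \<Longrightarrow> continuous_on S (\<lambda>x. hor (f x))"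
  by (rule bounded_linear.continuous_on[OF bounded_linear_hor])

text \<open>A complex 2 by 2 matrix, row by row. Tuples instead of a matrix type keep all computations
  with the four entries within the reach of the simplifier, and as a product of normed spaces
  the type comes with the topology that is needed.\<close>

type_synonym mat2 = "complex \<times> complex \<times> complex \<times> complex"

fun mm :: "mat2 \<Rightarrow> mat2 \<Rightarrow> mat2" where
  "mm (a,b,c,d) (a',b',c',d') = (a*a' + b*c', a*b' + b*d', c*a' + d*c', c*b' + d*d')"

fun tr :: "mat2 \<Rightarrow> complex" where "tr (a,b,c,d) = a + d"

text \<open>The projection onto the spin state that points in the direction \<open>a\<close>, that is,
  \<open>(1 + n \<cdot> \<sigma>) / 2\<close> for the unit vector \<open>n\<close> along \<open>a\<close> and the Pauli matrices
  \<open>\<sigma>\<close>.\<close>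

definition dirproj :: "real^3 \<Rightarrow> mat2" where
  "dirproj a = (of_real ((norm a + a$3) / (2 * norm a)), cnj (hor a) / of_real (2 * norm a),
      hor a / of_real (2 * norm a), of_real ((norm a - a$3) / (2 * norm a)))"

fun outer :: "complex \<times> complex \<Rightarrow> complex \<times> complex \<Rightarrow> mat2" where
  "outer (p,q) (p',q') = (p * cnj p', p * cnj q', q * cnj p', q * cnj q')"

fun ip :: "complex \<times> complex \<Rightarrow> complex \<times> complex \<Rightarrow> complex" where
  "ip (p,q) (p',q') = cnj p * p' + cnj q * q'"

fun scale :: "complex \<Rightarrow> mat2 \<Rightarrow> mat2" where
  "scale k (a,b,c,d) = (k*a, k*b, k*c, k*d)"

lemma mm_outer: "mm (outer s t) (scale k (outer u v)) = scale (k * ip t u) (outer s v)"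
  by (cases s; cases t; cases u; cases v) (simp add: algebra_simps)

lemma tr_outer: "tr (scale k (outer s t)) = k * ip t s"
  by (cases s; cases t) (simp add: algebra_simps)

fun links :: "'a list \<Rightarrow> ('a \<times> 'a) list" where
  "links (x # y # xs) = (x, y) # links (y # xs)"
| "links _ = []"

text \<open>The product of the projections in the directions in which a point \<open>x\<close> sees the vertices of
  a polygon. For a closed polygon the argument of its trace is half of the solid angle under which
  the polygon is seen (Berry phase). The solid angle is only defined modulo \<open>4 \<pi>\<close>, and passing
  once through a spanning surface changes it by \<open>4 \<pi>\<close>; so a square root of the trace has
  monodromy \<open>- 1\<close> along a meridian of the polygon and detects linking numbers modulo 2.\<close>

fun holo :: "(real^3) list \<Rightarrow> real^3 \<Rightarrow> mat2" where
  "holo [] x = (1,0,0,1)"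
| "holo (v # vs) x = mm (dirproj (v - x)) (holo vs x)"

lemma mm_id: "mm m (1,0,0,1) = m" by (cases m) simp

lemma scale_1: "scale 1 m = m" by (cases m) simp

lemma holo_outer:
  assumes "\<And>v. v \<in> set vs \<Longrightarrow> dirproj (v - x) = outer (\<psi> v) (\<psi> v)" "vs \<noteq> []"
  shows "holo vs x = scale (\<Prod>(v,w)\<leftarrow>links vs. ip (\<psi> v) (\<psi> w)) (outer (\<psi> (hd vs)) (\<psi> (last vs)))"
  using assms
proof (induction vs rule: links.induct)
  case (1 a b xs)
  then have IH: "holo (b#xs) x = scale (\<Prod>(v,w)\<leftarrow>links (b#xs). ip (\<psi> v) (\<psi> w)) (outer (\<psi> b) (\<psi> (last (b#xs))))"
    by simp
  have "holo (a#b#xs) x = mm (outer (\<psi> a) (\<psi> a)) (holo (b#xs) x)"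
    using 1 by simp
  then show ?case unfolding IH by (simp only: mm_outer) (simp add: mult.commute)
next
  case ("2_2" v)
  then show ?case by (simp add: mm_id scale_1)
qed simp

lemma trace_holo:
  assumes "\<And>v. v \<in> set vs \<Longrightarrow> dirproj (v - x) = outer (\<psi> v) (\<psi> v)" "vs \<noteq> []" "last vs = hd vs"
    "ip (\<psi> (hd vs)) (\<psi> (hd vs)) = 1"
  shows "tr (holo vs x) = (\<Prod>(v,w)\<leftarrow>links vs. ip (\<psi> v) (\<psi> w))"
  using holo_outer[OF assms(1,2)] assms(3,4) by (simp add: tr_outer)

lemma tr_dirproj: "a \<noteq> 0 \<Longrightarrow> tr (dirproj a) = 1"
  by (simp add: dirproj_def field_simps flip: of_real_add of_real_mult)

lemma tr_outer0: "tr (outer s s) = ip s s"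
  using tr_outer[of 1 s s] by (simp add: scale_1)

text \<open>A spinor for every direction but straight down.\<close>

lemma spinor_south:
  assumes "norm a + a$3 > 0"
  defines "s \<equiv> complex_of_real (1 / sqrt (2 * norm a * (norm a + a$3)))"
  shows "dirproj a = outer (s * of_real (norm a + a$3), s * hor a) (s * of_real (norm a + a$3), s * hor a)"
proof -
  have a: "a \<noteq> 0" using assms by auto
  then have pos: "2 * norm a * (norm a + a$3) > 0" using assms by auto
  have s2: "s * s = of_real (1 / (2 * norm a * (norm a + a$3)))"
    unfolding s_def of_real_mult[symmetric] using pos by (simp add: real_sqrt_mult flip: real_sqrt_mult)
  have h: "hor a * cnj (hor a) = of_real ((norm a - a$3) * (norm a + a$3))"
    using norm_hor[of a] complex_norm_square[of "hor a"] by (metis add_diff_cancel_right' power2_eq_square square_diff_square_factored mult.commute)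
  have fr: "1 / (2 * R * p) * (p * p) = p / (2 * R)" "1 / (2 * R * p) * p = 1 / (2 * R)"
    "1 / (2 * R * p) * (q * p) = q / (2 * R)" if "R > 0" "p > 0" for R p q :: real
    using that by (simp_all add: field_simps)
  have c: "cnj s = s" unfolding s_def by simp
  have e1: "s * of_real (norm a + a$3) * cnj (s * of_real (norm a + a$3)) = of_real ((norm a + a$3) / (2 * norm a))"
  proof -
    have "s * of_real (norm a + a$3) * cnj (s * of_real (norm a + a$3)) = (s * s) * of_real ((norm a + a$3) * (norm a + a$3))"
      by (simp add: c mult_ac)
    also have "\<dots> = of_real ((norm a + a$3) / (2 * norm a))"
      unfolding s2 h of_real_mult[symmetric] using a assms(1) by (intro arg_cong[where f=of_real] fr) auto
    finally show ?thesis .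
  qed
  have e2: "s * of_real (norm a + a$3) * cnj (s * hor a) = cnj (hor a) / of_real (2 * norm a)"
  proof -
    have "s * of_real (norm a + a$3) * cnj (s * hor a) = (s * s * of_real (norm a + a$3)) * cnj (hor a)"
      by (simp add: c mult_ac)
    also have "s * s * of_real (norm a + a$3) = of_real (1/(2 * norm a))"
      unfolding s2 h of_real_mult[symmetric] using a assms(1) by (intro arg_cong[where f=of_real] fr) auto
    finally show ?thesis by (simp add: field_simps)
  qed
  have e3: "s * hor a * cnj (s * of_real (norm a + a$3)) = hor a / of_real (2 * norm a)"
    using arg_cong[OF e2, of cnj] by (simp add: mult_ac c)
  have e4: "s * hor a * cnj (s * hor a) = of_real ((norm a - a$3) / (2 * norm a))"
  proof -
    have "s * hor a * cnj (s * hor a) = (s * s) * (hor a * cnj (hor a))" by (simp add: c mult_ac)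
    also have "\<dots> = of_real ((norm a - a$3) / (2 * norm a))"
      unfolding s2 h of_real_mult[symmetric] using a assms(1) by (intro arg_cong[where f=of_real] fr) auto
    finally show ?thesis .
  qed
  show ?thesis unfolding dirproj_def outer.simps e1 e2 e3 e4 ..
qed

lemma spinor_exists:
  assumes "a \<noteq> 0"
  shows "\<exists>\<psi>. dirproj a = outer \<psi> \<psi>"
proof (cases "norm a + a$3 > 0")
  case True then show ?thesis using spinor_south by blast
next
  case False
  have "\<bar>a$3\<bar> \<le> norm a" by (rule component_le_norm_cart)
  then have z: "a$3 = - norm a" using False by auto
  then have "hor a = 0" using norm_hor[of a] by simp
  with z assms have "dirproj a = outer (0,1) (0,1)" by (simp add: dirproj_def field_simps)
  then show ?thesis by blast
qed

lemma ip_zero_antipodal: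
  assumes "a \<noteq> 0" "b \<noteq> 0" "dirproj a = outer s s" "dirproj b = outer t t" "ip s t = 0"
  shows "norm b *\<^sub>R a + norm a *\<^sub>R b = 0"
proof -
  have "tr (mm (dirproj a) (dirproj b)) = ip s t * ip t s"
    unfolding assms(3,4) using mm_outer[of s s 1 t t] tr_outer[of "ip s t" s t] by (simp add: scale_1)
  then have 0: "tr (mm (dirproj a) (dirproj b)) = 0" using assms(5) by simp
  have "tr (mm (dirproj a) (dirproj b)) = of_real ((norm a * norm b + a \<bullet> b) / (2 * norm a * norm b))"
  proof -
    have i: "a \<bullet> b = a$1*b$1 + a$2*b$2 + a$3*b$3" by (simp add: inner_vec_def sum_3)
    show ?thesis unfolding dirproj_def i hor_def using assms(1,2)
      by (simp add: complex_eq_iff field_simps)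
  qed
  with 0 have "norm a * norm b + a \<bullet> b = 0" using assms(1,2) by (auto simp del: of_real_divide of_real_add of_real_mult)
  then have "a \<bullet> (- b) = norm a * norm (- b)" by simp
  then have "norm a *\<^sub>R (- b) = norm (-b) *\<^sub>R a" by (metis norm_cauchy_schwarz_eq)
  then show ?thesis by (metis add.right_inverse norm_minus_cancel scaleR_minus_right add.commute)
qed

lemma antipodal_segment:
  assumes "v \<noteq> x" "w \<noteq> x" "norm (w - x) *\<^sub>R (v - x) + norm (v - x) *\<^sub>R (w - x) = 0"
  shows "x \<in> closed_segment v w"
proof -
  let ?n = "norm (w - x) + norm (v - x)" let ?u = "norm (v - x) / ?n"
  have n: "?n > 0" using assms by (simp add: add_pos_pos)
  have "?n *\<^sub>R x = norm (w - x) *\<^sub>R v + norm (v - x) *\<^sub>R w"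
    using assms(3) by (simp add: algebra_simps)
  then have "(1/?n) *\<^sub>R (?n *\<^sub>R x) = (1/?n) *\<^sub>R (norm (w - x) *\<^sub>R v + norm (v - x) *\<^sub>R w)" by simp
  then have "x = (norm (w - x)/?n) *\<^sub>R v + ?u *\<^sub>R w" using n by (simp add: scaleR_add_right)
  moreover have "norm (w - x)/?n = 1 - ?u" using n by (simp add: field_simps)
  ultimately have "x = (1 - ?u) *\<^sub>R v + ?u *\<^sub>R w" by simp
  moreover have "0 \<le> ?u" "?u \<le> 1" using n by (auto simp: field_simps)
  ultimately show ?thesis unfolding in_segment by blast
qed

text \<open>The trace is a product of inner products of spinors of consecutive directions, and such an
  inner product vanishes only for opposite directions, in which case the point lies on an edge.\<close>

lemma trace_holo_nonzero:
  assumes "vs \<noteq> []" "last vs = hd vs" "x \<notin> set vs" "\<And>v w. (v,w) \<in> set (links vs) \<Longrightarrow> x \<notin> closed_segment v w"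
  shows "tr (holo vs x) \<noteq> 0"
proof -
  have "\<forall>v\<in>set vs. \<exists>\<psi>. dirproj (v - x) = outer \<psi> \<psi>" using assms(3) by (metis spinor_exists right_minus_eq)
  then obtain \<psi> where \<psi>: "\<And>v. v \<in> set vs \<Longrightarrow> dirproj (v - x) = outer (\<psi> v) (\<psi> v)" by metis
  have one: "ip (\<psi> v) (\<psi> v) = 1" if "v \<in> set vs" for v
    using tr_outer0[of "\<psi> v"] tr_dirproj[of "v - x"] \<psi>[OF that] that assms(3) by auto
  have sub: "v \<in> set vs \<and> w \<in> set vs" if "(v,w) \<in> set (links vs)" for v w
    using that by (induction vs rule: links.induct) auto
  have "(case p of (v,w) \<Rightarrow> ip (\<psi> v) (\<psi> w)) \<noteq> 0" if "p \<in> set (links vs)" for p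
  proof -
    obtain v w where p: "p = (v,w)" by force
    have vw: "v \<in> set vs" "w \<in> set vs" using sub that p by auto
    have ne: "v \<noteq> x" "w \<noteq> x" using vw assms(3) by auto
    show ?thesis using ip_zero_antipodal[OF _ _ \<psi>[OF vw(1)] \<psi>[OF vw(2)]] antipodal_segment[OF ne] assms(4) that p ne by auto
  qed
  then have "(\<Prod>p\<leftarrow>links vs. case p of (v,w) \<Rightarrow> ip (\<psi> v) (\<psi> w)) \<noteq> 0"
    by (auto simp: prod_list_zero_iff)
  moreover have "tr (holo vs x) = (\<Prod>(v,w)\<leftarrow>links vs. ip (\<psi> v) (\<psi> w))"
    using trace_holo[of vs x \<psi>] \<psi> assms(1,2) one by simp
  ultimately show ?thesis by simp
qed

section \<open>Continuity of the holonomy and its behaviour at infinity\<close>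

lemma mm_conv: "mm m n = (fst m * fst n + fst (snd m) * fst (snd (snd n)), fst m * fst (snd n) + fst (snd m) * snd (snd (snd n)),
   fst (snd (snd m)) * fst n + snd (snd (snd m)) * fst (snd (snd n)), fst (snd (snd m)) * fst (snd n) + snd (snd (snd m)) * snd (snd (snd n)))"
  by (cases m; cases n) simp

lemma tr_conv: "tr m = fst m + snd (snd (snd m))" by (cases m) simp

lemma continuous_on_dirproj: "continuous_on (- {v}) (\<lambda>x. dirproj (v - x))"
  unfolding dirproj_def by (auto intro!: continuous_intros)

lemma continuous_on_holo: "continuous_on (- set vs) (holo vs)"
proof (induction vs)
  case (Cons v vs)
  have "continuous_on (- set (v # vs)) (holo vs)" by (rule continuous_on_subset[OF Cons]) auto
  moreover have "continuous_on (- set (v # vs)) (\<lambda>x. dirproj (v - x))"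
    by (rule continuous_on_subset[OF continuous_on_dirproj]) auto
  ultimately have "continuous_on (- set (v # vs)) (\<lambda>x. mm (dirproj (v - x)) (holo vs x))"
    unfolding mm_conv by (intro continuous_intros)
  then show ?case by simp
qed (auto intro!: continuous_intros)

lemma continuous_on_trace_holo: "continuous_on (- set vs) (\<lambda>x. tr (holo vs x))"
  unfolding tr_conv by (intro continuous_intros continuous_on_holo)

text \<open>Seen from far away all vertices lie in the same direction.\<close>

lemma direction_diff:
  fixes a b :: "'a::real_normed_vector"
  assumes "a \<noteq> 0" "b \<noteq> 0"
  shows "norm (a /\<^sub>R norm a - b /\<^sub>R norm b) \<le> 2 * norm (a - b) / norm b"
proof -
  have "norm b *\<^sub>R (a /\<^sub>R norm a - b /\<^sub>R norm b) = (norm b - norm a) *\<^sub>R (a /\<^sub>R norm a) + (a - b)"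
    using assms by (simp add: algebra_simps)
  then have "norm b * norm (a /\<^sub>R norm a - b /\<^sub>R norm b) = norm ((norm b - norm a) *\<^sub>R (a /\<^sub>R norm a) + (a - b))"
    by (metis norm_scaleR abs_norm_cancel)
  also have "\<dots> \<le> norm ((norm b - norm a) *\<^sub>R (a /\<^sub>R norm a)) + norm (a - b)" by (rule norm_triangle_ineq)
  also have "norm ((norm b - norm a) *\<^sub>R (a /\<^sub>R norm a)) = \<bar>norm b - norm a\<bar>" using assms by (simp add: abs_mult)
  also have "\<bar>norm b - norm a\<bar> \<le> norm (a - b)" by (metis norm_minus_commute norm_triangle_ineq3)
  finally show ?thesis using assms by (simp add: field_simps)
qed

lemma dirproj_dir: "a \<noteq> 0 \<Longrightarrow> dirproj a = dirproj (a /\<^sub>R norm a)"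
  unfolding dirproj_def hor_def by (simp add: complex_eq_iff field_simps)

lemma dirproj_unit: "norm a = 1 \<Longrightarrow> dirproj a = (of_real ((1 + a$3)/2), cnj (hor a)/2, hor a/2, of_real ((1 - a$3)/2))"
  unfolding dirproj_def by simp

lemma bounded_linear_3: "bounded_linear (\<lambda>x::real^3. complex_of_real (x$3))"
  by (intro bounded_linear_compose[OF bounded_linear_of_real] bounded_linear_vec_nth)

lemma dirproj_far: "((\<lambda>x. dirproj (v - x) - dirproj (- x)) \<longlongrightarrow> 0) at_infinity"
proof -
  define D where "D x = (v - x) /\<^sub>R norm (v - x) - (- x) /\<^sub>R norm (- x)" for x :: "real^3"
  have ev: "\<forall>\<^sub>F x in at_infinity. norm x > norm v" using eventually_at_infinity_pos by (auto simp: eventually_at_infinity intro!: exI[of _ "norm v + 1"])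
  have D: "(D \<longlongrightarrow> 0) at_infinity"
  proof (rule Lim_null_comparison)
    show "\<forall>\<^sub>F x in at_infinity. norm (D x) \<le> 2 * norm v / norm x"
      using ev
    proof eventually_elim
      case (elim x)
      then have "v - x \<noteq> 0" "- x \<noteq> 0" by auto
      from direction_diff[OF this] show ?case unfolding D_def by simp
    qed
    show "((\<lambda>x. 2 * norm v / norm x) \<longlongrightarrow> 0) at_infinity"
      by (intro tendsto_divide_0[OF tendsto_const] filterlim_at_top_imp_at_infinity filterlim_norm_at_top)
  qed
  have "\<forall>\<^sub>F x in at_infinity. (complex_of_real (D x $3) / 2, cnj (hor (D x)) / 2, hor (D x) / 2, - (complex_of_real (D x $3) / 2)) = dirproj (v - x) - dirproj (- x)"
    using ev
  proof eventually_elim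
    case (elim x)
    then have ne: "v - x \<noteq> 0" "- x \<noteq> 0" by auto
    then have n: "norm ((v - x) /\<^sub>R norm (v - x)) = 1" "norm ((- x) /\<^sub>R norm (- x)) = 1" by auto
    show ?case unfolding dirproj_dir[OF ne(1)] dirproj_dir[OF ne(2)] dirproj_unit[OF n(1)] dirproj_unit[OF n(2)] D_def hor_diff
      by (simp add: diff_divide_distrib add_divide_distrib)
  qed
  moreover have "((\<lambda>x. (complex_of_real (D x $3) / 2, cnj (hor (D x)) / 2, hor (D x) / 2, - (complex_of_real (D x $3) / 2))) \<longlongrightarrow> (0,0,0,0)) at_infinity"
    using bounded_linear.tendsto_zero[OF bounded_linear_3 D] bounded_linear.tendsto_zero[OF bounded_linear_hor D]
      bounded_linear.tendsto_zero[OF bounded_linear_compose[OF bounded_linear_cnj bounded_linear_hor] D]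
      tendsto_minus[OF tendsto_divide_zero[OF bounded_linear.tendsto_zero[OF bounded_linear_3 D]], of 2]
    by (intro tendsto_Pair tendsto_divide_zero) simp_all
  ultimately show ?thesis unfolding zero_prod_def by (rule Lim_transform_eventually[rotated])
qed

lemma mm_bounded_bilinear: "bounded_bilinear mm"
proof
  show "\<exists>K. \<forall>a b. norm (mm a b) \<le> norm a * norm b * K"
  proof (intro exI allI)
    fix a b :: mat2
    have c: "norm (fst m) \<le> norm m" "norm (fst (snd m)) \<le> norm m" "norm (fst (snd (snd m))) \<le> norm m"
      "norm (snd (snd (snd m))) \<le> norm m" for m :: mat2
      by (cases m; force intro: order_trans[OF norm_fst_le] order_trans[OF norm_snd_le] order_trans[OF norm_fst_le norm_snd_le])+
    have p: "norm (x * y + x' * y') \<le> 2 * (norm a * norm b)" if "norm x \<le> norm a" "norm x' \<le> norm a" "norm y \<le> norm b" "norm y' \<le> norm b"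
      for x y x' y' :: complex
    proof -
      have "norm (x * y + x' * y') \<le> norm x * norm y + norm x' * norm y'" by (metis norm_mult norm_triangle_ineq)
      also have "\<dots> \<le> norm a * norm b + norm a * norm b" using that by (intro add_mono mult_mono) auto
      finally show ?thesis by simp
    qed
    have q: "norm m \<le> norm (fst m) + norm (fst (snd m)) + norm (fst (snd (snd m))) + norm (snd (snd (snd m)))" for m :: mat2
      using norm_Pair_le[of "fst m" "snd m"] norm_Pair_le[of "fst (snd m)" "snd (snd m)"] norm_Pair_le[of "fst (snd (snd m))" "snd (snd (snd m))"]
      by simp
    have "norm (mm a b) \<le> 2 * (norm a * norm b) + 2 * (norm a * norm b) + 2 * (norm a * norm b) + 2 * (norm a * norm b)"
      by (rule order_trans[OF q], unfold mm_conv fst_conv snd_conv) (intro add_mono p c)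
    then show "norm (mm a b) \<le> norm a * norm b * 8" by simp
  qed
qed (simp_all add: mm_conv prod_eq_iff algebra_simps scaleR_conv_of_real)

lemma dirproj_idem: "a \<noteq> 0 \<Longrightarrow> mm (dirproj a) (dirproj a) = dirproj a"
proof -
  assume a: "a \<noteq> 0"
  then obtain s where s: "dirproj a = outer s s" using spinor_exists by blast
  have "ip s s = 1" using tr_dirproj[OF a] unfolding s tr_outer0 .
  then show ?thesis unfolding s using mm_outer[of s s 1 s s] by (simp add: scale_1)
qed

lemma dirproj_bounded: "Bfun (\<lambda>x. dirproj (- x)) F"
proof (rule BfunI)
  have "norm (dirproj a) \<le> 4" for a
  proof -
    have c: "\<bar>a$3\<bar> \<le> norm a" "cmod (hor a) \<le> norm a"
      using component_le_norm_cart[of a 3] norm_hor[of a] by (auto intro: power2_le_imp_le)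
    have "norm (fst (dirproj a)) \<le> 1" "norm (fst (snd (dirproj a))) \<le> 1"
      "norm (fst (snd (snd (dirproj a)))) \<le> 1" "norm (snd (snd (snd (dirproj a)))) \<le> 1"
      using c by (auto simp: dirproj_def norm_divide norm_mult divide_le_eq simp flip: of_real_add of_real_diff)
    moreover have "norm m \<le> norm (fst m) + norm (fst (snd m)) + norm (fst (snd (snd m))) + norm (snd (snd (snd m)))" for m :: mat2
      using norm_Pair_le[of "fst m" "snd m"] norm_Pair_le[of "fst (snd m)" "snd (snd m)"] norm_Pair_le[of "fst (snd (snd m))" "snd (snd (snd m))"]
      by simp
    moreover note this[of "dirproj a"]
    ultimately show ?thesis by linarith
  qed
  then show "\<forall>\<^sub>F x in F. norm (dirproj (- x)) \<le> 4" by simp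
qed

text \<open>From far away all projections nearly agree with the one for \<open>- x\<close>, and a projection is
  idempotent.\<close>

lemma holo_far:
  assumes "vs \<noteq> []"
  shows "Zfun (\<lambda>x. holo vs x - dirproj (- x)) at_infinity"
  using assms
proof (induction vs rule: list_nonempty_induct)
  case (single v)
  then show ?case using dirproj_far[of v] by (simp add: mm_id tendsto_Zfun_iff)
next
  case (cons v vs)
  interpret bounded_bilinear mm by (rule mm_bounded_bilinear)
  let ?P = "\<lambda>x. dirproj (- x)" and ?M = "\<lambda>x. holo vs x - dirproj (- x)" and ?V = "\<lambda>x. dirproj (v - x) - dirproj (- x)"
  have V: "Zfun ?V at_infinity" using dirproj_far[of v] by (simp add: tendsto_Zfun_iff)
  have "Zfun (\<lambda>x. mm (?V x) (?M x) + mm (?V x) (?P x) + mm (?P x) (?M x)) at_infinity"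
    using Zfun_add[OF Zfun_add[OF Zfun[OF V cons.IH] Zfun_prod_Bfun[OF V dirproj_bounded]] Bfun_prod_Zfun[OF dirproj_bounded cons.IH]] .
  then have "((\<lambda>x. mm (?V x) (?M x) + mm (?V x) (?P x) + mm (?P x) (?M x)) \<longlongrightarrow> 0) at_infinity"
    by (simp only: tendsto_Zfun_iff diff_zero)
  moreover have "\<forall>\<^sub>F x in at_infinity. x \<noteq> (0::real^3)"
    by (auto simp: eventually_at_infinity intro!: exI[of _ 1])
  then have "\<forall>\<^sub>F x in at_infinity. mm (?V x) (?M x) + mm (?V x) (?P x) + mm (?P x) (?M x) = holo (v # vs) x - ?P x"
  proof eventually_elim
    case (elim x)
    then show ?case using dirproj_idem[of "- x"] by (simp add: diff_left diff_right algebra_simps)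
  qed
  ultimately have "((\<lambda>x. holo (v # vs) x - ?P x) \<longlongrightarrow> 0) at_infinity"
    by (rule Lim_transform_eventually)
  then show ?case by (simp only: tendsto_Zfun_iff diff_zero)
qed

lemma bounded_linear_tr: "bounded_linear tr"
proof -
  have "bounded_linear (\<lambda>m::mat2. fst m + snd (snd (snd m)))"
    by (intro bounded_linear_add bounded_linear_fst bounded_linear_snd bounded_linear_compose[OF bounded_linear_snd bounded_linear_compose[OF bounded_linear_snd bounded_linear_snd]])
  then show ?thesis by (simp add: tr_conv[abs_def])
qed

text \<open>This limit extends the trace continuously to the point at infinity of the 3-sphere.\<close>

lemma trace_holo_far:
  assumes "vs \<noteq> []"
  shows "((\<lambda>x. tr (holo vs x)) \<longlongrightarrow> 1) at_infinity"
proof -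
  have "((\<lambda>x. holo vs x - dirproj (- x)) \<longlongrightarrow> 0) at_infinity"
    using holo_far[OF assms] by (simp add: tendsto_Zfun_iff)
  then have "((\<lambda>x. tr (holo vs x - dirproj (- x)) + 1) \<longlongrightarrow> 0 + 1) at_infinity"
    by (intro tendsto_add tendsto_const bounded_linear.tendsto_zero[OF bounded_linear_tr])
  moreover have "\<forall>\<^sub>F x in at_infinity. x \<noteq> (0::real^3)"
    by (auto simp: eventually_at_infinity intro!: exI[of _ 1])
  then have "\<forall>\<^sub>F x in at_infinity. tr (holo vs x - dirproj (- x)) + 1 = tr (holo vs x)"
    by eventually_elim (simp add: linear_diff[OF bounded_linear.linear[OF bounded_linear_tr]] tr_dirproj)
  ultimately show ?thesis using Lim_transform_eventually by fastforce
qed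

section \<open>Crossings and square roots of the holonomy\<close>

text \<open>Up to a positive factor, the inner product of the spinors that belong to the directions from
  \<open>x\<close> to \<open>c\<close> and from \<open>x\<close> to \<open>d\<close>. Its imaginary part is twice the signed area of the triangle
  with these three vertices in the horizontal plane.\<close>

definition seen :: "real^3 \<Rightarrow> real^3 \<Rightarrow> real^3 \<Rightarrow> complex" where
  "seen c d x = of_real ((norm (c - x) + (c - x)$3) * (norm (d - x) + (d - x)$3)) + cnj (hor (c - x)) * hor (d - x)"

definition over :: "(real^3) \<times> (real^3) \<Rightarrow> (real^3) \<times> (real^3) \<Rightarrow> bool" where
  "over e f \<longleftrightarrow> (\<exists>x\<in>closed_segment (fst e) (snd e). \<exists>y\<in>closed_segment (fst f) (snd f). hor x = hor y \<and> x$3 > y$3)"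

lemma continuous_on_seen: "continuous_on S (seen c d)"
  unfolding seen_def by (intro continuous_intros)

lemma norm_plus_height_pos: "hor a \<noteq> 0 \<Longrightarrow> norm a + a$3 > 0"
proof -
  assume "hor a \<noteq> 0"
  then have "(a$3)\<^sup>2 < (norm a)\<^sup>2" unfolding norm_hor by simp
  then have "\<bar>a$3\<bar> < norm a" by (metis abs_norm_cancel abs_square_less_1 power2_less_imp_less norm_ge_zero power2_abs)
  then show ?thesis by linarith
qed

text \<open>Writing the height as a hyperbolic sine turns the sign of \<open>seen\<close> at a vertical crossing into
  a comparison of two slopes.\<close>

lemma norm_plus_height:
  assumes "hor a \<noteq> 0"
  shows "norm a + a$3 = cmod (hor a) * exp (arsinh (a$3 / cmod (hor a)))"
proof -
  let ?m = "cmod (hor a)" let ?p = "a$3 / ?m"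
  have m: "?m > 0" using assms by simp
  have "norm a = ?m * sqrt (?p\<^sup>2 + 1)"
  proof (rule power2_eq_imp_eq)
    show "(norm a)\<^sup>2 = (?m * sqrt (?p\<^sup>2 + 1))\<^sup>2"
      using m unfolding norm_hor by (simp add: power_mult_distrib field_simps)
  qed (use m in auto)
  moreover have "?p + sqrt (?p\<^sup>2 + 1) > 0" by (rule arsinh_real_aux)
  ultimately show ?thesis using m by (simp add: arsinh_real_def algebra_simps)
qed

text \<open>Below, \<open>y\<close> is the point of the segment met by the vertical line through \<open>x\<close>.\<close>

text \<open>When \<open>x\<close> lies vertically above or below a point \<open>y\<close> of the segment, \<open>seen\<close> is real, and it
  is negative exactly if \<open>x\<close> is the upper point.\<close>

lemma seen_vertical:
  assumes "u \<in> {0..1}" "y = (1 - u) *\<^sub>R c + u *\<^sub>R d" "hor y = hor x" "hor c \<noteq> hor x" "hor d \<noteq> hor x"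
  shows "Im (seen c d x) = 0" "Re (cnj (hor (c - x)) * hor (d - x)) < 0"
    "Re (seen c d x) < 0 \<longleftrightarrow> y$3 < x$3" "Re (seen c d x) = 0 \<longleftrightarrow> y$3 = x$3"
proof -
  define hc hd where "hc = hor (c - x)" and "hd = hor (d - x)"
  have nz: "hc \<noteq> 0" "hd \<noteq> 0" using assms(4,5) by (auto simp: hc_def hd_def hor_diff)
  have yx: "y - x = (1 - u) *\<^sub>R (c - x) + u *\<^sub>R (d - x)" unfolding assms(2) by (simp add: algebra_simps)
  have "hor (y - x) = 0" using assms(3) by (simp add: hor_diff)
  then have 0: "(1 - u) *\<^sub>R hc + u *\<^sub>R hd = 0" unfolding yx hc_def hd_def
    by (simp add: linear_add[OF linear_hor] linear_scale[OF linear_hor])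
  have u: "u > 0" "u < 1" using 0 nz assms(1) by (auto simp: less_le)
  have "u *\<^sub>R hd = - ((1 - u) *\<^sub>R hc)" using 0 by (simp add: eq_neg_iff_add_eq_0 add.commute)
  then have "(1/u) *\<^sub>R (u *\<^sub>R hd) = (1/u) *\<^sub>R (- ((1 - u) *\<^sub>R hc))" by simp
  then have hd: "hd = of_real (- ((1 - u) / u)) * hc" using u by (simp add: scaleR_conv_of_real)
  define mu where "mu = (1 - u) / u"
  have mu: "mu > 0" using u by (simp add: mu_def)
  have hd': "hd = of_real (- mu) * hc" unfolding hd mu_def ..
  have prod: "cnj hc * hd = of_real (- (cmod hc * cmod hd))"
    unfolding hd' using mu complex_norm_square[of hc] by (simp add: norm_mult power2_eq_square mult_ac)
  have pos: "cmod hc * cmod hd > 0" using nz by simp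
  show "Im (seen c d x) = 0" "Re (cnj (hor (c - x)) * hor (d - x)) < 0"
    using prod pos unfolding seen_def hc_def[symmetric] hd_def[symmetric] by simp_all
  define p q where "p = (c - x)$3 / cmod hc" and "q = (d - x)$3 / cmod hd"
  have re: "Re (seen c d x) = cmod hc * cmod hd * (exp (arsinh p + arsinh q) - 1)"
    unfolding seen_def norm_plus_height[OF nz(1)[unfolded hc_def]] norm_plus_height[OF nz(2)[unfolded hd_def]] 
      hc_def[symmetric] hd_def[symmetric] prod p_def[symmetric] q_def[symmetric] exp_add by (simp add: algebra_simps)
  have mhd: "cmod hd = mu * cmod hc" unfolding hd' using mu by (simp add: norm_mult)
  have umu: "u * mu = 1 - u" using u by (simp add: mu_def)
  have "(y - x)$3 = (1 - u) * (c - x)$3 + u * (d - x)$3" unfolding yx by simp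
  also have "\<dots> = (1 - u) * cmod hc * (p + q)"
  proof -
    have "u * (d - x)$3 = u * mu * cmod hc * q" unfolding q_def mhd using nz mu by simp
    moreover have "(c - x)$3 = cmod hc * p" unfolding p_def using nz by simp
    ultimately show ?thesis unfolding umu by (simp add: algebra_simps)
  qed
  finally have h: "y$3 - x$3 = (1 - u) * cmod hc * (p + q)" by simp
  have k: "(1 - u) * cmod hc > 0" using u nz by simp
  have "p < - q \<longleftrightarrow> arsinh p + arsinh q < 0" "p = - q \<longleftrightarrow> arsinh p + arsinh q = 0"
    using arsinh_less_iff_real[of p "-q"] arsinh_minus_real[of q] arsinh_less_iff_real[of "-q" p] by linarith+
  moreover have "P * s < 0 \<longleftrightarrow> s < 0" "P * s = 0 \<longleftrightarrow> s = 0" if "P > 0" for P s :: real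
    using that by (simp_all add: mult_less_0_iff)
  note this[OF k, of "p + q", folded h] this[OF pos, of "exp (arsinh p + arsinh q) - 1", folded re]
  ultimately show "Re (seen c d x) < 0 \<longleftrightarrow> y$3 < x$3" "Re (seen c d x) = 0 \<longleftrightarrow> y$3 = x$3"
    by simp_all linarith+
qed

lemma vertical_point:
  assumes "Im (seen c d x) = 0" "Re (seen c d x) \<le> 0" "hor c \<noteq> hor x" "hor d \<noteq> hor x"
  obtains u where "u \<in> {0..1}" "hor ((1 - u) *\<^sub>R c + u *\<^sub>R d) = hor x"
proof -
  define hc hd where "hc = hor (c - x)" and "hd = hor (d - x)"
  have nz: "hc \<noteq> 0" "hd \<noteq> 0" using assms(3,4) by (auto simp: hc_def hd_def hor_diff)
  let ?P = "(norm (c - x) + (c - x)$3) * (norm (d - x) + (d - x)$3)"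
  have P: "?P > 0" using nz unfolding hc_def hd_def by (intro mult_pos_pos norm_plus_height_pos)
  define lam where "lam = Re (cnj hc * hd)"
  have sn: "seen c d x = of_real ?P + cnj hc * hd" unfolding seen_def hc_def hd_def ..
  have im: "Im (cnj hc * hd) = 0" using assms(1) unfolding sn plus_complex.sel Im_complex_of_real by linarith
  have re: "lam < 0" using assms(2) P unfolding sn plus_complex.sel Re_complex_of_real lam_def by linarith
  have w: "cnj hc * hd = of_real lam" using im by (intro complex_eqI) (simp_all only: lam_def Re_complex_of_real Im_complex_of_real)
  have "of_real ((cmod hc)\<^sup>2) * hd = hc * (cnj hc * hd)"
    unfolding complex_norm_square by (simp only: mult.assoc)
  then have e: "of_real ((cmod hc)\<^sup>2) * hd = of_real lam * hc" unfolding w by (simp only: mult.commute)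
  define u where "u = (cmod hc)\<^sup>2 / ((cmod hc)\<^sup>2 - lam)"
  have n: "(cmod hc)\<^sup>2 - lam > 0" using re zero_le_power2[of "cmod hc"] by linarith
  have u: "u \<in> {0..1}" unfolding u_def using n re by (auto simp: field_simps)
  have u1: "1 - u = - lam / ((cmod hc)\<^sup>2 - lam)" unfolding u_def using n by (simp add: field_simps)
  have "(1 - u) *\<^sub>R hc + u *\<^sub>R hd = (1 / ((cmod hc)\<^sup>2 - lam)) *\<^sub>R ((cmod hc)\<^sup>2 *\<^sub>R hd - lam *\<^sub>R hc)"
    unfolding u1 unfolding u_def scaleR_diff_right scaleR_scaleR by simp
  also have "\<dots> = 0" using e unfolding scaleR_conv_of_real by simp
  finally have "hor ((1 - u) *\<^sub>R (c - x) + u *\<^sub>R (d - x)) = 0"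
    unfolding hc_def hd_def by (simp add: linear_add[OF linear_hor] linear_scale[OF linear_hor])
  then have "hor (((1 - u) *\<^sub>R c + u *\<^sub>R d) - x) = 0" by (simp add: algebra_simps)
  then show ?thesis using that[OF u] by (simp add: hor_diff)
qed

lemma eq_by_hor: "hor x = hor y \<Longrightarrow> x$3 = y$3 \<Longrightarrow> x = y" for x y :: "real^3"
  by (simp add: hor_def vec_eq_iff forall_3)

lemma seen_nonzero:
  assumes "x \<notin> closed_segment c d" "hor c \<noteq> hor x" "hor d \<noteq> hor x"
  shows "seen c d x \<noteq> 0"
proof
  assume 0: "seen c d x = 0"
  obtain u where u: "u \<in> {0..1}" "hor ((1 - u) *\<^sub>R c + u *\<^sub>R d) = hor x"
    by (rule vertical_point[of c d x]) (use 0 assms in auto)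
  from seen_vertical(4)[OF u(1) refl u(2) assms(2,3)] 0 have "(1 - u) *\<^sub>R c + u *\<^sub>R d = x"
    by (intro eq_by_hor u(2)) simp
  with u(1) assms(1) show False unfolding in_segment by auto
qed

lemma Im_seen_affine:
  "Im (seen c d ((1 - t) *\<^sub>R k + t *\<^sub>R k')) = (1 - t) * Im (seen c d k) + t * Im (seen c d k')"
proof -
  have im: "Im (seen c d x) = (c$1 * d$2 - c$2 * d$1) + (c$2 - d$2) * x$1 + (d$1 - c$1) * x$2" for x
  proof -
    have "Im (cnj (Complex p q) * Complex r s) = p * s - q * r" for p q r s by simp
    then have "Im (seen c d x) = (c$1 - x$1) * (d$2 - x$2) + (x$2 - c$2) * (d$1 - x$1)"
      unfolding seen_def hor_def by simp
    then show ?thesis by (simp only: left_diff_distrib right_diff_distrib) (simp add: mult.commute)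
  qed
  have "A + B * ((1 - t) * p + t * p') + C * ((1 - t) * q + t * q') = (1 - t) * (A + B * p + C * q) + t * (A + B * p' + C * q')"
    for A B C p p' q q' :: real by (simp add: algebra_simps)
  then show ?thesis unfolding im vector_add_component vector_scaleR_component real_scaleR_def by blast
qed

text \<open>Along a segment from \<open>k\<close> to \<open>k'\<close> the imaginary part of \<open>seen\<close> is affine, so it has at most
  one zero. The principal square root is continuous along the segment unless the values cross the
  negative axis there, which means that the segment passes over the edge; in that case the
  continuous root arrives with the other sign.\<close>

lemma root_flip:
  assumes off: "\<And>x. x \<in> closed_segment k k' \<Longrightarrow> x \<notin> closed_segment c d \<and> hor c \<noteq> hor x \<and> hor d \<noteq> hor x"
    and im: "Im (seen c d k) \<noteq> 0" "Im (seen c d k') \<noteq> 0"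
  shows "\<exists>R. continuous_on (closed_segment k k') R \<and> (\<forall>x\<in>closed_segment k k'. R x ^ 2 = seen c d x) \<and>
    R k = csqrt (seen c d k) \<and> R k' = (if over (k,k') (c,d) then -1 else 1) * csqrt (seen c d k')"
proof (cases "\<exists>x\<in>closed_segment k k'. seen c d x \<in> \<real>\<^sub>\<le>\<^sub>0")
  case False
  have "\<not> over (k,k') (c,d)"
  proof
    assume "over (k,k') (c,d)"
    then obtain x y where xy: "x \<in> closed_segment k k'" "y \<in> closed_segment c d" "hor x = hor y" "x$3 > y$3"
      unfolding over_def by auto
    from xy(2) obtain u where u: "u \<in> {0..1}" "y = (1 - u) *\<^sub>R c + u *\<^sub>R d" unfolding in_segment by auto
    have "Im (seen c d x) = 0" "Re (seen c d x) < 0"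
      using seen_vertical(1,3)[OF u xy(3)[symmetric]] off[OF xy(1)] xy(4) by blast+
    then have "seen c d x \<in> \<real>\<^sub>\<le>\<^sub>0" by (simp add: complex_nonpos_Reals_iff)
    with False xy(1) show False by auto
  qed
  moreover have "continuous_on (closed_segment k k') (\<lambda>x. csqrt (seen c d x))"
    by (rule continuous_on_compose2[OF continuous_on_csqrt continuous_on_seen]) (use False in auto)
  ultimately show ?thesis by (intro exI[of _ "\<lambda>x. csqrt (seen c d x)"]) auto
next
  case True
  then obtain x0 where x0: "x0 \<in> closed_segment k k'" "Im (seen c d x0) = 0" "Re (seen c d x0) \<le> 0"
    by (auto simp: complex_nonpos_Reals_iff)
  have off0: "x0 \<notin> closed_segment c d" "hor c \<noteq> hor x0" "hor d \<noteq> hor x0" using off[OF x0(1)] by auto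
  have neg: "Re (seen c d x0) < 0" 
  proof -
    have "Re (seen c d x0) \<noteq> 0" using x0(2) seen_nonzero[OF off0] complex_eqI[of "seen c d x0" 0] by auto
    then show ?thesis using x0(3) by simp
  qed
  obtain u where u: "u \<in> {0..1}" "hor ((1 - u) *\<^sub>R c + u *\<^sub>R d) = hor x0"
    by (rule vertical_point[OF x0(2,3) off0(2,3)])
  have ov: "over (k,k') (c,d)"
    unfolding over_def fst_conv snd_conv
  proof (intro bexI conjI)
    show "hor x0 = hor ((1 - u) *\<^sub>R c + u *\<^sub>R d)" using u(2) by simp
    show "x0$3 > ((1 - u) *\<^sub>R c + u *\<^sub>R d)$3"
      using seen_vertical(3)[OF u(1) refl u(2) off0(2,3)] neg by simp
    show "(1 - u) *\<^sub>R c + u *\<^sub>R d \<in> closed_segment c d" using u(1) unfolding in_segment by auto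
  qed (rule x0(1))
  obtain t0 where t0: "0 \<le> t0" "t0 \<le> 1" "x0 = (1 - t0) *\<^sub>R k + t0 *\<^sub>R k'" using x0(1) unfolding in_segment by auto
  let ?A = "Im (seen c d k)" and ?B = "Im (seen c d k')"
  have z0: "(1 - t0) * ?A + t0 * ?B = 0" using x0(2) unfolding t0(3) Im_seen_affine .
  have t01: "0 < t0" "t0 < 1" using z0 im t0(1,2) by (cases "t0 = 0"; cases "t0 = 1"; simp)+
  have opp: "?A * ?B < 0"
  proof -
    have "?B = - ((1 - t0) / t0) * ?A" using z0 t01 by (simp add: field_simps)
    then have "?A * ?B = - ((1 - t0) / t0 * (?A * ?A))" by simp
    moreover have "(1 - t0) / t0 * (?A * ?A) > 0" using t01 im(1) by (intro mult_pos_pos[OF divide_pos_pos]) (simp_all flip: power2_eq_square)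
    ultimately show ?thesis by linarith
  qed
  have nn: "- seen c d x \<notin> \<real>\<^sub>\<le>\<^sub>0" if xK: "x \<in> closed_segment k k'" for x
  proof
    assume "- seen c d x \<in> \<real>\<^sub>\<le>\<^sub>0"
    then have x: "Im (seen c d x) = 0" "Re (seen c d x) \<ge> 0" by (auto simp: complex_nonpos_Reals_iff)
    obtain t where t: "x = (1 - t) *\<^sub>R k + t *\<^sub>R k'" using xK unfolding in_segment by blast
    have "(1 - t) * ?A + t * ?B = 0" using x(1) unfolding t Im_seen_affine .
    with z0 have "(t - t0) * (?A - ?B) = 0" by (simp add: algebra_simps)
    moreover have "?A \<noteq> ?B" using opp by (metis not_square_less_zero)
    ultimately have "t = t0" by simp
    with t t0(3) x(2) neg show False by simp
  qed
  let ?s = "if ?A < 0 then - \<i> else \<i>"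
  let ?R = "\<lambda>x. ?s * csqrt (- seen c d x)"
  have m1: "\<i> * csqrt (- z) = - csqrt z" if "Im z < 0" for z
    using csqrt_minus[of z] that by (simp add: mult.assoc[symmetric])
  have m2: "\<i> * csqrt (- z) = csqrt z" if "Im z > 0" for z
    using csqrt_minus[of "- z"] that by (simp only: minus_minus) simp
  have "continuous_on (closed_segment k k') (\<lambda>x. csqrt (- seen c d x))"
    by (rule continuous_on_compose2[OF continuous_on_csqrt continuous_on_minus[OF continuous_on_seen]]) (use nn in auto)
  then have Rc: "continuous_on (closed_segment k k') ?R" by (intro continuous_on_mult continuous_on_const)
  have R2: "?R x ^ 2 = seen c d x" for x by (simp add: power_mult_distrib)
  have Rk: "?R k = csqrt (seen c d k)"
  proof (cases "?A < 0")
    case True then show ?thesis using m1[OF True] by simp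
  next
    case False
    then have "?A > 0" using im by simp
    from m2[OF this] False show ?thesis by simp
  qed
  have Rk': "?R k' = - csqrt (seen c d k')"
  proof (cases "?A < 0")
    case True
    then have "?B > 0" using opp by (simp add: mult_less_0_iff)
    from m2[OF this] True show ?thesis by simp
  next
    case False
    then have "?B < 0" using opp im(1) by (simp add: mult_less_0_iff)
    from m1[OF this] False show ?thesis by simp
  qed
  have Rk'': "?R k' = (if over (k, k') (c, d) then - 1 else 1) * csqrt (seen c d k')"
    unfolding Rk' using ov by simp
  show ?thesis
    by (rule exI[of _ ?R]) (intro conjI ballI Rc R2 Rk Rk'')
qed

definition genpos :: "(real^3) list \<Rightarrow> (real^3) list \<Rightarrow> bool" where
  "genpos ks ls \<longleftrightarrow> (\<forall>(k,k')\<in>set (links ks). \<forall>x\<in>closed_segment k k'. \<forall>l\<in>set ls. hor l \<noteq> hor x) \<and>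
     (\<forall>k\<in>set ks. \<forall>(c,d)\<in>set (links ls). Im (seen c d k) \<noteq> 0)"

lemma links_subset: "(v,w) \<in> set (links vs) \<Longrightarrow> v \<in> set vs \<and> w \<in> set vs"
  by (induction vs rule: links.induct) auto

lemma trace_holo_seen:
  assumes "ls \<noteq> []" "last ls = hd ls" "\<And>l. l \<in> set ls \<Longrightarrow> hor l \<noteq> hor x"
  obtains \<rho> :: real where "\<rho> > 0" "tr (holo ls x) = of_real \<rho> * (\<Prod>(c,d)\<leftarrow>links ls. seen c d x)"
proof -
  define s where "s a = 1 / sqrt (2 * norm a * (norm a + a$3))" for a :: "real^3"
  define \<psi> where "\<psi> v = (complex_of_real (s (v - x)) * of_real (norm (v - x) + (v - x)$3), complex_of_real (s (v - x)) * hor (v - x))" for v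
  have np: "norm (v - x) + (v - x)$3 > 0" if "v \<in> set ls" for v
    using assms(3)[OF that] by (intro norm_plus_height_pos) (simp add: hor_diff)
  have sp: "s (v - x) > 0" if "v \<in> set ls" for v
    using np[OF that] assms(3)[OF that] unfolding s_def
    by (intro divide_pos_pos real_sqrt_gt_zero mult_pos_pos) auto
  have \<psi>: "dirproj (v - x) = outer (\<psi> v) (\<psi> v)" if "v \<in> set ls" for v
    using spinor_south[OF np[OF that]] unfolding \<psi>_def s_def .
  have hd: "hd ls \<in> set ls" using assms(1) by simp
  then have "hd ls \<noteq> x" using assms(3) by blast
  then have "ip (\<psi> (hd ls)) (\<psi> (hd ls)) = 1"
    using tr_dirproj[of "hd ls - x"] unfolding \<psi>[OF hd] tr_outer0 by simp
  from trace_holo[OF \<psi> assms(1,2) this]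
  have tr: "tr (holo ls x) = (\<Prod>(v,w)\<leftarrow>links ls. ip (\<psi> v) (\<psi> w))" by simp
  have ip: "ip (\<psi> c) (\<psi> d) = of_real (s (c - x) * s (d - x)) * seen c d x" for c d
  proof -
    have "cnj (complex_of_real s1 * of_real p1) * (of_real s2 * of_real p2) + cnj (of_real s1 * h1) * (of_real s2 * h2) =
      of_real (s1 * s2) * (of_real (p1 * p2) + cnj h1 * h2)" for s1 s2 p1 p2 h1 h2
      by (simp add: distrib_left mult_ac)
    then show ?thesis unfolding \<psi>_def seen_def ip.simps .
  qed
  define \<rho> where "\<rho> = (\<Prod>(c,d)\<leftarrow>links ls. s (c - x) * s (d - x))"
  have "tr (holo ls x) = of_real \<rho> * (\<Prod>(c,d)\<leftarrow>links ls. seen c d x)"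
  proof -
    have "(\<Prod>(v,w)\<leftarrow>ps. ip (\<psi> v) (\<psi> w)) = of_real (\<Prod>(c,d)\<leftarrow>ps. s (c - x) * s (d - x)) * (\<Prod>(c,d)\<leftarrow>ps. seen c d x)" for ps
      by (induction ps) (simp_all add: ip case_prod_beta)
    then show ?thesis unfolding tr \<rho>_def .
  qed
  moreover have "\<rho> > 0" unfolding \<rho>_def
  proof -
    have "\<forall>p\<in>set ps. fst p \<in> set ls \<and> snd p \<in> set ls \<Longrightarrow> (\<Prod>(c,d)\<leftarrow>ps. s (c - x) * s (d - x)) > 0" for ps
      by (induction ps) (auto simp: sp)
    then show "(\<Prod>(c,d)\<leftarrow>links ls. s (c - x) * s (d - x)) > 0" using links_subset[of _ _ ls] by fastforce
  qed
  ultimately show ?thesis using that by blast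
qed

lemma real_square_pos: "q ^ 2 = of_real r \<Longrightarrow> r > 0 \<Longrightarrow> Re q \<noteq> 0" for q :: complex
proof
  assume q: "q ^ 2 = of_real r" "r > 0" "Re q = 0"
  have "Re (q ^ 2) = - ((Im q)\<^sup>2)" using q(3) by (simp add: power2_eq_square)
  then show False using arg_cong[OF q(1), of Re] q(2) zero_le_power2[of "Im q"] by simp
qed

definition root :: "(real^3) list \<Rightarrow> real^3 \<Rightarrow> complex" where
  "root ls x = (\<Prod>(c,d)\<leftarrow>links ls. csqrt (seen c d x))"

text \<open>Compares a continuous square root of the trace with the product of the principal roots of its
  factors: their quotient has a real part of constant sign except for one change for every edge
  that is passed over.\<close>

lemma sign_flip:
  assumes ls: "ls \<noteq> []" "last ls = hd ls"
    and S: "continuous_on (closed_segment k k') S" "\<And>x. x \<in> closed_segment k k' \<Longrightarrow> S x ^ 2 = tr (holo ls x)"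
    and off: "\<And>x c d. x \<in> closed_segment k k' \<Longrightarrow> (c,d) \<in> set (links ls) \<Longrightarrow> x \<notin> closed_segment c d"
    and gen: "\<And>x l. x \<in> closed_segment k k' \<Longrightarrow> l \<in> set ls \<Longrightarrow> hor l \<noteq> hor x"
    and im: "\<And>c d. (c,d) \<in> set (links ls) \<Longrightarrow> Im (seen c d k) \<noteq> 0 \<and> Im (seen c d k') \<noteq> 0"
  shows "sgn (Re (S k / root ls k)) \<noteq> 0"
    "sgn (Re (S k' / root ls k')) = (-1) ^ (\<Sum>f\<leftarrow>links ls. of_bool (over (k,k') f)) * sgn (Re (S k / root ls k))"
proof -
  let ?K = "closed_segment k k'"
  have "\<exists>R. continuous_on ?K R \<and> (\<forall>x\<in>?K. R x ^ 2 = seen (fst f) (snd f) x) \<and>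
    R k = csqrt (seen (fst f) (snd f) k) \<and> R k' = (if over (k,k') f then -1 else 1) * csqrt (seen (fst f) (snd f) k')"
    if "f \<in> set (links ls)" for f
    using root_flip[of k k' "fst f" "snd f"] off gen im that links_subset[of "fst f" "snd f" ls] by simp
  then obtain R where R: "\<And>f. f \<in> set (links ls) \<Longrightarrow> continuous_on ?K (R f)"
    "\<And>f x. f \<in> set (links ls) \<Longrightarrow> x \<in> ?K \<Longrightarrow> R f x ^ 2 = seen (fst f) (snd f) x"
    "\<And>f. f \<in> set (links ls) \<Longrightarrow> R f k = csqrt (seen (fst f) (snd f) k)"
    "\<And>f. f \<in> set (links ls) \<Longrightarrow> R f k' = (if over (k,k') f then -1 else 1) * csqrt (seen (fst f) (snd f) k')"
    by metis
  define Q where "Q x = (\<Prod>f\<leftarrow>links ls. R f x)" for x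
  have Qc: "continuous_on ?K Q"
  proof -
    have "\<forall>f\<in>set fs. continuous_on ?K (R f) \<Longrightarrow> continuous_on ?K (\<lambda>x. \<Prod>f\<leftarrow>fs. R f x)" for fs
      by (induction fs) (auto intro!: continuous_intros)
    then show ?thesis unfolding Q_def using R(1) by blast
  qed
  have Q2: "Q x ^ 2 = (\<Prod>(c,d)\<leftarrow>links ls. seen c d x)" if "x \<in> ?K" for x
  proof -
    have "\<forall>f\<in>set fs. R f x ^ 2 = seen (fst f) (snd f) x \<Longrightarrow> (\<Prod>f\<leftarrow>fs. R f x) ^ 2 = (\<Prod>(c,d)\<leftarrow>fs. seen c d x)" for fs
      by (induction fs) (auto simp: power_mult_distrib case_prod_beta)
    then show ?thesis unfolding Q_def using R(2)[OF _ that] by blast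
  qed
  have Qk: "Q k = root ls k"
  proof -
    have "\<forall>f\<in>set fs. R f k = csqrt (seen (fst f) (snd f) k) \<Longrightarrow> (\<Prod>f\<leftarrow>fs. R f k) = (\<Prod>(c,d)\<leftarrow>fs. csqrt (seen c d k))" for fs
      by (induction fs) (auto simp: case_prod_beta)
    then show ?thesis unfolding Q_def root_def using R(3) by blast
  qed
  have Qk': "Q k' = (-1) ^ (\<Sum>f\<leftarrow>links ls. of_bool (over (k,k') f)) * root ls k'"
  proof -
    have "\<forall>f\<in>set fs. R f k' = (if over (k,k') f then -1 else 1) * csqrt (seen (fst f) (snd f) k') \<Longrightarrow>
       (\<Prod>f\<leftarrow>fs. R f k') = (-1) ^ (\<Sum>f\<leftarrow>fs. of_bool (over (k,k') f)) * (\<Prod>(c,d)\<leftarrow>fs. csqrt (seen c d k'))" for fs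
      by (induction fs) (auto simp: case_prod_beta)
    then show ?thesis unfolding Q_def root_def using R(4) by blast
  qed
  have quot: "\<exists>\<rho>>0. (S x / Q x) ^ 2 = of_real \<rho>" "Q x \<noteq> 0" if xK: "x \<in> ?K" for x
  proof -
    obtain \<rho> where \<rho>: "\<rho> > 0" "tr (holo ls x) = of_real \<rho> * (\<Prod>(c,d)\<leftarrow>links ls. seen c d x)"
      using trace_holo_seen[OF ls gen[OF xK]] .
    have "\<forall>f\<in>set (links ls). seen (fst f) (snd f) x \<noteq> 0"
      using seen_nonzero[of x] off[OF xK] gen[OF xK] links_subset[of _ _ ls] by force
    then have nz: "(\<Prod>(c,d)\<leftarrow>links ls. seen c d x) \<noteq> 0"
      by (auto simp: prod_list_zero_iff case_prod_beta)
    then show "Q x \<noteq> 0" using Q2[OF xK] by auto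
    show "\<exists>\<rho>>0. (S x / Q x) ^ 2 = of_real \<rho>"
      using \<rho> nz unfolding power_divide Q2[OF xK] S(2)[OF xK] by (intro exI[of _ \<rho>]) simp
  qed
  define h where "h x = Re (S x / Q x)" for x
  have re: "h x \<noteq> 0" if "x \<in> ?K" for x
    using quot(1)[OF that] real_square_pos unfolding h_def by blast
  have "continuous_on ?K h" unfolding h_def
    by (rule continuous_on_Re[OF continuous_on_divide[OF S(1) Qc]]) (use quot(2) in blast)
  then have conn: "connected (h ` ?K)"
    by (rule connected_continuous_image) simp
  have ends: "h k \<noteq> 0" "h k' \<noteq> 0" by (rule re, simp)+
  have same: "sgn (h k') = sgn (h k)"
  proof (rule ccontr)
    assume ne: "sgn (h k') \<noteq> sgn (h k)"
    have in_I: "h k \<in> h ` ?K" "h k' \<in> h ` ?K" by (rule imageI, simp)+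
    have "0 \<in> h ` ?K"
    proof (cases "h k < 0")
      case True
      then have "h k' \<ge> 0" using ne by (auto simp: sgn_if split: if_splits)
      then show ?thesis using connectedD_interval[OF conn in_I, of 0] True by simp
    next
      case False
      then have "h k' \<le> 0" using ne ends by (auto simp: sgn_if split: if_splits)
      then show ?thesis using connectedD_interval[OF conn in_I(2,1), of 0] False by simp
    qed
    then show False using re by auto
  qed
  show "sgn (Re (S k / root ls k)) \<noteq> 0" using ends(1) Qk unfolding h_def by (simp add: sgn_zero_iff)
  let ?n = "\<Sum>f\<leftarrow>links ls. of_bool (over (k,k') f) :: nat"
  have "S k' / root ls k' = of_real ((-1) ^ ?n) * (S k' / Q k')"
    unfolding Qk' by (cases "even ?n") simp_all
  moreover have "Re (of_real r * z) = r * Re z" for r z by simp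
  ultimately have "Re (S k' / root ls k') = (-1) ^ ?n * h k'" unfolding h_def by (simp only:)
  then show "sgn (Re (S k' / root ls k')) = (-1) ^ ?n * sgn (Re (S k / root ls k))"
    using same Qk unfolding h_def by (cases "even ?n") (simp_all add: sgn_minus)
qed

text \<open>Along a closed polygon the continuous root returns to its initial value, so its sign relative to the
  product of the principal roots changes an even number of times.\<close>

lemma overcrossings_even:
  assumes ls: "ls \<noteq> []" "last ls = hd ls" and ks: "ks \<noteq> []" "last ks = hd ks"
    and S: "continuous_on T S" "\<And>x. x \<in> T \<Longrightarrow> S x ^ 2 = tr (holo ls x)"
    and T: "\<And>k k'. (k,k') \<in> set (links ks) \<Longrightarrow> closed_segment k k' \<subseteq> T"
    and off: "\<And>x c d. x \<in> T \<Longrightarrow> (c,d) \<in> set (links ls) \<Longrightarrow> x \<notin> closed_segment c d"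
    and gen: "genpos ks ls"
  shows "even (\<Sum>e\<leftarrow>links ks. \<Sum>f\<leftarrow>links ls. of_bool (over e f) :: nat)"
proof (cases "links ks = []")
  case False
  let ?g = "\<lambda>k. sgn (Re (S k / root ls k))" and ?n = "\<lambda>e. \<Sum>f\<leftarrow>links ls. of_bool (over e f) :: nat"
  have step: "?g (fst e) \<noteq> 0 \<and> ?g (snd e) = (-1) ^ ?n e * ?g (fst e)" if e_in: "e \<in> set (links ks)" for e
  proof -
    obtain k k' where e: "e = (k,k')" by force
    note T' = T[OF e_in[unfolded e]]
    have c: "continuous_on (closed_segment k k') S" by (rule continuous_on_subset[OF S(1) T'])
    have g: "hor l \<noteq> hor x" if "x \<in> closed_segment k k'" "l \<in> set ls" for x l
      using gen e_in that unfolding genpos_def e by blast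
    have i: "Im (seen c d k) \<noteq> 0 \<and> Im (seen c d k') \<noteq> 0" if "(c,d) \<in> set (links ls)" for c d
      using gen e_in links_subset[of k k' ks] that unfolding genpos_def e by blast
    note * = sign_flip[OF ls c S(2) off g i]
    show ?thesis unfolding e fst_conv snd_conv
      by (intro conjI *) (use T' in blast)+
  qed
  have "\<forall>e\<in>set (links vs). ?g (fst e) \<noteq> 0 \<and> ?g (snd e) = (-1) ^ ?n e * ?g (fst e) \<Longrightarrow> vs \<noteq> [] \<Longrightarrow>
    ?g (last vs) = (-1) ^ (\<Sum>e\<leftarrow>links vs. ?n e) * ?g (hd vs)" for vs
    by (induction vs rule: links.induct) (auto simp: power_add)
  from this[of ks] step ks have "?g (hd ks) = (-1) ^ (\<Sum>e\<leftarrow>links ks. ?n e) * ?g (hd ks)" by simp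
  moreover have "?g (hd ks) \<noteq> 0" 
  proof -
    have "(hd ks, hd (tl ks)) \<in> set (links ks)" using False by (cases ks rule: links.cases) auto
    from step[OF this] show ?thesis by simp
  qed
  ultimately have "(-1) ^ (\<Sum>e\<leftarrow>links ks. ?n e) = (1::real)" by simp
  then show ?thesis by (cases "even (\<Sum>e\<leftarrow>links ks. ?n e)") auto
qed simp

section \<open>Separating spheres\<close>

text \<open>A nonvanishing function on the closed complement of one side \<open>V\<close> has a logarithm on the 2-sphere
  \<open>\<Sigma>\<close>, which is simply connected. Extending this logarithm by Tietze's theorem continues the function over
  \<open>V\<close> to the whole 3-sphere without zeros, and there it has a logarithm again.\<close>

lemma sphere_side_log:
  fixes \<Sigma> :: "(real^4) set" and g :: "real^4 \<Rightarrow> complex"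
  assumes \<Sigma>: "\<Sigma> \<subseteq> sphere 0 1" "\<Sigma> homeomorphic (sphere 0 1 :: (real^3) set)"
    and V: "V \<in> components (sphere 0 1 - \<Sigma>)"
    and g: "continuous_on (sphere 0 1 - V) g" "\<And>x. x \<in> sphere 0 1 - V \<Longrightarrow> g x \<noteq> 0"
  shows "closed (sphere 0 1 - V)" "\<exists>\<phi>. continuous_on (sphere 0 1 - V) \<phi> \<and> (\<forall>x\<in>sphere 0 1 - V. g x = exp (\<phi> x))"
proof -
  let ?S = "sphere 0 1 :: (real^4) set" and ?A = "sphere 0 1 - V"
  have cS: "compact \<Sigma>" using homeomorphic_compactness[OF \<Sigma>(2)] by simp
  then have cl: "closed \<Sigma>" by (rule compact_imp_closed)
  have VS: "V \<subseteq> ?S - \<Sigma>" by (rule in_components_subset[OF V])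
  have lc: "locally connected ?S"
    by (rule ENR_imp_locally_connected[OF ENR_sphere])
  have op: "openin (top_of_set ?S) (?S - \<Sigma>)"
    unfolding Diff_eq by (rule openin_open_Int[OF open_Compl[OF cl]])
  have "openin (top_of_set (?S - \<Sigma>)) V"
    by (rule openin_components_locally_connected[OF locally_open_subset[OF lc op] V])
  then have opV: "openin (top_of_set ?S) V" by (rule openin_trans[OF _ op])
  have "closedin (top_of_set ?S) ?A" by (rule closedin_diff[OF _ opV]) simp
  then show clA: "closed ?A" by (rule closedin_closed_trans[OF _ closed_sphere])
  have clB: "closed (\<Sigma> \<union> V)"
  proof -
    have "closedin (top_of_set (?S - \<Sigma>)) V" by (rule closedin_component[OF V])
    then obtain T where T: "closed T" "V = (?S - \<Sigma>) \<inter> T" unfolding closedin_closed by blast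
    have "\<Sigma> \<union> V = \<Sigma> \<union> (?S \<inter> T)" unfolding T(2) by blast
    moreover have "closed (\<Sigma> \<union> (?S \<inter> T))" by (intro closed_Un closed_Int cl T(1) closed_sphere)
    ultimately show ?thesis by (simp only:)
  qed
  have \<Sigma>A: "\<Sigma> \<subseteq> ?A" using \<Sigma>(1) VS by auto
  have "Borsukian \<Sigma>"
    using Borsukian_sphere[of "0::real^3" 1] homeomorphic_Borsukian_eq[OF \<Sigma>(2)] by simp
  moreover have "continuous_on \<Sigma> g" by (rule continuous_on_subset[OF g(1) \<Sigma>A])
  moreover have "g \<in> \<Sigma> \<rightarrow> - {0}" using g(2) \<Sigma>A by blast
  ultimately obtain l where l: "continuous_on \<Sigma> l" "\<And>x. x \<in> \<Sigma> \<Longrightarrow> g x = exp (l x)"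
    unfolding Borsukian_continuous_logarithm by blast
  obtain m where m: "continuous_on UNIV m" "\<And>x. x \<in> \<Sigma> \<Longrightarrow> m x = l x"
    by (rule Dugundji[of "UNIV :: complex set" UNIV \<Sigma> l]) (use l(1) cl in simp_all)
  define G where "G x = (if x \<in> ?A then g x else exp (m x))" for x
  have "continuous_on (?A \<union> (\<Sigma> \<union> V)) G" unfolding G_def
  proof (rule continuous_on_If[OF clA clB g(1)])
    show "continuous_on (\<Sigma> \<union> V) (\<lambda>x. exp (m x))"
      by (rule continuous_on_exp[OF continuous_on_subset[OF m(1)]]) simp
    show "g x = exp (m x)" if "x \<in> ?A" "x \<notin> ?A" for x using that by simp
    show "g x = exp (m x)" if "x \<in> \<Sigma> \<union> V" "x \<in> ?A" for x
      using that l(2)[of x] m(2)[of x] by simp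
  qed
  moreover have "?A \<union> (\<Sigma> \<union> V) = ?S" using \<Sigma>(1) VS by auto
  ultimately have "continuous_on ?S G" by simp
  moreover have "Borsukian ?S" by (rule Borsukian_sphere) simp
  moreover have "G \<in> ?S \<rightarrow> - {0}" using g(2) by (auto simp: G_def)
  ultimately obtain \<phi> where \<phi>: "continuous_on ?S \<phi>" "\<And>x. x \<in> ?S \<Longrightarrow> G x = exp (\<phi> x)"
    unfolding Borsukian_continuous_logarithm by blast
  have "continuous_on ?A \<phi>" by (rule continuous_on_subset[OF \<phi>(1)]) auto
  moreover have "\<forall>x\<in>?A. g x = exp (\<phi> x)"
  proof
    fix x assume "x \<in> ?A"
    then have "G x = g x" "x \<in> ?S" by (simp_all add: G_def)
    with \<phi>(2) show "g x = exp (\<phi> x)" by simp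
  qed
  ultimately show "\<exists>\<phi>. continuous_on ?A \<phi> \<and> (\<forall>x\<in>?A. g x = exp (\<phi> x))" by blast
qed

lemma homeomorphism_far:
  fixes h :: "real^4 \<Rightarrow> real^3"
  assumes "homeomorphism (sphere 0 1 - {p}) UNIV h k" "p \<in> sphere 0 1"
  shows "filterlim h at_infinity (at p within sphere 0 1)"
  unfolding filterlim_at_infinity[OF order_refl]
proof (intro allI impI)
  fix r :: real assume "r > 0"
  let ?C = "k ` cball 0 r"
  have ck: "continuous_on (cball 0 r) k"
    by (rule continuous_on_subset[OF homeomorphism_cont2[OF assms(1)]]) simp
  have cl: "closed ?C" by (rule compact_imp_closed[OF compact_continuous_image[OF ck compact_cball]])
  have "k x \<noteq> p" for x using homeomorphism_image2[OF assms(1)] by blast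
  then have "p \<in> - ?C" by blast
  then have "\<forall>\<^sub>F y in nhds p. y \<in> - ?C" by (rule eventually_nhds_in_open[OF open_Compl[OF cl]])
  then show "\<forall>\<^sub>F y in at p within sphere 0 1. r \<le> norm (h y)"
    unfolding eventually_at_filter
  proof eventually_elim
    case (elim y)
    show ?case
    proof (intro impI)
      assume "y \<noteq> p" "y \<in> sphere 0 1"
      then have "k (h y) = y" by (intro homeomorphism_apply1[OF assms(1)]) simp
      then have "h y \<notin> cball 0 r" using elim by (metis ComplD imageI)
      then show "r \<le> norm (h y)" by simp
    qed
  qed
qed

text \<open>On the side of \<open>ks\<close> the trace of the holonomy of \<open>ls\<close>, continued by 1 to the point at infinity,
  has a logarithm; half of it gives the square root that \<open>overcrossings_even\<close> asks for.\<close>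

lemma separated_even:
  assumes hom: "homeomorphism (sphere 0 1 - {p}) UNIV h k" "p \<in> sphere (0::real^4) 1"
    and \<Sigma>: "\<Sigma> \<subseteq> sphere 0 1" "\<Sigma> homeomorphic (sphere 0 1 :: (real^3) set)"
    and UV: "U \<in> components (sphere 0 1 - \<Sigma>)" "V \<in> components (sphere 0 1 - \<Sigma>)" "U \<noteq> V"
    and ls: "ls \<noteq> []" "last ls = hd ls" and ks: "ks \<noteq> []" "last ks = hd ks"
    and K: "\<And>a b x. (a,b) \<in> set (links ks) \<Longrightarrow> x \<in> closed_segment a b \<Longrightarrow> k x \<in> U"
    and L: "\<And>a b x. (a,b) \<in> set (links ls) \<Longrightarrow> x \<in> closed_segment a b \<Longrightarrow> k x \<in> V"
    and Lv: "\<And>v. v \<in> set ls \<Longrightarrow> k v \<in> V"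
    and gen: "genpos ks ls"
  shows "even (\<Sum>e\<leftarrow>links ks. \<Sum>f\<leftarrow>links ls. of_bool (over e f) :: nat)"
proof -
  let ?A = "sphere 0 1 - V"
  have hk: "h (k x) = x" "k x \<in> sphere 0 1" "k x \<noteq> p" for x
    using homeomorphism_apply2[OF hom(1)] homeomorphism_image2[OF hom(1)] by blast+
  have kh: "k (h y) = y" if "y \<in> sphere 0 1 - {p}" for y by (rule homeomorphism_apply1[OF hom(1) that])
  have ch: "continuous_on (sphere 0 1 - {p}) h" and ck: "continuous_on UNIV k"
    by (rule homeomorphism_cont1[OF hom(1)], rule homeomorphism_cont2[OF hom(1)])
  have UVd: "U \<inter> V = {}" using components_nonoverlap[OF UV(1,2)] UV(3) by blast
  define g where "g y = (if y = p then 1 else tr (holo ls (h y)))" for y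
  have notL: "h y \<notin> set ls" "\<And>a b. (a,b) \<in> set (links ls) \<Longrightarrow> h y \<notin> closed_segment a b" if y: "y \<in> ?A - {p}" for y
  proof -
    have "k (h y) \<notin> V" using kh[of y] y by simp
    then show "h y \<notin> set ls" "\<And>a b. (a,b) \<in> set (links ls) \<Longrightarrow> h y \<notin> closed_segment a b"
      using Lv L by blast+
  qed
  have nz: "g y \<noteq> 0" if y: "y \<in> ?A" for y
  proof (cases "y = p")
    case False
    then have "y \<in> ?A - {p}" using y by simp
    note n = notL[OF this]
    have "tr (holo ls (h y)) \<noteq> 0" by (rule trace_holo_nonzero[OF ls]) (use n in blast)+
    then show ?thesis using False by (simp add: g_def)
  qed (simp add: g_def)
  have cA: "continuous_on (?A - {p}) h" by (rule continuous_on_subset[OF ch]) blast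
  have cont: "continuous_on (?A - {p}) (\<lambda>y. tr (holo ls (h y)))"
    by (rule continuous_on_compose2[OF continuous_on_trace_holo cA]) (use notL(1) in blast)
  have "continuous_on ?A g"
    unfolding continuous_on_eq_continuous_within
  proof
    fix y assume y: "y \<in> ?A"
    show "continuous (at y within ?A) g"
    proof (cases "y = p")
      case True
      have "filterlim h at_infinity (at p within ?A)"
        by (rule filterlim_mono[OF homeomorphism_far[OF hom] order_refl at_le]) auto
      from filterlim_compose[OF trace_holo_far[OF ls(1)] this]
      have "((\<lambda>y. tr (holo ls (h y))) \<longlongrightarrow> 1) (at p within ?A)" .
      then have "(g \<longlongrightarrow> 1) (at p within ?A)"
        by (rule Lim_transform_eventually) (auto simp: g_def eventually_at_filter)
      then show ?thesis unfolding True continuous_within by (simp add: g_def)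
    next
      case False
      have "continuous (at y within (?A - {p})) (\<lambda>y. tr (holo ls (h y)))"
        using cont y False by (simp add: continuous_on_eq_continuous_within)
      then have "((\<lambda>y. tr (holo ls (h y))) \<longlongrightarrow> tr (holo ls (h y))) (at y within (?A - {p}))"
        by (simp only: continuous_within)
      moreover have eq: "at y within (?A - {p}) = at y within ?A"
        by (rule at_within_nhd[of y "- {p}"]) (use False in auto)
      ultimately have "((\<lambda>y. tr (holo ls (h y))) \<longlongrightarrow> g y) (at y within ?A)" using False by (simp add: g_def)
      moreover have "\<forall>\<^sub>F y in at y within ?A. tr (holo ls (h y)) = g y"
      proof -
        have "\<forall>\<^sub>F z in nhds y. z \<in> - {p}" using False by (intro eventually_nhds_in_open) auto
        then show ?thesis unfolding eventually_at_filter by eventually_elim (simp add: g_def)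
      qed
      ultimately show ?thesis unfolding continuous_within by (rule Lim_transform_eventually)
    qed
  qed
  from sphere_side_log(2)[OF \<Sigma> UV(2) this nz] obtain \<phi> where
    \<phi>: "continuous_on ?A \<phi>" "\<And>y. y \<in> ?A \<Longrightarrow> g y = exp (\<phi> y)" by blast
  define S where "S x = exp (\<phi> (k x) / 2)" for x
  let ?T = "{x. k x \<in> ?A}"
  show ?thesis
  proof (rule overcrossings_even[OF ls ks, of ?T S])
    have "continuous_on ?T (\<lambda>x. \<phi> (k x))"
      by (rule continuous_on_compose2[OF \<phi>(1) continuous_on_subset[OF ck]]) auto
    then show "continuous_on ?T S" unfolding S_def by (intro continuous_intros) auto
    show "S x ^ 2 = tr (holo ls x)" if "x \<in> ?T" for x
    proof -
      have "S x ^ 2 = exp (\<phi> (k x))" unfolding S_def exp_double[symmetric] by simp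
      also have "\<dots> = g (k x)" using \<phi>(2) that by simp
      also have "\<dots> = tr (holo ls x)" using hk(1,3)[of x] by (simp add: g_def)
      finally show ?thesis .
    qed
    show "closed_segment a b \<subseteq> ?T" if "(a,b) \<in> set (links ks)" for a b
    proof
      fix x assume "x \<in> closed_segment a b"
      from K[OF that this] UVd hk(2)[of x] show "x \<in> ?T" by blast
    qed
    show "x \<notin> closed_segment c d" if "x \<in> ?T" "(c,d) \<in> set (links ls)" for x c d
    proof
      assume "x \<in> closed_segment c d"
      from L[OF that(2) this] that(1) show False by blast
    qed
  qed (rule gen)
qed

section \<open>Crossings of two segments in general position\<close>

text \<open>The \<open>i\<close>-th coordinate of the point of the line through \<open>a\<close> and \<open>b\<close> whose first coordinate
  is \<open>x\<close>.\<close>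

definition line_at :: "3 \<Rightarrow> real^3 \<Rightarrow> real^3 \<Rightarrow> real \<Rightarrow> real" where
  "line_at i a b x = a$i + (b$i - a$i) * ((x - a$1) / (b$1 - a$1))"

definition beneath :: "real^3 \<Rightarrow> (real^3) \<times> (real^3) \<Rightarrow> bool" where
  "beneath v e \<longleftrightarrow> (case e of (a,b) \<Rightarrow> (a$1 < v$1 \<and> v$1 < b$1 \<or> b$1 < v$1 \<and> v$1 < a$1) \<and> v$2 < line_at 2 a b (v$1))"

lemma affine_zero_count:
  fixes D E :: "real \<Rightarrow> real"
  assumes D: "\<And>x. D x = \<alpha> + \<beta> * x" and lr: "l < r" and nz: "D l \<noteq> 0" "D r \<noteq> 0"
    and E: "\<And>x. l \<le> x \<Longrightarrow> x \<le> r \<Longrightarrow> D x = 0 \<Longrightarrow> E x \<noteq> 0"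
  shows "of_bool (\<exists>x. l \<le> x \<and> x \<le> r \<and> D x = 0 \<and> E x > 0) + of_bool (\<exists>x. l \<le> x \<and> x \<le> r \<and> D x = 0 \<and> E x < 0)
    = (of_bool ((D l > 0) \<noteq> (D r > 0)) :: nat)"
proof (cases "(D l > 0) \<noteq> (D r > 0)")
  case False
  have "D x \<noteq> 0" if "l \<le> x" "x \<le> r" for x
  proof
    assume 0: "D x = 0"
    have "(D l) * (r - x) + (D r) * (x - l) = 0 * (r - l)"
      using 0 unfolding D by algebra
    moreover have "r - x \<ge> 0" "x - l \<ge> 0" "r - x > 0 \<or> x - l > 0" using that lr by auto
    moreover have "D l > 0 \<and> D r > 0 \<or> D l < 0 \<and> D r < 0" using False nz by auto
    ultimately show False
      by (smt (verit) mult_nonneg_nonneg mult_pos_pos mult_neg_pos mult_nonpos_nonneg mult_zero_left)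
  qed
  then show ?thesis using False by auto
next
  case True
  have \<beta>: "\<beta> \<noteq> 0" using True unfolding D by auto
  define x0 where "x0 = - \<alpha> / \<beta>"
  have z: "D x = 0 \<longleftrightarrow> x = x0" for x unfolding D x0_def using \<beta> by (auto simp: field_simps)
  have D': "D x = \<beta> * (x - x0)" for x unfolding D x0_def using \<beta> by (simp add: field_simps)
  have in_lr: "l \<le> x0" "x0 \<le> r"
    using True nz lr unfolding D' by (auto simp: zero_less_mult_iff mult_le_0_iff not_less)
  have "E x0 \<noteq> 0" using E[OF in_lr] z by blast
  then have "of_bool (E x0 > 0) + of_bool (E x0 < 0) = (1::nat)" by auto
  then show ?thesis using True in_lr unfolding z by auto
qed

lemma segment_over:
  assumes "a$1 < b$1"
  shows "p \<in> closed_segment a b \<longleftrightarrow> a$1 \<le> p$1 \<and> p$1 \<le> b$1 \<and> p$2 = line_at 2 a b (p$1) \<and> p$3 = line_at 3 a b (p$1)"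
proof
  assume "p \<in> closed_segment a b"
  then obtain u where u: "0 \<le> u" "u \<le> 1" "p = (1 - u) *\<^sub>R a + u *\<^sub>R b" unfolding in_segment by blast
  have c: "p$i = a$i + (b$i - a$i) * u" for i unfolding u(3) by (simp add: algebra_simps)
  have "(p$1 - a$1) / (b$1 - a$1) = u" unfolding c using assms by simp
  then have "p$2 = line_at 2 a b (p$1)" "p$3 = line_at 3 a b (p$1)" unfolding line_at_def c[of 2] c[of 3] by simp_all
  moreover have "a$1 \<le> p$1" unfolding c using u assms by simp
  moreover have "(b$1 - a$1) * u \<le> (b$1 - a$1) * 1" using u assms by (intro mult_left_mono) auto
  then have "p$1 \<le> b$1" unfolding c by simp
  ultimately show "a$1 \<le> p$1 \<and> p$1 \<le> b$1 \<and> p$2 = line_at 2 a b (p$1) \<and> p$3 = line_at 3 a b (p$1)" by blast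
next
  assume r: "a$1 \<le> p$1 \<and> p$1 \<le> b$1 \<and> p$2 = line_at 2 a b (p$1) \<and> p$3 = line_at 3 a b (p$1)"
  define u where "u = (p$1 - a$1) / (b$1 - a$1)"
  have u: "0 \<le> u" "u \<le> 1" using r assms by (simp_all add: u_def)
  have "p$1 = a$1 + (b$1 - a$1) * u" using assms by (simp add: u_def)
  moreover have "p$2 = a$2 + (b$2 - a$2) * u" "p$3 = a$3 + (b$3 - a$3) * u"
    using r unfolding line_at_def u_def by blast+
  ultimately have "p = (1 - u) *\<^sub>R a + u *\<^sub>R b" by (simp add: vec_eq_iff forall_3 algebra_simps)
  then show "p \<in> closed_segment a b" unfolding in_segment using u by blast
qed

lemma segment_over_ex:
  fixes a b :: "real^3"
  assumes "a$1 < b$1" "a$1 \<le> x" "x \<le> b$1"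
  shows "\<exists>p\<in>closed_segment a b. p$1 = x"
proof -
  let ?p = "vector [x, line_at 2 a b x, line_at 3 a b x] :: real^3"
  have "?p \<in> closed_segment a b" unfolding segment_over[OF assms(1)] using assms by simp
  moreover have "?p $ 1 = x" by simp
  ultimately show ?thesis by blast
qed

lemma over_line:
  assumes "a$1 < b$1" "c$1 < d$1"
  shows "over (a,b) (c,d) \<longleftrightarrow> (\<exists>x. max (a$1) (c$1) \<le> x \<and> x \<le> min (b$1) (d$1) \<and>
    line_at 2 a b x - line_at 2 c d x = 0 \<and> line_at 3 a b x - line_at 3 c d x > 0)"
proof
  assume "over (a,b) (c,d)"
  then obtain p q where p: "p \<in> closed_segment a b" "q \<in> closed_segment c d" "hor p = hor q" "p$3 > q$3"
    unfolding over_def by auto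
  have h: "p$1 = q$1" "p$2 = q$2" using p(3) unfolding hor_def by simp_all
  show "\<exists>x. max (a$1) (c$1) \<le> x \<and> x \<le> min (b$1) (d$1) \<and>
    line_at 2 a b x - line_at 2 c d x = 0 \<and> line_at 3 a b x - line_at 3 c d x > 0"
    using p(1,2,4) h unfolding segment_over[OF assms(1)] segment_over[OF assms(2)]
    by (intro exI[of _ "p$1"]) simp
next
  assume "\<exists>x. max (a$1) (c$1) \<le> x \<and> x \<le> min (b$1) (d$1) \<and>
    line_at 2 a b x - line_at 2 c d x = 0 \<and> line_at 3 a b x - line_at 3 c d x > 0"
  then obtain x where x: "max (a$1) (c$1) \<le> x" "x \<le> min (b$1) (d$1)"
    "line_at 2 a b x = line_at 2 c d x" "line_at 3 a b x > line_at 3 c d x" by auto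
  obtain p where p: "p \<in> closed_segment a b" "p$1 = x" using segment_over_ex[OF assms(1)] x by auto
  obtain q where q: "q \<in> closed_segment c d" "q$1 = x" using segment_over_ex[OF assms(2)] x by auto
  have "p$2 = q$2" "p$3 > q$3"
    using p q x unfolding segment_over[OF assms(1)] segment_over[OF assms(2)] by auto
  then have "hor p = hor q \<and> p$3 > q$3" unfolding hor_def p(2) q(2) by simp
  then show "over (a,b) (c,d)" unfolding over_def fst_conv snd_conv using p(1) q(1) by blast
qed

lemma over_sym: "over (b,a) f = over (a,b) f" "over f (b,a) = over f (a,b)"
  unfolding over_def by (simp_all add: closed_segment_commute)

lemma line_at_sym: "a$1 \<noteq> b$1 \<Longrightarrow> line_at i b a x = line_at i a b x"
  unfolding line_at_def by (simp add: divide_simps) (simp add: algebra_simps)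

lemma beneath_sym: "beneath v (b,a) = beneath v (a,b)"
proof (cases "a$1 = b$1")
  case False then show ?thesis unfolding beneath_def by (auto simp: line_at_sym)
qed (auto simp: beneath_def)

abbreviation west :: "real^3 \<Rightarrow> real^3 \<Rightarrow> nat" where "west u v \<equiv> of_bool (u$1 < v$1)"

text \<open>Modulo 2 this counts the crossings of the two segments in the plane, but as a sum of terms each
  of which depends on one segment and one endpoint of the other or on two endpoints only. The terms of the
  first kind cancel when summed along closed polygons.\<close>

definition crossing_sum :: "(real^3) \<times> (real^3) \<Rightarrow> (real^3) \<times> (real^3) \<Rightarrow> nat" where
  "crossing_sum e f = (case (e,f) of ((a,b),(c,d)) \<Rightarrow>
     of_bool (beneath a f) + of_bool (beneath b f) + of_bool (beneath c e) + of_bool (beneath d e) +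
     west a c + west a d + west b c + west b d)"

lemma crossing_sum_sym:
  "crossing_sum (b,a) f = crossing_sum (a,b) f" "crossing_sum e (d,c) = crossing_sum e (c,d)"
  unfolding crossing_sum_def by (simp_all add: beneath_sym split: prod.splits)

lemma line_at_ends: "a$1 < b$1 \<Longrightarrow> line_at i a b (a$1) = a$i" "a$1 < b$1 \<Longrightarrow> line_at i a b (b$1) = b$i"
  unfolding line_at_def by simp_all

lemma line_at_affine: "line_at i a b x = (a$i - (b$i - a$i) * a$1 / (b$1 - a$1)) + (b$i - a$i) / (b$1 - a$1) * x"
  unfolding line_at_def by (simp add: diff_divide_distrib right_diff_distrib left_diff_distrib)

lemma Im_seen: "Im (seen c d x) = (c$1 - x$1) * (d$2 - x$2) + (x$2 - c$2) * (d$1 - x$1)"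
proof -
  have "Im (cnj (Complex p q) * Complex r s) = p * s - q * r" for p q r s by simp
  then show ?thesis unfolding seen_def hor_def by simp
qed

lemma off_line_at: "a$1 \<noteq> b$1 \<Longrightarrow> Im (seen a b v) \<noteq> 0 \<Longrightarrow> line_at 2 a b (v$1) \<noteq> v$2"
proof
  assume n: "a$1 \<noteq> b$1" "Im (seen a b v) \<noteq> 0" "line_at 2 a b (v$1) = v$2"
  then have "(b$2 - a$2) * (v$1 - a$1) = (v$2 - a$2) * (b$1 - a$1)"
    unfolding line_at_def by (simp add: field_simps)
  then have "Im (seen a b v) = 0" unfolding Im_seen by algebra
  with n show False by simp
qed

text \<open>Case inspection of how the projections of two segments to the first axis overlap; \<open>P\<close> says which of the two lies higher in the plane.\<close>

lemma crossing_cases: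
  fixes a b c d :: real
  assumes "a < b" "c < d" "a \<noteq> c" "a \<noteq> d" "b \<noteq> c" "b \<noteq> d" "max a c < min b d"
  shows "even (of_bool (P (max a c) \<noteq> P (min b d)) + (of_bool (c < a \<and> a < d \<and> \<not> P a) + of_bool (c < b \<and> b < d \<and> \<not> P b) +
    of_bool (a < c \<and> c < b \<and> P c) + of_bool (a < d \<and> d < b \<and> P d) +
    of_bool (a < c) + of_bool (a < d) + of_bool (b < c) + of_bool (b < d)) :: nat)"
proof (cases "a < c")
  case True
  then have "max a c = c" "c < b" "\<not> c < a" "\<not> b < c" "a < d" using assms by auto
  moreover have "b < d \<Longrightarrow> min b d = b \<and> \<not> d < b" "\<not> b < d \<Longrightarrow> min b d = d \<and> d < b" using assms(6) by auto
  ultimately show ?thesis using True assms(1,2) by (cases "b < d"; cases "P b"; cases "P c"; cases "P d"; simp)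
next
  case False
  then have "max a c = a" "c < a" "c < b" "\<not> a < c" "\<not> b < c" "a < d" using assms by auto
  moreover have "b < d \<Longrightarrow> min b d = b \<and> \<not> d < b" "\<not> b < d \<Longrightarrow> min b d = d \<and> d < b" using assms(6) by auto
  ultimately show ?thesis using assms(1,2) by (cases "b < d"; cases "P a"; cases "P b"; cases "P d"; simp)
qed

lemma crossing_parity_ordered:
  assumes o: "a$1 < b$1" "c$1 < d$1"
    and x: "a$1 \<noteq> c$1" "a$1 \<noteq> d$1" "b$1 \<noteq> c$1" "b$1 \<noteq> d$1"
    and g: "Im (seen a b c) \<noteq> 0" "Im (seen a b d) \<noteq> 0" "Im (seen c d a) \<noteq> 0" "Im (seen c d b) \<noteq> 0"
    and dis: "closed_segment a b \<inter> closed_segment c d = {}"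
  shows "even (of_bool (over (a,b) (c,d)) + of_bool (over (c,d) (a,b)) + crossing_sum (a,b) (c,d))"
proof -
  let ?l = "max (a$1) (c$1)" and ?r = "min (b$1) (d$1)"
  define D where "D x = line_at 2 a b x - line_at 2 c d x" for x
  define E where "E x = line_at 3 a b x - line_at 3 c d x" for x
  note ne = off_line_at[OF less_imp_neq[OF o(1)] g(1)] off_line_at[OF less_imp_neq[OF o(1)] g(2)]
    off_line_at[OF less_imp_neq[OF o(2)] g(3)] off_line_at[OF less_imp_neq[OF o(2)] g(4)]
  have ab: "over (a,b) (c,d) \<longleftrightarrow> (\<exists>x. ?l \<le> x \<and> x \<le> ?r \<and> D x = 0 \<and> E x > 0)"
    unfolding over_line[OF o] D_def E_def ..
  have "over (c,d) (a,b) \<longleftrightarrow> (\<exists>x. ?l \<le> x \<and> x \<le> ?r \<and> - D x = 0 \<and> - E x > 0)"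
    unfolding over_line[OF o(2,1)] D_def E_def minus_diff_eq max.commute[of "c$1"] min.commute[of "d$1"] ..
  then have cd: "over (c,d) (a,b) \<longleftrightarrow> (\<exists>x. ?l \<le> x \<and> x \<le> ?r \<and> D x = 0 \<and> E x < 0)" by simp
  show ?thesis
  proof (cases "?l < ?r")
    case False
    with x o have "b$1 < c$1 \<or> d$1 < a$1" by (auto simp: max_def min_def split: if_splits)
    moreover from this have "\<not> over (a,b) (c,d)" "\<not> over (c,d) (a,b)" unfolding ab cd by auto
    ultimately show ?thesis using o unfolding crossing_sum_def beneath_def by auto
  next
    case True
    have aff: "D x = ((a$2 - (b$2 - a$2) * a$1 / (b$1 - a$1)) - (c$2 - (d$2 - c$2) * c$1 / (d$1 - c$1)))
       + ((b$2 - a$2) / (b$1 - a$1) - (d$2 - c$2) / (d$1 - c$1)) * x" for x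
      unfolding D_def line_at_affine by (simp add: left_diff_distrib)
    have nl: "D ?l \<noteq> 0" and nr: "D ?r \<noteq> 0"
      using ne o unfolding D_def by (auto simp: max_def min_def line_at_ends)
    have dE: "E x \<noteq> 0" if xlr: "?l \<le> x" "x \<le> ?r" "D x = 0" for x
    proof
      assume e: "E x = 0"
      obtain p where p: "p \<in> closed_segment a b" "p$1 = x" using segment_over_ex[OF o(1), of x] xlr by auto
      have "p \<in> closed_segment c d"
        using p xlr e unfolding segment_over[OF o(1)] segment_over[OF o(2)] D_def E_def by auto
      with p dis show False by blast
    qed
    have cnt: "of_bool (over (a,b) (c,d)) + of_bool (over (c,d) (a,b)) = (of_bool ((D ?l > 0) \<noteq> (D ?r > 0)) :: nat)"
      unfolding ab cd by (rule affine_zero_count[OF aff True nl nr dE])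
    have Dl: "D (a$1) = a$2 - line_at 2 c d (a$1)" "D (c$1) = line_at 2 a b (c$1) - c$2"
      "D (b$1) = b$2 - line_at 2 c d (b$1)" "D (d$1) = line_at 2 a b (d$1) - d$2"
      unfolding D_def by (simp_all add: line_at_ends o)
    have bn: "beneath a (c,d) \<longleftrightarrow> c$1 < a$1 \<and> a$1 < d$1 \<and> \<not> D (a$1) > 0" "beneath b (c,d) \<longleftrightarrow> c$1 < b$1 \<and> b$1 < d$1 \<and> \<not> D (b$1) > 0"
      "beneath c (a,b) \<longleftrightarrow> a$1 < c$1 \<and> c$1 < b$1 \<and> D (c$1) > 0" "beneath d (a,b) \<longleftrightarrow> a$1 < d$1 \<and> d$1 < b$1 \<and> D (d$1) > 0"
      using ne o unfolding Dl beneath_def by auto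
    show ?thesis unfolding cnt crossing_sum_def prod.case bn
      by (rule crossing_cases[OF o x True])
  qed
qed

lemma crossing_parity:
  assumes x: "a$1 \<noteq> b$1" "c$1 \<noteq> d$1" "a$1 \<noteq> c$1" "a$1 \<noteq> d$1" "b$1 \<noteq> c$1" "b$1 \<noteq> d$1"
    and g: "Im (seen a b c) \<noteq> 0" "Im (seen a b d) \<noteq> 0" "Im (seen c d a) \<noteq> 0" "Im (seen c d b) \<noteq> 0"
    and dis: "closed_segment a b \<inter> closed_segment c d = {}"
  shows "even (of_bool (over (a,b) (c,d)) + of_bool (over (c,d) (a,b)) + crossing_sum (a,b) (c,d))"
proof -
  have sw: "Im (seen q p v) = - Im (seen p q v)" for p q v unfolding Im_seen by algebra
  have main: "even (of_bool (over (a,b) (c,d)) + of_bool (over (c,d) (a,b)) + crossing_sum (a,b) (c,d))"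
    if "a$1 < b$1" "a$1 \<noteq> c$1" "a$1 \<noteq> d$1" "b$1 \<noteq> c$1" "b$1 \<noteq> d$1"
     "Im (seen a b c) \<noteq> 0" "Im (seen a b d) \<noteq> 0" "Im (seen c d a) \<noteq> 0" "Im (seen c d b) \<noteq> 0"
     "closed_segment a b \<inter> closed_segment c d = {}" for a b
  proof (cases "c$1 < d$1")
    case True
    show ?thesis by (rule crossing_parity_ordered) (use that True in auto)
  next
    case False
    then have "d$1 < c$1" using x(2) by simp
    then have "even (of_bool (over (a,b) (d,c)) + of_bool (over (d,c) (a,b)) + crossing_sum (a,b) (d,c))"
      by (intro crossing_parity_ordered) (use that in \<open>auto simp: sw[of c d] closed_segment_commute[of d c]\<close>)
    then show ?thesis by (simp only: over_sym crossing_sum_sym)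
  qed
  show ?thesis
  proof (cases "a$1 < b$1")
    case True
    show ?thesis by (rule main) (use True x g dis in auto)
  next
    case False
    then have "b$1 < a$1" using x(1) by simp
    then have "even (of_bool (over (b,a) (c,d)) + of_bool (over (c,d) (b,a)) + crossing_sum (b,a) (c,d))"
      by (intro main) (use x g dis in \<open>auto simp: sw[of a b] closed_segment_commute[of b a]\<close>)
    then show ?thesis by (simp only: over_sym crossing_sum_sym)
  qed
qed

section \<open>Certificates of linking\<close>

definition cyc_arcs :: "'a list \<Rightarrow> ('a \<times> 'a) list" where
  "cyc_arcs xs = links (xs @ [hd xs])"

lemma sum_list_even: "(\<And>x. x \<in> set xs \<Longrightarrow> even (f x)) \<Longrightarrow> even (sum_list (map f xs))" for f :: "'a \<Rightarrow> nat"
  by (induction xs) auto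

lemma sum_list_add: "(\<Sum>x\<leftarrow>xs. f x + g x) = (\<Sum>x\<leftarrow>xs. f x) + (\<Sum>x\<leftarrow>xs. g x)" for f g :: "'a \<Rightarrow> nat"
  by (induction xs) auto

lemma sum_list_swap: "(\<Sum>x\<leftarrow>xs. \<Sum>y\<leftarrow>ys. f x y) = (\<Sum>y\<leftarrow>ys. \<Sum>x\<leftarrow>xs. f x y)" for f :: "'a \<Rightarrow> 'b \<Rightarrow> nat"
  by (induction xs) (auto simp: sum_list_add)

lemma telescope:
  "vs \<noteq> [] \<Longrightarrow> even ((\<Sum>e\<leftarrow>links vs. \<phi> (fst e) + \<phi> (snd e)) + (\<phi> (hd vs) + \<phi> (last vs)))" for \<phi> :: "'a \<Rightarrow> nat"
  by (induction vs rule: links.induct) auto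

lemma cycle_telescope: "xs \<noteq> [] \<Longrightarrow> even (\<Sum>e\<leftarrow>cyc_arcs xs. \<phi> (fst e) + \<phi> (snd e))" for \<phi> :: "'a \<Rightarrow> nat"
  using telescope[of "xs @ [hd xs]" \<phi>] unfolding cyc_arcs_def by (cases xs) auto

definition arc_over :: "('a \<Rightarrow> (real^3) list) \<Rightarrow> 'a \<Rightarrow> 'a \<Rightarrow> nat" where
  "arc_over pl e f = (\<Sum>g\<leftarrow>links (pl e). \<Sum>g'\<leftarrow>links (pl f). of_bool (over g g'))"

definition arc_beneath :: "('a \<Rightarrow> (real^3) list) \<Rightarrow> real^3 \<Rightarrow> 'a \<Rightarrow> nat" where
  "arc_beneath pl v f = (\<Sum>g\<leftarrow>links (pl f). of_bool (beneath v g))"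

lemma arc_parity:
  assumes ne: "pl e \<noteq> []" "pl f \<noteq> []"
    and cr: "\<And>g g'. g \<in> set (links (pl e)) \<Longrightarrow> g' \<in> set (links (pl f)) \<Longrightarrow>
      even (of_bool (over g g') + of_bool (over g' g) + crossing_sum g g')"
  defines "a \<equiv> hd (pl e)" and "b \<equiv> last (pl e)" and "c \<equiv> hd (pl f)" and "d \<equiv> last (pl f)"
  shows "even (arc_over pl e f + arc_over pl f e +
    (arc_beneath pl a f + arc_beneath pl b f + arc_beneath pl c e + arc_beneath pl d e
     + (west a c + west a d + west b c + west b d)))"
proof -
  let ?E = "links (pl e)" and ?F = "links (pl f)"
  let ?b = "\<lambda>v g. of_bool (beneath v g) :: nat"
  have cs: "crossing_sum g g' = (?b (fst g) g' + ?b (snd g) g') + (?b (fst g') g + ?b (snd g') g) +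
     ((west (fst g) (fst g') + west (fst g) (snd g')) + (west (snd g) (fst g') + west (snd g) (snd g')))" for g g'
    unfolding crossing_sum_def by (cases g; cases g') simp
  have "even (\<Sum>g\<leftarrow>?E. \<Sum>g'\<leftarrow>?F. of_bool (over g g') + of_bool (over g' g) + crossing_sum g g')"
    by (intro sum_list_even cr)
  then have A: "even (arc_over pl e f + arc_over pl f e + (\<Sum>g\<leftarrow>?E. \<Sum>g'\<leftarrow>?F. crossing_sum g g'))"
    unfolding arc_over_def sum_list_add sum_list_swap[of _ ?F ?E] .
  have B: "even ((\<Sum>g\<leftarrow>?E. \<Sum>g'\<leftarrow>?F. ?b (fst g) g' + ?b (snd g) g') + (arc_beneath pl a f + arc_beneath pl b f))"
    using telescope[OF ne(1), of "\<lambda>v. arc_beneath pl v f"] unfolding arc_beneath_def sum_list_add a_def b_def .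
  have C: "even ((\<Sum>g\<leftarrow>?E. \<Sum>g'\<leftarrow>?F. ?b (fst g') g + ?b (snd g') g) + (arc_beneath pl c e + arc_beneath pl d e))"
    using telescope[OF ne(2), of "\<lambda>v. arc_beneath pl v e"] unfolding arc_beneath_def sum_list_add c_def d_def sum_list_swap[of _ ?E ?F] .
  have t: "even ((\<Sum>g'\<leftarrow>?F. west u (fst g') + west u (snd g')) + (west u c + west u d))" for u
    unfolding c_def d_def by (rule telescope[OF ne(2)])
  have D1: "even ((\<Sum>g\<leftarrow>?E. \<Sum>g'\<leftarrow>?F. (west (fst g) (fst g') + west (fst g) (snd g')) + (west (snd g) (fst g') + west (snd g) (snd g')))
     + ((west a c + west a d) + (west b c + west b d)))"
  proof -
    let ?\<phi> = "\<lambda>u. \<Sum>g'\<leftarrow>?F. west u (fst g') + west u (snd g')"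
    have "even ((\<Sum>g\<leftarrow>?E. ?\<phi> (fst g) + ?\<phi> (snd g)) + (?\<phi> a + ?\<phi> b))"
      unfolding a_def b_def by (rule telescope[OF ne(1)])
    then show ?thesis using t[of a] t[of b] unfolding sum_list_add even_add by argo
  qed
  have "(\<Sum>g\<leftarrow>?E. \<Sum>g'\<leftarrow>?F. crossing_sum g g') = (\<Sum>g\<leftarrow>?E. \<Sum>g'\<leftarrow>?F. ?b (fst g) g' + ?b (snd g) g')
    + (\<Sum>g\<leftarrow>?E. \<Sum>g'\<leftarrow>?F. ?b (fst g') g + ?b (snd g') g)
    + (\<Sum>g\<leftarrow>?E. \<Sum>g'\<leftarrow>?F. (west (fst g) (fst g') + west (fst g) (snd g')) + (west (snd g) (fst g') + west (snd g) (snd g')))"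
    unfolding cs sum_list_add by simp
  moreover have "even (X + S) \<Longrightarrow> even (B + b) \<Longrightarrow> even (C + c) \<Longrightarrow> even (D + d) \<Longrightarrow> S = B + C + D \<Longrightarrow> even (X + (b + c + d))"
    for X S B C D b c d :: nat by simp
  ultimately have "even (arc_over pl e f + arc_over pl f e + ((arc_beneath pl a f + arc_beneath pl b f) + (arc_beneath pl c e + arc_beneath pl d e)
     + ((west a c + west a d) + (west b c + west b d))))"
    using A B C D1 by blast
  then show ?thesis by (simp only: add.assoc)
qed

definition arc_pairs :: "(nat list \<times> nat list) list \<Rightarrow> ((nat \<times> nat) \<times> (nat \<times> nat)) list" where
  "arc_pairs P = concat (map (\<lambda>(C,D). List.product (cyc_arcs C) (cyc_arcs D)) P)"

text \<open>The value of the endpoint terms of \<open>crossing_sum\<close> for vertices numbered from west to east. Any other numbering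
  changes the terms only by amounts that cancel along cycles.\<close>

definition interleave :: "nat \<times> nat \<Rightarrow> nat \<times> nat \<Rightarrow> nat" where
  "interleave e f = of_bool (fst e < fst f) + of_bool (fst e < snd f) + of_bool (snd e < fst f) + of_bool (snd e < snd f)"

text \<open>Disjoint arcs have different tails, so the smaller tail selects one of the two orders.\<close>

definition norm_pair :: "(nat \<times> nat) \<times> (nat \<times> nat) \<Rightarrow> (nat \<times> nat) \<times> (nat \<times> nat)" where
  "norm_pair p = (if fst (fst p) \<le> fst (snd p) then p else (snd p, fst p))"

text \<open>Deletes equal entries in pairs, so an empty result says that every entry occurs an even number
  of times.\<close>

fun cancel :: "'a list \<Rightarrow> 'a list" where
  "cancel [] = []"
| "cancel (x # xs) = (let ys = cancel xs in if x \<in> set ys then remove1 x ys else x # ys)"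

text \<open>A family of pairs of disjoint directed cycles in which every unordered pair of arcs is met an even number
  of times. Sum the crossing numbers modulo 2 over the family and rewrite each pair of arcs with the smaller
  tail first: the crossing numbers cancel, and every exchange contributes \<open>interleave\<close>, up to terms that
  cancel along the cycles. The sum of the linking numbers modulo 2 is therefore the same in all
  drawings; the second condition says that it is odd.\<close>

definition odd_certificate :: "(nat list \<times> nat list) list \<Rightarrow> bool" where
  "odd_certificate P \<longleftrightarrow> cancel (map norm_pair (arc_pairs P)) = [] \<and>
     odd (\<Sum>(e,f)\<leftarrow>filter (\<lambda>p. \<not> fst (fst p) \<le> fst (snd p)) (arc_pairs P). interleave e f)"

lemma cancel_sum: "even (sum_list (map f xs) + sum_list (map f (cancel xs)))" for f :: "'a \<Rightarrow> nat"
proof (induction xs)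
  case (Cons x xs)
  show ?case
  proof (cases "x \<in> set (cancel xs)")
    case True
    then have "sum_list (map f (cancel xs)) = f x + sum_list (map f (remove1 x (cancel xs)))"
      by (rule sum_list_map_remove1)
    with Cons True show ?thesis by (simp add: Let_def) argo
  qed (use Cons in \<open>auto simp: Let_def\<close>)
qed simp

lemma sum_list_product: "(\<Sum>p\<leftarrow>List.product xs ys. f p) = (\<Sum>x\<leftarrow>xs. \<Sum>y\<leftarrow>ys. f (x,y))" for f :: "_ \<Rightarrow> nat"
  by (induction xs) (auto simp: comp_def)

lemma arc_pairs_sum: "(\<Sum>p\<leftarrow>arc_pairs P. f p) = (\<Sum>(C,D)\<leftarrow>P. \<Sum>e\<leftarrow>cyc_arcs C. \<Sum>f'\<leftarrow>cyc_arcs D. f (e,f'))" for f :: "_ \<Rightarrow> nat"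
  unfolding arc_pairs_def by (induction P) (auto simp: sum_list_product)

text \<open>Replacing \<open>q e f\<close> by \<open>q f e\<close> at the pairs that stand in the other order costs exactly the interleaving
  numbers; what remains cancels in pairs.\<close>

lemma certificate_contradiction:
  fixes q :: "nat \<times> nat \<Rightarrow> nat \<times> nat \<Rightarrow> nat"
  assumes cert: "odd_certificate P"
    and sym: "\<And>e f. (e,f) \<in> set (arc_pairs P) \<Longrightarrow> even (q e f + q f e + interleave e f)"
    and ev: "\<And>C D. (C,D) \<in> set P \<Longrightarrow> even (\<Sum>e\<leftarrow>cyc_arcs C. \<Sum>f\<leftarrow>cyc_arcs D. q e f)"
  shows False
proof -
  let ?q = "\<lambda>p. q (fst p) (snd p)" and ?ok = "\<lambda>p. fst (fst p) \<le> fst (snd p)"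
  have 1: "even (\<Sum>p\<leftarrow>arc_pairs P. ?q p)" unfolding arc_pairs_sum
    by (intro sum_list_even) (use ev in auto)
  have 2: "even (\<Sum>p\<leftarrow>map norm_pair (arc_pairs P). ?q p)"
    using cancel_sum[of ?q "map norm_pair (arc_pairs P)"] cert unfolding odd_certificate_def by simp
  have "even (\<Sum>p\<leftarrow>ps. ?q p + ?q (norm_pair p) + (if ?ok p then 0 else interleave (fst p) (snd p)))"
    if "set ps \<subseteq> set (arc_pairs P)" for ps
    by (intro sum_list_even) (use that sym in \<open>force simp: norm_pair_def\<close>)
  from this[OF subset_refl] have 3: "even ((\<Sum>p\<leftarrow>arc_pairs P. ?q p) + (\<Sum>p\<leftarrow>arc_pairs P. ?q (norm_pair p)) +
     (\<Sum>p\<leftarrow>arc_pairs P. if ?ok p then 0 else interleave (fst p) (snd p)))"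
    unfolding sum_list_add .
  have "(\<Sum>p\<leftarrow>ps. if ?ok p then 0 else interleave (fst p) (snd p)) = (\<Sum>(e,f)\<leftarrow>filter (\<lambda>p. \<not> ?ok p) ps. interleave e f)" for ps
    by (induction ps) (auto simp: case_prod_beta)
  with 3 have "even ((\<Sum>p\<leftarrow>arc_pairs P. ?q p) + (\<Sum>p\<leftarrow>arc_pairs P. ?q (norm_pair p)) +
     (\<Sum>(e,f)\<leftarrow>filter (\<lambda>p. \<not> ?ok p) (arc_pairs P). interleave e f))" by simp
  moreover have "(\<Sum>p\<leftarrow>map norm_pair (arc_pairs P). ?q p) = (\<Sum>p\<leftarrow>arc_pairs P. ?q (norm_pair p))"
    by (simp add: comp_def)
  ultimately show False using 1 2 cert unfolding odd_certificate_def by simp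
qed

text \<open>The numbering of the vertices need not agree with their order from west to east; the discrepancy \<open>\<mu>\<close>
  and the terms with \<open>beneath\<close> telescope along the cycles.\<close>

lemma drawing_contradiction:
  fixes pl :: "nat \<times> nat \<Rightarrow> (real^3) list" and pos :: "nat \<Rightarrow> real^3"
  assumes cert: "odd_certificate P"
    and C: "\<And>C D. (C,D) \<in> set P \<Longrightarrow> C \<noteq> [] \<and> D \<noteq> []"
    and ends: "\<And>e f. (e,f) \<in> set (arc_pairs P) \<Longrightarrow> pl e \<noteq> [] \<and> hd (pl e) = pos (fst e) \<and> last (pl e) = pos (snd e)
      \<and> pl f \<noteq> [] \<and> hd (pl f) = pos (fst f) \<and> last (pl f) = pos (snd f)"
    and dis: "\<And>e f. (e,f) \<in> set (arc_pairs P) \<Longrightarrow> fst e \<noteq> fst f \<and> fst e \<noteq> snd f \<and> snd e \<noteq> fst f \<and> snd e \<noteq> snd f"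
    and inj: "\<And>e f u v. (e,f) \<in> set (arc_pairs P) \<Longrightarrow> u \<in> {fst e, snd e} \<Longrightarrow> v \<in> {fst f, snd f} \<Longrightarrow> pos u $ 1 \<noteq> pos v $ 1"
    and cr: "\<And>e f g g'. (e,f) \<in> set (arc_pairs P) \<Longrightarrow> g \<in> set (links (pl e)) \<Longrightarrow> g' \<in> set (links (pl f)) \<Longrightarrow>
      even (of_bool (over g g') + of_bool (over g' g) + crossing_sum g g')"
    and ev: "\<And>C D. (C,D) \<in> set P \<Longrightarrow> even (\<Sum>e\<leftarrow>cyc_arcs C. \<Sum>f\<leftarrow>cyc_arcs D. arc_over pl e f)"
  shows False
proof -
  let ?w = "\<lambda>u v. west (pos u) (pos v)" and ?R = "\<lambda>v f. arc_beneath pl (pos v) f"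
  define \<mu> where "\<mu> u v = (of_bool (u < v \<and> (pos u$1 < pos v$1) \<noteq> (u < v)) :: nat)" for u v :: nat
  define m where "m e f = \<mu> (fst e) (fst f) + \<mu> (fst e) (snd f) + (\<mu> (snd e) (fst f) + \<mu> (snd e) (snd f))" for e f :: "nat \<times> nat"
  define q where "q e f = arc_over pl e f + (?R (fst e) f + ?R (snd e) f) + m e f" for e f
  show False
  proof (rule certificate_contradiction[OF cert, of q])
    fix e f assume ef: "(e,f) \<in> set (arc_pairs P)"
    have \<mu>: "even (\<mu> u v + \<mu> v u + ?w u v + of_bool (u < v))" if "u \<in> {fst e, snd e}" "v \<in> {fst f, snd f}" for u v
    proof -
      have "u \<noteq> v" using that dis[OF ef] by auto
      with inj[OF ef that] show ?thesis unfolding \<mu>_def by (cases "u < v"; cases "pos u$1 < pos v$1"; simp)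
    qed
    have "even (arc_over pl e f + arc_over pl f e + (?R (fst e) f + ?R (snd e) f + ?R (fst f) e + ?R (snd f) e
     + (?w (fst e) (fst f) + ?w (fst e) (snd f) + ?w (snd e) (fst f) + ?w (snd e) (snd f))))"
      using arc_parity[of pl e f, OF _ _ cr[OF ef]] ends[OF ef] by simp
    with \<mu>[of "fst e" "fst f"] \<mu>[of "fst e" "snd f"] \<mu>[of "snd e" "fst f"] \<mu>[of "snd e" "snd f"]
    show "even (q e f + q f e + interleave e f)"
      unfolding q_def m_def interleave_def even_add by (simp only: insert_iff simp_thms) argo
  next
    fix C D assume P: "(C,D) \<in> set P"
    have "even (\<Sum>f\<leftarrow>cyc_arcs D. \<Sum>e\<leftarrow>cyc_arcs C. ?R (fst e) f + ?R (snd e) f)"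
      by (intro sum_list_even cycle_telescope[of C "\<lambda>v. ?R v _"]) (use C[OF P] in simp)
    moreover have "even (\<Sum>f\<leftarrow>cyc_arcs D. \<Sum>e\<leftarrow>cyc_arcs C. m e f)" unfolding m_def
      by (intro sum_list_even cycle_telescope[of C "\<lambda>u. \<mu> u (fst _) + \<mu> u (snd _)"]) (use C[OF P] in simp)
    moreover have "(\<Sum>e\<leftarrow>cyc_arcs C. \<Sum>f\<leftarrow>cyc_arcs D. q e f) = (\<Sum>e\<leftarrow>cyc_arcs C. \<Sum>f\<leftarrow>cyc_arcs D. arc_over pl e f)
      + (\<Sum>f\<leftarrow>cyc_arcs D. \<Sum>e\<leftarrow>cyc_arcs C. ?R (fst e) f + ?R (snd e) f) + (\<Sum>f\<leftarrow>cyc_arcs D. \<Sum>e\<leftarrow>cyc_arcs C. m e f)"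
      unfolding sum_list_swap[of _ "cyc_arcs D" "cyc_arcs C"] unfolding sum_list_add[symmetric] q_def ..
    ultimately show "even (\<Sum>e\<leftarrow>cyc_arcs C. \<Sum>f\<leftarrow>cyc_arcs D. q e f)"
      using ev[OF P] by simp
  qed
qed

section \<open>General position and walks\<close>

lemma hyperplane_seen: "a$1 \<noteq> b$1 \<Longrightarrow> negligible {x. Im (seen a b x) = 0}" for a b :: "real^3"
proof -
  assume ab: "a$1 \<noteq> b$1"
  let ?n = "vector [a$2 - b$2, b$1 - a$1, 0] :: real^3"
  have "Im (seen a b x) = (a$1 * b$2 - a$2 * b$1) + ?n \<bullet> x" for x
    unfolding Im_seen by (simp add: inner_vec_def sum_3 algebra_simps)
  moreover have "p = (A - B) + r \<Longrightarrow> p = 0 \<longleftrightarrow> r = B - A" for p A B r :: real by auto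
  ultimately have "{x. Im (seen a b x) = 0} = {x. ?n \<bullet> x = a$2 * b$1 - a$1 * b$2}" by blast
  moreover have "?n $ 2 \<noteq> 0" using ab by simp
  then have "?n \<noteq> 0" by (metis zero_index)
  ultimately show ?thesis using negligible_hyperplane[of ?n] by simp
qed

lemma hyperplane_coord: "negligible {x :: real^3. x$1 = c}"
proof -
  have "{x :: real^3. x$1 = c} = {x. axis 1 1 \<bullet> x = c}" by (simp add: inner_axis' )
  then show ?thesis using negligible_hyperplane[of "axis 1 1 :: real^3" c] by (simp add: axis_eq_0_iff)
qed

lemma seen_perm:
  "Im (seen b a c) = - Im (seen a b c)" "Im (seen a c b) = - Im (seen a b c)" "Im (seen c b a) = - Im (seen a b c)"
  "Im (seen b c a) = Im (seen a b c)" "Im (seen c a b) = Im (seen a b c)"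
  unfolding Im_seen by algebra+

definition general :: "('i \<Rightarrow> real^3) \<Rightarrow> 'i set \<Rightarrow> bool" where
  "general q J \<longleftrightarrow> (\<forall>i\<in>J. \<forall>j\<in>J. i \<noteq> j \<longrightarrow> q i $ 1 \<noteq> q j $ 1) \<and>
     (\<forall>i\<in>J. \<forall>j\<in>J. \<forall>k\<in>J. i \<noteq> j \<longrightarrow> i \<noteq> k \<longrightarrow> j \<noteq> k \<longrightarrow> Im (seen (q i) (q j) (q k)) \<noteq> 0)"

text \<open>The points are chosen one after another outside finitely many hyperplanes, which form a null set.\<close>

lemma perturb_general:
  assumes "finite J" "\<delta> > 0"
  shows "\<exists>q. general q J \<and> (\<forall>j\<in>J. dist (p j) (q j) < \<delta>)"
  using assms(1)
proof induction
  case empty then show ?case by (auto simp: general_def)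
next
  case (insert j J)
  then obtain q where q: "general q J" "\<And>j. j \<in> J \<Longrightarrow> dist (p j) (q j) < \<delta>" by blast
  let ?B1 = "\<Union>i\<in>J. {x::real^3. x$1 = q i $ 1}" and ?B2 = "\<Union>i\<in>J. \<Union>k\<in>J - {i}. {x. Im (seen (q i) (q k) x) = 0}"
  have "negligible ?B1" using insert.hyps(1) hyperplane_coord by (intro negligible_Union) auto
  moreover have "negligible ?B2"
  proof (intro negligible_Union)
    show "negligible t" if "t \<in> (\<lambda>i. \<Union>k\<in>J - {i}. {x. Im (seen (q i) (q k) x) = 0}) ` J" for t
    proof -
      from that obtain i where i: "i \<in> J" "t = (\<Union>k\<in>J - {i}. {x. Im (seen (q i) (q k) x) = 0})" by blast
      show ?thesis unfolding i(2)
      proof (intro negligible_Union)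
        show "negligible s" if "s \<in> (\<lambda>k. {x. Im (seen (q i) (q k) x) = 0}) ` (J - {i})" for s
          using that q(1) i(1) unfolding general_def by (auto intro!: hyperplane_seen)
      qed (use insert.hyps(1) in auto)
    qed
  qed (use insert.hyps(1) in auto)
  ultimately have "negligible (?B1 \<union> ?B2)" by (rule negligible_Un)
  moreover have "\<not> negligible (ball (p j) \<delta>)" using assms(2) by (intro open_not_negligible) auto
  ultimately obtain x where x: "x \<in> ball (p j) \<delta>" "x \<notin> ?B1 \<union> ?B2"
    by (meson negligible_subset subsetI)
  have x1: "x$1 \<noteq> q i $ 1" if "i \<in> J" for i using x(2) that by blast
  have x2: "Im (seen (q i) (q k) x) \<noteq> 0" if "i \<in> J" "k \<in> J" "i \<noteq> k" for i k using x(2) that by blast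
  let ?q = "q(j := x)"
  have "general ?q (insert j J)"
    unfolding general_def
  proof (intro conjI ballI impI)
    fix i k assume "i \<in> insert j J" "k \<in> insert j J" "i \<noteq> k"
    then show "?q i $ 1 \<noteq> ?q k $ 1" using x1[of i] x1[of k] q(1) unfolding general_def by auto
  next
    fix i k l assume *: "i \<in> insert j J" "k \<in> insert j J" "l \<in> insert j J" "i \<noteq> k" "i \<noteq> l" "k \<noteq> l"
    consider "i = j" "k \<in> J" "l \<in> J" "k \<noteq> j" "l \<noteq> j" | "k = j" "i \<in> J" "l \<in> J" "i \<noteq> j" "l \<noteq> j" | "l = j" "i \<in> J" "k \<in> J" "i \<noteq> j" "k \<noteq> j"
      | "i \<in> J" "k \<in> J" "l \<in> J" "i \<noteq> j" "k \<noteq> j" "l \<noteq> j"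
      using * insert.hyps(2) by blast
    then show "Im (seen (?q i) (?q k) (?q l)) \<noteq> 0"
    proof cases
      case 1 then show ?thesis using x2[of k l] * seen_perm(4)[of "q k" "q l" x] by simp
    next
      case 2 then show ?thesis using x2[of i l] * by (simp add: seen_perm(2)[of "q i" "q l" x])
    next
      case 3 then show ?thesis using x2[of i k] * by simp
    next
      case 4 then show ?thesis using q(1) * unfolding general_def by simp
    qed
  qed
  moreover have "\<forall>i\<in>insert j J. dist (p i) (?q i) < \<delta>" using q(2) x(1) by auto
  ultimately show ?case by blast
qed

lemma links_append: "P \<noteq> [] \<Longrightarrow> W \<noteq> [] \<Longrightarrow> last P = hd W \<Longrightarrow> links (butlast P @ W) = links P @ links W"
proof (induction P rule: links.induct)
  case (1 x y xs)
  then have IH: "links (butlast (y # xs) @ W) = links (y # xs) @ links W" by simp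
  obtain z zs where z: "butlast (y # xs) @ W = z # zs" "z = y"
    using 1(3,4) by (cases xs; cases W) auto
  have "butlast (x # y # xs) @ W = x # butlast (y # xs) @ W" by simp
  then show ?case using IH unfolding z by simp
qed auto

fun walk :: "('a \<Rightarrow> 'b list) \<Rightarrow> 'a list \<Rightarrow> 'b list" where
  "walk p [] = []"
| "walk p [e] = p e"
| "walk p (e # f # es) = butlast (p e) @ walk p (f # es)"

lemma walk:
  assumes "es \<noteq> []" "\<And>e. e \<in> set es \<Longrightarrow> p e \<noteq> []" "\<And>e f. (e,f) \<in> set (links es) \<Longrightarrow> last (p e) = hd (p f)"
  shows "walk p es \<noteq> [] \<and> hd (walk p es) = hd (p (hd es)) \<and> last (walk p es) = last (p (last es))
    \<and> links (walk p es) = concat (map (\<lambda>e. links (p e)) es) \<and> set (walk p es) \<subseteq> (\<Union>e\<in>set es. set (p e))"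
  using assms
proof (induction es rule: links.induct)
  case (1 e f es)
  let ?W = "walk p (f # es)"
  have IH: "?W \<noteq> []" "hd ?W = hd (p f)" "last ?W = last (p (last (f # es)))"
    "links ?W = concat (map (\<lambda>e. links (p e)) (f # es))" "set ?W \<subseteq> (\<Union>e\<in>set (f # es). set (p e))"
    using 1 by auto
  have l: "last (p e) = hd ?W" "p e \<noteq> []" using 1(3,4) IH(2) by auto
  have "hd (butlast (p e) @ ?W) = hd (p e)"
    using l IH(1) by (cases "p e" rule: links.cases) auto
  moreover have "links (butlast (p e) @ ?W) = links (p e) @ links ?W" by (rule links_append[OF l(2) IH(1) l(1)])
  moreover have "set (butlast (p e)) \<subseteq> set (p e)" by (meson in_set_butlastD subsetI)
  ultimately show ?case using IH by auto
qed auto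

lemma links_links: "(e,f) \<in> set (links (links ys)) \<Longrightarrow> snd e = fst f"
proof (induction ys rule: links.induct)
  case (1 x y xs)
  then show ?case by (cases xs) auto
qed auto

lemma links_ends: "length ys \<ge> 2 \<Longrightarrow> links ys \<noteq> [] \<and> fst (hd (links ys)) = hd ys \<and> snd (last (links ys)) = last ys"
proof (induction ys rule: links.induct)
  case (1 x y xs)
  then show ?case by (cases xs) auto
qed auto

lemma links_zip: "links xs = zip xs (tl xs)"
  by (induction xs rule: links.induct) auto

lemma links_map_upt: "links (map f [0..<Suc m]) = map (\<lambda>i. (f i, f (Suc i))) [0..<m]"
  unfolding links_zip
proof (rule nth_equalityI)
  show "length (zip (map f [0..<Suc m]) (tl (map f [0..<Suc m]))) = length (map (\<lambda>i. (f i, f (Suc i))) [0..<m])"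
    by simp
  fix i assume "i < length (zip (map f [0..<Suc m]) (tl (map f [0..<Suc m])))"
  then have i: "i < m" by simp
  then have "tl (map f [0..<Suc m]) ! i = f (Suc i)" "map f [0..<Suc m] ! i = f i"
    by (simp_all add: nth_tl del: upt_Suc)
  then show "zip (map f [0..<Suc m]) (tl (map f [0..<Suc m])) ! i = map (\<lambda>i. (f i, f (Suc i))) [0..<m] ! i"
    using i by (simp del: upt_Suc)
qed

section \<open>From curves to polygons\<close>

lemma Im_seen_segment:
  assumes "Im (seen k k' l) \<noteq> 0" "x \<in> closed_segment k k'"
  shows "hor l \<noteq> hor x"
proof
  assume h: "hor l = hor x"
  obtain t where t: "x = (1 - t) *\<^sub>R k + t *\<^sub>R k'" using assms(2) unfolding in_segment by blast
  have "Im (seen k k' x) = 0" unfolding t Im_seen_affine by (simp add: Im_seen)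
  moreover have "l$1 = x$1" "l$2 = x$2" using h unfolding hor_def by simp_all
  ultimately show False using assms(1) unfolding Im_seen by simp
qed

lemma uniform_neighbourhood:
  assumes "finite R" "\<And>g W. (g,W) \<in> R \<Longrightarrow> continuous_on {0..1::real} g \<and> open W \<and> g ` {0..1} \<subseteq> W"
  shows "\<exists>\<epsilon>>0. \<forall>(g,W)\<in>R. \<forall>t\<in>{0..1}. ball (g t :: real^3) \<epsilon> \<subseteq> W"
  using assms
proof (induction R)
  case (insert r R)
  obtain g W where r: "r = (g,W)" by force
  have g: "continuous_on {0..1} g" "open W" "g ` {0..1} \<subseteq> W" using insert.prems[of g W] r by auto
  have "compact (g ` {0..1})" using g(1) by (intro compact_continuous_image) auto
  then obtain e where e: "e > 0" "(\<Union>x\<in>g ` {0..1}. ball x e) \<subseteq> W"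
    using compact_subset_open_imp_ball_epsilon_subset[OF _ g(2,3)] by metis
  have "\<exists>\<epsilon>>0. \<forall>(g,W)\<in>R. \<forall>t\<in>{0..1}. ball (g t) \<epsilon> \<subseteq> W"
    using insert.IH insert.prems by blast
  then obtain e' where e': "e' > 0" "\<And>g W t. (g,W) \<in> R \<Longrightarrow> t \<in> {0..1} \<Longrightarrow> ball (g t) e' \<subseteq> W" by blast
  have "ball (g' t) (min e e') \<subseteq> W'" if "(g',W') \<in> insert r R" "t \<in> {0..1}" for g' W' t
  proof (cases "(g',W') = r")
    case True
    then have "ball (g' t) e \<subseteq> W'" using e(2) that(2) r by blast
    then show ?thesis using subset_ball[of "min e e'" e "g' t"] by auto
  next
    case False
    then have "ball (g' t) e' \<subseteq> W'" using e'(2) that by blast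
    then show ?thesis using subset_ball[of "min e e'" e' "g' t"] by auto
  qed
  moreover have "min e e' > 0" using e(1) e'(1) by simp
  ultimately show ?case by blast
qed (auto intro: exI[of _ 1])

text \<open>Uniform continuity for finitely many curves at once.\<close>

lemma uniform_subdivision:
  assumes "finite A" "\<And>e. e \<in> A \<Longrightarrow> continuous_on {0..1::real} (g e)" "\<epsilon> > 0"
  shows "\<exists>m\<ge>2. \<forall>e\<in>A. \<forall>i<m. dist (g e (real i / real m) :: real^3) (g e (real (Suc i) / real m)) < \<epsilon>"
proof -
  have "\<exists>d>0. \<forall>e\<in>A. \<forall>s\<in>{0..1}. \<forall>t\<in>{0..1}. dist s t < d \<longrightarrow> dist (g e s) (g e t) < \<epsilon>"
    using assms(1,2)
  proof (induction A)
    case (insert e A)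
    have "uniformly_continuous_on {0..1} (g e)" using insert.prems by (intro compact_uniformly_continuous) auto
    then obtain d where d: "d > 0" "\<And>s t. s \<in> {0..1} \<Longrightarrow> t \<in> {0..1} \<Longrightarrow> dist s t < d \<Longrightarrow> dist (g e s) (g e t) < \<epsilon>"
      unfolding uniformly_continuous_on_def using assms(3) by (metis dist_commute)
    obtain d' where d': "d' > 0" "\<And>e s t. e \<in> A \<Longrightarrow> s \<in> {0..1} \<Longrightarrow> t \<in> {0..1} \<Longrightarrow> dist s t < d' \<Longrightarrow> dist (g e s) (g e t) < \<epsilon>"
      using insert by blast
    show ?case using d d' by (intro exI[of _ "min d d'"]) auto
  qed (auto intro: exI[of _ 1])
  then obtain d where d: "d > 0" "\<And>e s t. e \<in> A \<Longrightarrow> s \<in> {0..1} \<Longrightarrow> t \<in> {0..1} \<Longrightarrow> dist s t < d \<Longrightarrow> dist (g e s) (g e t) < \<epsilon>"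
    by blast
  obtain n where n: "1 / real (Suc n) < d" using d(1) reals_Archimedean by (metis inverse_eq_divide)
  let ?m = "Suc (Suc n)"
  have "dist (g e (real i / real ?m)) (g e (real (Suc i) / real ?m)) < \<epsilon>" if "e \<in> A" "i < ?m" for e i
  proof (rule d(2)[OF that(1)])
    show "real i / real ?m \<in> {0..1}" "real (Suc i) / real ?m \<in> {0..1}" using that(2) by auto
    have "dist (real i / real ?m) (real (Suc i) / real ?m) = 1 / real ?m"
      by (simp add: dist_real_def diff_divide_distrib[symmetric])
    also have "\<dots> \<le> 1 / real (Suc n)" by (simp add: frac_le)
    finally show "dist (real i / real ?m) (real (Suc i) / real ?m) < d" using n by linarith
  qed
  then show ?thesis by (intro exI[of _ ?m]) simp
qed

text \<open>The only property of a separating sphere that is used: polygons on its two sides cross over each other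
  an even number of times. Unlike a sphere it is preserved when the curves are moved slightly, because it
  speaks of open sets.\<close>

definition even_sep :: "(real^3) set \<Rightarrow> (real^3) set \<Rightarrow> bool" where
  "even_sep W W' \<longleftrightarrow> open W \<and> open W' \<and> W \<inter> W' = {} \<and>
    (\<forall>ks ls. ks \<noteq> [] \<longrightarrow> last ks = hd ks \<longrightarrow> ls \<noteq> [] \<longrightarrow> last ls = hd ls \<longrightarrow> set ls \<subseteq> W' \<longrightarrow>
      (\<forall>(a,b)\<in>set (links ks). closed_segment a b \<subseteq> W) \<longrightarrow> (\<forall>(a,b)\<in>set (links ls). closed_segment a b \<subseteq> W') \<longrightarrow>
      genpos ks ls \<longrightarrow> even (\<Sum>e\<leftarrow>links ks. \<Sum>f\<leftarrow>links ls. of_bool (over e f) :: nat))"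

lemma even_sepD:
  assumes "even_sep W W'"
  shows "open W" "open W'" "W \<inter> W' = {}"
proof -
  note a = assms[unfolded even_sep_def]
  show "open W" by (rule conjunct1[OF a])
  show "open W'" by (rule conjunct1[OF conjunct2[OF a]])
  show "W \<inter> W' = {}" by (rule conjunct1[OF conjunct2[OF conjunct2[OF a]]])
qed

lemma even_sep_even:
  assumes "even_sep W W'" "ks \<noteq> []" "last ks = hd ks" "ls \<noteq> []" "last ls = hd ls" "set ls \<subseteq> W'"
    "\<And>a b. (a,b) \<in> set (links ks) \<Longrightarrow> closed_segment a b \<subseteq> W" "\<And>a b. (a,b) \<in> set (links ls) \<Longrightarrow> closed_segment a b \<subseteq> W'"
    "genpos ks ls"
  shows "even (\<Sum>e\<leftarrow>links ks. \<Sum>f\<leftarrow>links ls. of_bool (over e f) :: nat)"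
proof -
  have "\<forall>(a,b)\<in>set (links ks). closed_segment a b \<subseteq> W" "\<forall>(a,b)\<in>set (links ls). closed_segment a b \<subseteq> W'"
    using assms(7,8) by fast+
  then show ?thesis
    using assms(1)[unfolded even_sep_def, THEN conjunct2, THEN conjunct2, THEN conjunct2, rule_format, OF assms(2-6) _ _ assms(9)]
    by fast
qed

text \<open>Polygons in general position that follow the curves closely stay inside the separating open sets, so all
  crossing numbers of the family are even, in contradiction to \<open>drawing_contradiction\<close>.\<close>

theorem separated_certificate_contradiction:
  fixes g :: "nat \<times> nat \<Rightarrow> real \<Rightarrow> real^3" and F :: "nat \<Rightarrow> real^3"
  assumes cert: "odd_certificate P"
    and P: "\<And>C D. (C,D) \<in> set P \<Longrightarrow> C \<noteq> [] \<and> D \<noteq> [] \<and> set C \<inter> set D = {}"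
    and g: "\<And>C D e. (C,D) \<in> set P \<Longrightarrow> e \<in> set (cyc_arcs C) \<union> set (cyc_arcs D) \<Longrightarrow>
      continuous_on {0..1} (g e) \<and> g e 0 = F (fst e) \<and> g e 1 = F (snd e)"
    and sep: "\<And>C D. (C,D) \<in> set P \<Longrightarrow> \<exists>W W'. even_sep W W' \<and>
      (\<forall>e\<in>set (cyc_arcs C). g e ` {0..1} \<subseteq> W) \<and> (\<forall>e\<in>set (cyc_arcs D). g e ` {0..1} \<subseteq> W')"
  shows False
proof -
  have "\<forall>p\<in>set P. \<exists>W W'. even_sep W W' \<and>
      (\<forall>e\<in>set (cyc_arcs (fst p)). g e ` {0..1} \<subseteq> W) \<and> (\<forall>e\<in>set (cyc_arcs (snd p)). g e ` {0..1} \<subseteq> W')"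
    using sep by auto
  then obtain W W' where W: "\<And>p. p \<in> set P \<Longrightarrow> even_sep (W p) (W' p)"
    "\<And>p e. p \<in> set P \<Longrightarrow> e \<in> set (cyc_arcs (fst p)) \<Longrightarrow> g e ` {0..1} \<subseteq> W p"
    "\<And>p e. p \<in> set P \<Longrightarrow> e \<in> set (cyc_arcs (snd p)) \<Longrightarrow> g e ` {0..1} \<subseteq> W' p"
    by metis
  define A where "A = (\<Union>p\<in>set P. set (cyc_arcs (fst p)) \<union> set (cyc_arcs (snd p)))"
  have finA: "finite A" unfolding A_def by simp
  have gA: "continuous_on {0..1} (g e)" "g e 0 = F (fst e)" "g e 1 = F (snd e)" if "e \<in> A" for e
    using that g unfolding A_def by fastforce+
  define R where "R = (\<Union>p\<in>set P. (\<lambda>e. (g e, W p)) ` set (cyc_arcs (fst p)) \<union> (\<lambda>e. (g e, W' p)) ` set (cyc_arcs (snd p)))"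
  have "\<exists>\<epsilon>>0. \<forall>(g,W)\<in>R. \<forall>t\<in>{0..1}. ball (g t) \<epsilon> \<subseteq> W"
  proof (rule uniform_neighbourhood)
    show "finite R" unfolding R_def by simp
    show "continuous_on {0..1} c \<and> open V \<and> c ` {0..1} \<subseteq> V" if "(c,V) \<in> R" for c V
    proof -
      from that obtain p e where p: "p \<in> set P" "c = g e"
        "e \<in> set (cyc_arcs (fst p)) \<and> V = W p \<or> e \<in> set (cyc_arcs (snd p)) \<and> V = W' p"
        unfolding R_def by blast
      then have "e \<in> A" unfolding A_def by blast
      then have "continuous_on {0..1} c" using gA(1) p(2) by blast
      moreover have "open V" using even_sepD(1,2)[OF W(1)[OF p(1)]] p(3) by blast
      moreover have "c ` {0..1} \<subseteq> V" using W(2,3)[OF p(1)] p(2,3) by blast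
      ultimately show ?thesis by blast
    qed
  qed
  then obtain \<epsilon> where \<epsilon>: "\<epsilon> > 0" "\<And>c V t. (c,V) \<in> R \<Longrightarrow> t \<in> {0..1} \<Longrightarrow> ball (c t) \<epsilon> \<subseteq> V" by blast
  have "\<epsilon>/2 > 0" using \<epsilon>(1) by simp
  then obtain m where m: "m \<ge> 2" "\<And>e i. e \<in> A \<Longrightarrow> i < m \<Longrightarrow> dist (g e (real i / real m)) (g e (real (Suc i) / real m)) < \<epsilon>/2"
    using uniform_subdivision[where g=g and \<epsilon>="\<epsilon>/2", OF finA gA(1)] by blast
  \<comment> \<open>Vertices are shared between arcs, interior points belong to one arc.\<close>
  define ix where "ix e i = (if i = 0 then Inl (fst e) else if i = m then Inl (snd e) else Inr (e, i))" for e :: "nat \<times> nat" and i :: nat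
  define c where "c j = (case j of Inl v \<Rightarrow> F v | Inr (e,i) \<Rightarrow> g e (real i / real m))" for j :: "nat + (nat \<times> nat) \<times> nat"
  have c_ix: "c (ix e i) = g e (real i / real m)" if "e \<in> A" "i \<le> m" for e i
    using gA[OF that(1)] that m(1) unfolding c_def ix_def by auto
  define J where "J = (\<Union>e\<in>A. ix e ` {..m})"
  have "finite J" unfolding J_def using finA by simp
  then obtain q where q: "general q J" "\<And>j. j \<in> J \<Longrightarrow> dist (c j) (q j) < \<epsilon>/2"
    using perturb_general[of J "\<epsilon>/2" c] \<epsilon>(1) by auto
  define pl where "pl e = map (\<lambda>i. q (ix e i)) [0..<Suc m]" for e
  have lk: "links (pl e) = map (\<lambda>i. (q (ix e i), q (ix e (Suc i)))) [0..<m]" for e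
    unfolding pl_def by (rule links_map_upt)
  have pl: "pl e \<noteq> []" "hd (pl e) = q (Inl (fst e))" "last (pl e) = q (Inl (snd e))" for e
    using m(1) unfolding pl_def ix_def by (simp_all add: hd_map last_map del: upt_Suc)
  have inJ: "ix e i \<in> J" if "e \<in> A" "i \<le> m" for e i using that unfolding J_def by auto
  have near: "closed_segment (q (ix e i)) (q (ix e (Suc i))) \<subseteq> V" if eA: "e \<in> A" and R: "(g e, V) \<in> R" and i: "i < m" for e V i
  proof -
    let ?x = "g e (real i / real m)"
    have "dist ?x (q (ix e i)) < \<epsilon>/2" using q(2)[OF inJ[OF eA, of i]] c_ix[OF eA, of i] i by simp
    moreover have "dist (g e (real (Suc i) / real m)) (q (ix e (Suc i))) < \<epsilon>/2"
      using q(2)[OF inJ[OF eA, of "Suc i"]] c_ix[OF eA, of "Suc i"] i by simp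
    ultimately have "q (ix e i) \<in> ball ?x \<epsilon>" "q (ix e (Suc i)) \<in> ball ?x \<epsilon>"
      using m(2)[OF eA i] dist_triangle[of ?x "q (ix e (Suc i))" "g e (real (Suc i) / real m)"] \<epsilon>(1) by auto
    then have "closed_segment (q (ix e i)) (q (ix e (Suc i))) \<subseteq> ball ?x \<epsilon>" by (rule closed_segment_subset) simp
    moreover have "ball ?x \<epsilon> \<subseteq> V" using \<epsilon>(2)[OF R] i by simp
    ultimately show ?thesis by blast
  qed
  have step: "ix e i \<noteq> ix e (Suc i)" if "i < m" for e i using that m(1) unfolding ix_def by auto
  have disj: "ix e i \<noteq> ix f j" if "fst e \<noteq> fst f" "fst e \<noteq> snd f" "snd e \<noteq> fst f" "snd e \<noteq> snd f" for e f i j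
    using that unfolding ix_def by auto
  have pairs: "e \<in> A \<and> f \<in> A \<and> fst e \<noteq> fst f \<and> fst e \<noteq> snd f \<and> snd e \<noteq> fst f \<and> snd e \<noteq> snd f"
    if CD: "(C,D) \<in> set P" and e: "e \<in> set (cyc_arcs C)" and f: "f \<in> set (cyc_arcs D)" for C D e f
  proof -
    have "fst e \<in> set C" "snd e \<in> set C"
      using links_subset[of "fst e" "snd e" "C @ [hd C]"] e P[OF CD] unfolding cyc_arcs_def by auto
    moreover have "fst f \<in> set D" "snd f \<in> set D"
      using links_subset[of "fst f" "snd f" "D @ [hd D]"] f P[OF CD] unfolding cyc_arcs_def by auto
    moreover have "e \<in> A" "f \<in> A" unfolding A_def by (rule UN_I[OF CD]; use e f in simp)+
    moreover have "\<forall>x\<in>set C. \<forall>y\<in>set D. x \<noteq> y" using P[OF CD] by (simp add: disjoint_iff_not_equal)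
    ultimately show ?thesis by simp
  qed
  have pairs': "e \<in> A \<and> f \<in> A \<and> fst e \<noteq> fst f \<and> fst e \<noteq> snd f \<and> snd e \<noteq> fst f \<and> snd e \<noteq> snd f"
    if "(e,f) \<in> set (arc_pairs P)" for e f
  proof -
    from that obtain C D where "(C,D) \<in> set P" "e \<in> set (cyc_arcs C)" "f \<in> set (cyc_arcs D)" unfolding arc_pairs_def by auto
    then show ?thesis by (rule pairs)
  qed
  have gen2: "q i $ 1 \<noteq> q j $ 1" if "i \<in> J" "j \<in> J" "i \<noteq> j" for i j using q(1) that unfolding general_def by blast
  have gen3: "Im (seen (q i) (q j) (q k)) \<noteq> 0" if "i \<in> J" "j \<in> J" "k \<in> J" "i \<noteq> j" "i \<noteq> k" "j \<noteq> k" for i j k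
    using q(1) that unfolding general_def by blast
  show False
  proof (rule drawing_contradiction[OF cert, of pl "\<lambda>v. q (Inl v)"])
    show "C \<noteq> [] \<and> D \<noteq> []" if "(C,D) \<in> set P" for C D using P[OF that] by blast
    show "pl e \<noteq> [] \<and> hd (pl e) = q (Inl (fst e)) \<and> last (pl e) = q (Inl (snd e)) \<and>
      pl f \<noteq> [] \<and> hd (pl f) = q (Inl (fst f)) \<and> last (pl f) = q (Inl (snd f))" for e f using pl by blast
    show "fst e \<noteq> fst f \<and> fst e \<noteq> snd f \<and> snd e \<noteq> fst f \<and> snd e \<noteq> snd f" if "(e,f) \<in> set (arc_pairs P)" for e f
      using pairs'[OF that] by blast
    show "q (Inl u) $ 1 \<noteq> q (Inl v) $ 1" if ef: "(e,f) \<in> set (arc_pairs P)" and u: "u \<in> {fst e, snd e}" and v: "v \<in> {fst f, snd f}" for e f u v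
    proof (rule gen2)
      note p = pairs'[OF ef]
      have J: "Inl (fst e) \<in> J" "Inl (snd e) \<in> J" if "e \<in> A" for e
        using inJ[OF that, of 0] inJ[OF that, of m] m(1) unfolding ix_def by auto
      show "Inl u \<in> J" "Inl v \<in> J" using J[of e] J[of f] p u v by blast+
      show "Inl u \<noteq> Inl v" using p u v by blast
    qed
  next
    fix e f g1 g2 assume ef: "(e,f) \<in> set (arc_pairs P)" and g: "g1 \<in> set (links (pl e))" "g2 \<in> set (links (pl f))"
    note p = pairs'[OF ef]
    obtain i where i: "i < m" "g1 = (q (ix e i), q (ix e (Suc i)))" using g(1) unfolding lk by auto
    obtain j where j: "j < m" "g2 = (q (ix f j), q (ix f (Suc j)))" using g(2) unfolding lk by auto
    have J: "ix e i \<in> J" "ix e (Suc i) \<in> J" "ix f j \<in> J" "ix f (Suc j) \<in> J" using inJ p i(1) j(1) by simp_all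
    have d: "ix e i \<noteq> ix f j" "ix e i \<noteq> ix f (Suc j)" "ix e (Suc i) \<noteq> ix f j" "ix e (Suc i) \<noteq> ix f (Suc j)"
      using disj[of e f] p by blast+
    from ef obtain C D where CD: "(C,D) \<in> set P" "e \<in> set (cyc_arcs C)" "f \<in> set (cyc_arcs D)" unfolding arc_pairs_def by auto
    have "(g e, W (C,D)) \<in> R" "(g f, W' (C,D)) \<in> R" unfolding R_def by (rule UN_I[OF CD(1)]; use CD(2,3) in simp)+
    then have "closed_segment (q (ix e i)) (q (ix e (Suc i))) \<subseteq> W (C,D)" "closed_segment (q (ix f j)) (q (ix f (Suc j))) \<subseteq> W' (C,D)"
      using near p i(1) j(1) by blast+
    then have s: "closed_segment (q (ix e i)) (q (ix e (Suc i))) \<inter> closed_segment (q (ix f j)) (q (ix f (Suc j))) = {}"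
      using even_sepD(3)[OF W(1)[OF CD(1)]] by blast
    show "even (of_bool (over g1 g2) + of_bool (over g2 g1) + crossing_sum g1 g2)"
      unfolding i(2) j(2)
      by (rule crossing_parity[OF _ _ _ _ _ _ _ _ _ _ s]; (rule gen2 gen3))
        (use J d step[OF i(1)] step[OF j(1)] in \<open>simp_all add: not_sym\<close>)
  next
    fix C D assume CD: "(C,D) \<in> set P"
    note p = P[OF CD]
    let ?k = "walk pl (cyc_arcs C)" and ?l = "walk pl (cyc_arcs D)"
    have w: "walk pl (cyc_arcs X) \<noteq> [] \<and> hd (walk pl (cyc_arcs X)) = last (walk pl (cyc_arcs X)) \<and>
      links (walk pl (cyc_arcs X)) = concat (map (\<lambda>e. links (pl e)) (cyc_arcs X)) \<and>
      set (walk pl (cyc_arcs X)) \<subseteq> (\<Union>e\<in>set (cyc_arcs X). set (pl e))" if X: "X \<noteq> []" for X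
    proof -
      have l: "length (X @ [hd X]) \<ge> 2" using X by (cases X) auto
      note le = links_ends[OF l]
      have "cyc_arcs X \<noteq> []" using le unfolding cyc_arcs_def by blast
      from walk[OF this, of pl] have wk: "walk pl (cyc_arcs X) \<noteq> [] \<and> hd (walk pl (cyc_arcs X)) = hd (pl (hd (cyc_arcs X))) \<and>
        last (walk pl (cyc_arcs X)) = last (pl (last (cyc_arcs X))) \<and>
        links (walk pl (cyc_arcs X)) = concat (map (\<lambda>e. links (pl e)) (cyc_arcs X)) \<and>
        set (walk pl (cyc_arcs X)) \<subseteq> (\<Union>e\<in>set (cyc_arcs X). set (pl e))"
        using pl links_links[of _ _ "X @ [hd X]"] unfolding cyc_arcs_def by simp
      moreover have "fst (hd (cyc_arcs X)) = snd (last (cyc_arcs X))" using le X unfolding cyc_arcs_def by (cases X) auto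
      ultimately show ?thesis using pl by simp
    qed
    have set_pl: "set (pl e) = (\<lambda>i. q (ix e i)) ` {..m}" for e unfolding pl_def by (auto simp del: upt_Suc)
    have vertex: "\<exists>e i. e \<in> set (cyc_arcs X) \<and> i \<le> m \<and> x = q (ix e i)"
      if X: "X \<noteq> []" and x: "x \<in> set (walk pl (cyc_arcs X))" for X x
    proof -
      have "x \<in> (\<Union>e\<in>set (cyc_arcs X). set (pl e))" using w[OF X] x by (elim conjE) (rule subsetD)
      then obtain e where e: "e \<in> set (cyc_arcs X)" "x \<in> set (pl e)" by (rule UN_E)
      then obtain i where "i \<le> m" "x = q (ix e i)" unfolding set_pl by auto
      with e(1) show ?thesis by blast
    qed
    have piece: "\<exists>e i. e \<in> set (cyc_arcs X) \<and> i < m \<and> a = q (ix e i) \<and> b = q (ix e (Suc i))"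
      if X: "X \<noteq> []" and ab: "(a,b) \<in> set (links (walk pl (cyc_arcs X)))" for X a b
    proof -
      have "links (walk pl (cyc_arcs X)) = concat (map (\<lambda>e. links (pl e)) (cyc_arcs X))" using w[OF X] by (elim conjE)
      then obtain e where e: "e \<in> set (cyc_arcs X)" "(a,b) \<in> set (links (pl e))" using ab by auto
      then obtain i where "i < m" "a = q (ix e i)" "b = q (ix e (Suc i))" unfolding lk by auto
      with e(1) show ?thesis by blast
    qed
    have ne: "C \<noteq> []" "D \<noteq> []" using p by simp_all
    note kv = vertex[OF ne(1)] and lv = vertex[OF ne(2)] and ke = piece[OF ne(1)] and le = piece[OF ne(2)]
    have RC: "(g e, W (C,D)) \<in> R" if "e \<in> set (cyc_arcs C)" for e unfolding R_def by (rule UN_I[OF CD]) (use that in simp)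
    have RD: "(g e, W' (C,D)) \<in> R" if "e \<in> set (cyc_arcs D)" for e unfolding R_def by (rule UN_I[OF CD]) (use that in simp)
    have AC: "e \<in> A" if "e \<in> set (cyc_arcs C) \<union> set (cyc_arcs D)" for e unfolding A_def by (rule UN_I[OF CD]) (use that in simp)
    have segk: "closed_segment a b \<subseteq> W (C,D)" if ab: "(a,b) \<in> set (links ?k)" for a b
      
    proof -
      obtain e i where e: "e \<in> set (cyc_arcs C)" "i < m" "a = q (ix e i)" "b = q (ix e (Suc i))" using ke[OF ab] by blast
      show ?thesis unfolding e(3,4) by (rule near[OF AC RC e(2)]) (use e(1) in simp_all)
    qed
    have segl: "closed_segment a b \<subseteq> W' (C,D)" if ab: "(a,b) \<in> set (links ?l)" for a b
      
    proof -
      obtain e i where e: "e \<in> set (cyc_arcs D)" "i < m" "a = q (ix e i)" "b = q (ix e (Suc i))" using le[OF ab] by blast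
      show ?thesis unfolding e(3,4) by (rule near[OF AC RD e(2)]) (use e(1) in simp_all)
    qed
    have ptl: "set ?l \<subseteq> W' (C,D)"
    proof
      fix x assume "x \<in> set ?l"
      then obtain e i where e: "e \<in> set (cyc_arcs D)" "i \<le> m" "x = q (ix e i)" using lv by blast
      have eA: "e \<in> A" by (rule AC) (use e(1) in simp)
      have "dist (g e (real i / real m)) x < \<epsilon>" using q(2)[OF inJ[OF eA e(2)]] c_ix[OF eA e(2)] e(3) \<epsilon>(1) by simp
      moreover have "real i / real m \<in> {0..1}" using e(2) m(1) by auto
      ultimately show "x \<in> W' (C,D)" using \<epsilon>(2)[OF RD[OF e(1)]] by (meson mem_ball subsetD)
    qed
    have gp1: "hor v \<noteq> hor x" if ab: "(a,b) \<in> set (links ?k)" and x: "x \<in> closed_segment a b" and v: "v \<in> set ?l" for a b x v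
    proof -
      obtain e i where e: "e \<in> set (cyc_arcs C)" "i < m" "a = q (ix e i)" "b = q (ix e (Suc i))" using ke[OF ab] by blast
      obtain f j where f: "f \<in> set (cyc_arcs D)" "j \<le> m" "v = q (ix f j)" using lv[OF v] by blast
      have A: "e \<in> A" "f \<in> A" and d: "ix e i \<noteq> ix f j" "ix e (Suc i) \<noteq> ix f j"
        using pairs[OF CD e(1) f(1)] by (simp_all add: disj)
      have "Im (seen a b v) \<noteq> 0" unfolding e f
        by (rule gen3[OF inJ[OF A(1)] inJ[OF A(1)] inJ[OF A(2) f(2)] step[OF e(2)] d]) (use e(2) in simp_all)
      from Im_seen_segment[OF this x] show ?thesis .
    qed
    have gp2: "Im (seen a b x) \<noteq> 0" if k: "x \<in> set ?k" and ab: "(a,b) \<in> set (links ?l)" for a b x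
    proof -
      obtain e i where e: "e \<in> set (cyc_arcs C)" "i \<le> m" "x = q (ix e i)" using kv[OF k] by blast
      obtain f j where f: "f \<in> set (cyc_arcs D)" "j < m" "a = q (ix f j)" "b = q (ix f (Suc j))" using le[OF ab] by blast
      have A: "e \<in> A" "f \<in> A" and d: "ix f j \<noteq> ix e i" "ix f (Suc j) \<noteq> ix e i"
        using pairs[OF CD e(1) f(1)] by (simp_all add: not_sym[OF disj])
      show ?thesis unfolding e f
        by (rule gen3[OF inJ[OF A(2)] inJ[OF A(2)] inJ[OF A(1) e(2)] step[OF f(2)] d]) (use f(2) in simp_all)
    qed
    have gp: "genpos ?k ?l" unfolding genpos_def
      using gp1 gp2 by fast
    have "even (\<Sum>e\<leftarrow>links ?k. \<Sum>f\<leftarrow>links ?l. of_bool (over e f) :: nat)"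
      by (rule even_sep_even[OF W(1)[OF CD]]) (use w[of C] w[of D] p ptl gp segk segl in \<open>simp_all only: simp_thms\<close>)
    moreover have cc: "(\<Sum>e\<leftarrow>concat (map h xs). \<phi> e) = (\<Sum>x\<leftarrow>xs. \<Sum>e\<leftarrow>h x. \<phi> e)" for h :: "nat \<times> nat \<Rightarrow> 'b list" and \<phi> :: "'b \<Rightarrow> nat" and xs
      by (induction xs) simp_all
    moreover have "links ?k = concat (map (\<lambda>e. links (pl e)) (cyc_arcs C))" "links ?l = concat (map (\<lambda>e. links (pl e)) (cyc_arcs D))"
      using w[of C] w[of D] p by simp_all
    ultimately have "even (\<Sum>e\<leftarrow>cyc_arcs C. \<Sum>g1\<leftarrow>links (pl e). \<Sum>f\<leftarrow>cyc_arcs D. \<Sum>g2\<leftarrow>links (pl f). of_bool (over g1 g2) :: nat)"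
      by (simp only: cc)
    then show "even (\<Sum>e\<leftarrow>cyc_arcs C. \<Sum>f\<leftarrow>cyc_arcs D. arc_over pl e f)"
      unfolding arc_over_def sum_list_swap[of _ "links (pl _)" "cyc_arcs D"] .
  qed
qed

section \<open>Intrinsic linking\<close>

lemma pcas_links: "ys \<noteq> [] \<Longrightarrow> pcas (hd ys) (links ys) (last ys)"
  by (induction ys rule: links.induct) auto

lemma pawalk_verts_links: "ys \<noteq> [] \<Longrightarrow> pawalk_verts (hd ys) (links ys) = ys"
proof (induction ys rule: links.induct)
  case ("2_2" v) then show ?case by simp
qed auto

lemma cycle_cyc_arcs:
  assumes "pair_wf_digraph G" "distinct xs" "xs \<noteq> []" "set (cyc_arcs xs) \<subseteq> parcs G"
  shows "pre_digraph.cycle (with_proj G) (cyc_arcs xs)"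
proof -
  interpret pair_wf_digraph G by (rule assms(1))
  let ?ys = "xs @ [hd xs]"
  have h: "hd ?ys = hd xs" "last ?ys = hd xs" using assms(3) by simp_all
  have ne: "cyc_arcs xs \<noteq> []" using assms(3) unfolding cyc_arcs_def by (cases xs rule: links.cases) auto
  then have "fst (hd (cyc_arcs xs)) = hd xs" unfolding cyc_arcs_def using assms(3) by (cases xs rule: links.cases) auto
  moreover have "hd (cyc_arcs xs) \<in> parcs G" using ne assms(4) hd_in_set by blast
  ultimately have "hd xs \<in> pverts G" using arc_fst_in_verts by metis
  moreover have "pcas (hd xs) (cyc_arcs xs) (hd xs)"
    using pcas_links[of ?ys] unfolding h cyc_arcs_def by simp
  moreover have "pawalk_verts (hd xs) (cyc_arcs xs) = ?ys"
    using pawalk_verts_links[of ?ys] unfolding h cyc_arcs_def by simp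
  moreover have "distinct (tl ?ys)" using assms(2,3) by (cases xs) auto
  ultimately show ?thesis
    unfolding pre_digraph.cycle_def pre_digraph.awalk_def cas_with_proj_eq awalk_verts_with_proj_eq
    using ne assms(4) by auto
qed

lemma cyc_arcs_tails: "xs \<noteq> [] \<Longrightarrow> fst ` set (cyc_arcs xs) = set xs"
proof -
  have "map fst (links ys) = butlast ys" for ys :: "'a list"
    by (induction ys rule: links.induct) auto
  from this[of "xs @ [hd xs]"] show ?thesis unfolding cyc_arcs_def by (metis butlast_snoc set_map)
qed

text \<open>Read in the chart, the two sides of the separating sphere are such a pair of open sets.\<close>

lemma split_even_sep:
  fixes h :: "real^4 \<Rightarrow> real^3"
  assumes hom: "homeomorphism (S3 - {p}) UNIV h k" "p \<in> S3"
    and sp: "split_link K L" and pKL: "p \<notin> K" "p \<notin> L" and sub: "K \<subseteq> S3" "L \<subseteq> S3"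
  shows "\<exists>W W'. even_sep W W' \<and> h ` K \<subseteq> W \<and> h ` L \<subseteq> W'"
proof -
  obtain \<Sigma> U V where \<Sigma>: "tame \<Sigma>" "\<Sigma> homeomorphic (sphere 0 1 :: (real^3) set)" "\<Sigma> \<inter> (K \<union> L) = {}"
    and UV: "U \<in> components (S3 - \<Sigma>)" "V \<in> components (S3 - \<Sigma>)" "U \<noteq> V" and KL: "K \<subseteq> U" "L \<subseteq> V"
    using sp unfolding split_link_def by blast
  have \<Sigma>S: "\<Sigma> \<subseteq> S3" using \<Sigma>(1) unfolding tame_def by blast
  have cl: "closed \<Sigma>" using homeomorphic_compactness[OF \<Sigma>(2)] compact_imp_closed by simp
  have ck: "continuous_on UNIV k" by (rule homeomorphism_cont2[OF hom(1)])
  have kS: "k x \<in> S3" for x using homeomorphism_image2[OF hom(1)] by blast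
  have op: "open (k -` X)" if X: "X \<in> components (S3 - \<Sigma>)" for X
  proof -
    have lc: "locally connected S3" by (rule ENR_imp_locally_connected[OF ENR_sphere])
    have o: "openin (top_of_set S3) (S3 - \<Sigma>)" unfolding Diff_eq by (rule openin_open_Int[OF open_Compl[OF cl]])
    have "openin (top_of_set S3) X"
      by (rule openin_trans[OF openin_components_locally_connected[OF locally_open_subset[OF lc o] X] o])
    then obtain T where T: "open T" "X = S3 \<inter> T" unfolding openin_open by blast
    have "k -` X = k -` T" unfolding T(2) using kS by blast
    moreover have "open (k -` T)" by (rule open_vimage[OF T(1) ck])
    ultimately show ?thesis by (simp only:)
  qed
  have "even_sep (k -` U) (k -` V)"
    unfolding even_sep_def
  proof (intro conjI allI impI)
    show "open (k -` U)" "open (k -` V)" using op UV by blast+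
    show "k -` U \<inter> k -` V = {}" using components_nonoverlap[OF UV(1,2)] UV(3) by blast
  next
    fix ks ls :: "(real^3) list"
    assume a: "ks \<noteq> []" "last ks = hd ks" "ls \<noteq> []" "last ls = hd ls" "set ls \<subseteq> k -` V"
      and b: "\<forall>(a,b)\<in>set (links ks). closed_segment a b \<subseteq> k -` U" "\<forall>(a,b)\<in>set (links ls). closed_segment a b \<subseteq> k -` V"
      and g: "genpos ks ls"
    show "even (\<Sum>e\<leftarrow>links ks. \<Sum>f\<leftarrow>links ls. of_bool (over e f) :: nat)"
      by (rule separated_even[OF hom \<Sigma>S \<Sigma>(2) UV a(3,4,1,2) _ _ _ g]) (use a(5) b in fast)+
  qed
  moreover have "h ` X \<subseteq> k -` Y" if "X \<subseteq> Y" "p \<notin> X" "X \<subseteq> S3" for X Y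
    using homeomorphism_apply1[OF hom(1)] that by fastforce
  ultimately show ?thesis using KL pKL sub by blast
qed

text \<open>If no pair of the family were a non-split link, polygonal approximations of all the arcs would have even
  crossing numbers for every pair of the family, which the certificate excludes.\<close>

theorem certificate_intrinsically_linked:
  fixes G :: "nat pair_pre_digraph"
  assumes wf: "pair_wf_digraph G" and cert: "odd_certificate P"
    and P: "\<And>C D. (C,D) \<in> set P \<Longrightarrow> C \<noteq> [] \<and> D \<noteq> [] \<and> set C \<inter> set D = {} \<and> distinct C \<and> distinct D \<and>
      set (cyc_arcs C) \<subseteq> parcs G \<and> set (cyc_arcs D) \<subseteq> parcs G"
  shows "intrinsically_linked_digraph (with_proj G)"
  unfolding intrinsically_linked_digraph_def
proof (intro allI impI, rule ccontr)
  fix f \<gamma> assume emb: "tame_embedding_S3 (with_proj G) f \<gamma>" and no: "\<not> contains_nonsplit_oriented_link (with_proj G) \<gamma>"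
  let ?X = "f ` pverts G \<union> (\<Union>e\<in>parcs G. path_image (\<gamma> e))"
  have E: "embedding_S3 (with_proj G) f \<gamma>" and T: "tame ?X"
    using emb unfolding tame_embedding_S3_def by simp_all
  obtain p h k where "p \<in> S3 - ?X \<and> homeomorphism (S3 - {p}) (UNIV :: (real^3) set) h k \<and>
      (\<exists>\<P>. finite \<P> \<and> (\<forall>P\<in>\<P>. polytope P) \<and> h ` ?X = \<Union>\<P>)"
    using T[unfolded tame_def, THEN conjunct2] by (elim exE)
  then have p: "p \<in> S3 - ?X" and hom: "homeomorphism (S3 - {p}) UNIV h k" by (rule conjunct1, elim conjE)
  have arc: "simple_path (\<gamma> e) \<and> path_image (\<gamma> e) \<subseteq> S3 \<and> pathstart (\<gamma> e) = f (fst e) \<and> pathfinish (\<gamma> e) = f (snd e)"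
    if "e \<in> parcs G" for e
    using E[unfolded embedding_S3_def with_proj_simps, THEN conjunct2, THEN conjunct2, THEN conjunct1, rule_format, OF that] .
  have arc': "path (\<gamma> e)" "path_image (\<gamma> e) \<subseteq> S3 - {p}" if "e \<in> parcs G" for e
  proof -
    note a = arc[OF that]
    show "path (\<gamma> e)" using a by (intro simple_path_imp_path) (elim conjE)
    have "path_image (\<gamma> e) \<subseteq> ?X" using that by blast
    then have "p \<notin> path_image (\<gamma> e)" using p by blast
    moreover have "path_image (\<gamma> e) \<subseteq> S3" using a by (elim conjE)
    ultimately show "path_image (\<gamma> e) \<subseteq> S3 - {p}" by blast
  qed
  show False
  proof (rule separated_certificate_contradiction[OF cert, of "\<lambda>e. h \<circ> \<gamma> e" "h \<circ> f"])
    show "C \<noteq> [] \<and> D \<noteq> [] \<and> set C \<inter> set D = {}" if "(C,D) \<in> set P" for C D using P[OF that] by blast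
  next
    fix C D e assume CD: "(C,D) \<in> set P" and e: "e \<in> set (cyc_arcs C) \<union> set (cyc_arcs D)"
    have eG: "e \<in> parcs G" using P[OF CD] e by blast
    have "continuous_on {0..1} (h \<circ> \<gamma> e)"
    proof (rule continuous_on_compose)
      show "continuous_on {0..1} (\<gamma> e)" using arc'(1)[OF eG] unfolding path_def .
      show "continuous_on (\<gamma> e ` {0..1}) h"
        by (rule continuous_on_subset[OF homeomorphism_cont1[OF hom]]) (use arc'(2)[OF eG] in \<open>simp only: path_image_def\<close>)
    qed
    moreover have "\<gamma> e 0 = f (fst e)" "\<gamma> e 1 = f (snd e)" using arc[OF eG] unfolding pathstart_def pathfinish_def by simp_all
    ultimately show "continuous_on {0..1} (h \<circ> \<gamma> e) \<and> (h \<circ> \<gamma> e) 0 = (h \<circ> f) (fst e) \<and> (h \<circ> \<gamma> e) 1 = (h \<circ> f) (snd e)"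
      by (simp add: comp_def)
  next
    fix C D assume CD: "(C,D) \<in> set P"
    note PCD = P[OF CD]
    let ?K = "\<lambda>C. \<Union>e\<in>set (cyc_arcs C). path_image (\<gamma> e)"
    have cyc: "pre_digraph.cycle (with_proj G) (cyc_arcs C)" "pre_digraph.cycle (with_proj G) (cyc_arcs D)"
      by (rule cycle_cyc_arcs[OF wf]; use PCD in simp)+
    have tails: "tail (with_proj G) ` set (cyc_arcs C) \<inter> tail (with_proj G) ` set (cyc_arcs D) = {}"
      using PCD by (simp add: cyc_arcs_tails)
    have sp: "split_link (?K C) (?K D)"
    proof (rule ccontr)
      assume ns: "\<not> split_link (?K C) (?K D)"
      have "contains_nonsplit_oriented_link (with_proj G) \<gamma>"
        unfolding contains_nonsplit_oriented_link_def
        by (intro exI[of _ "cyc_arcs C"] exI[of _ "cyc_arcs D"] conjI cyc tails ns)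
      with no show False by (rule notE)
    qed
    have "path_image (\<gamma> e) \<subseteq> S3 - {p}" if "e \<in> set (cyc_arcs C) \<union> set (cyc_arcs D)" for e
      by (rule arc'(2)) (use PCD that in blast)
    then have "?K C \<subseteq> S3 - {p}" "?K D \<subseteq> S3 - {p}" by (intro UN_least; simp)+
    then have in_S: "p \<notin> ?K C" "p \<notin> ?K D" "?K C \<subseteq> S3" "?K D \<subseteq> S3" by blast+
    have "p \<in> S3" using p by (rule DiffD1)
    from split_even_sep[OF hom this sp in_S]
    obtain W W' where W: "even_sep W W'" "h ` ?K C \<subseteq> W" "h ` ?K D \<subseteq> W'" by (elim exE conjE)
    have img: "(h \<circ> \<gamma> e) ` {0..1} = h ` path_image (\<gamma> e)" for e by (simp only: path_image_def image_comp)
    have "(h \<circ> \<gamma> e) ` {0..1} \<subseteq> Z" if "h ` ?K X \<subseteq> Z" "e \<in> set (cyc_arcs X)" for X Z e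
      unfolding img using that by blast
    then show "\<exists>W W'. even_sep W W' \<and> (\<forall>e\<in>set (cyc_arcs C). (h \<circ> \<gamma> e) ` {0..1} \<subseteq> W) \<and> (\<forall>e\<in>set (cyc_arcs D). (h \<circ> \<gamma> e) ` {0..1} \<subseteq> W')"
      using W by (intro exI[of _ W] exI[of _ W'] conjI ballI) assumption+
  qed
qed

section \<open>Links split by height\<close>

text \<open>If \<open>D\<close> lies above \<open>C\<close> wherever their projections meet, the graph of a function separates them. The
  function is the supremum of downward cones over the points of \<open>C\<close>; the slope \<open>M\<close> of the cones has to be large enough
  for the cones to stay below \<open>D\<close> where \<open>D\<close> is lower, and compactness bounds the horizontal distance to these
  places from below.\<close>

lemma compact_shear:
  fixes C D :: "(real^3) set"
  assumes C: "compact C" "C \<noteq> {}" and D: "compact D" "D \<noteq> {}"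
    and above: "\<And>c d. c \<in> C \<Longrightarrow> d \<in> D \<Longrightarrow> hor c = hor d \<Longrightarrow> c$3 < d$3"
  shows "\<exists>\<phi> :: complex \<Rightarrow> real. continuous_on UNIV \<phi> \<and> (\<forall>c\<in>C. c$3 < \<phi> (hor c)) \<and> (\<forall>d\<in>D. \<phi> (hor d) < d$3)"
proof -
  have c3: "continuous_on S (\<lambda>x::real^3. x$3)" for S by (intro continuous_intros)
  have "compact (C \<times> D)" by (rule compact_Times[OF C(1) D(1)])
  define Z where "Z = (C \<times> D) \<inter> {p. (snd p)$3 \<le> (fst p)$3}"
  have "closed {p :: (real^3) \<times> (real^3). (snd p)$3 \<le> (fst p)$3}"
    by (intro closed_Collect_le continuous_intros)
  then have Z: "compact Z" unfolding Z_def by (rule compact_Int_closed[OF \<open>compact (C \<times> D)\<close>])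
  have dc: "continuous_on S (\<lambda>p. dist (hor (fst p)) (hor (snd p)))" for S by (intro continuous_intros)
  have "\<exists>\<delta>>0. \<forall>p\<in>Z. \<delta> \<le> dist (hor (fst p)) (hor (snd p))"
  proof (cases "Z = {}")
    case False
    obtain p where p: "p \<in> Z" "\<And>q. q \<in> Z \<Longrightarrow> dist (hor (fst p)) (hor (snd p)) \<le> dist (hor (fst q)) (hor (snd q))"
      using continuous_attains_inf[OF Z False dc] by blast
    have "hor (fst p) \<noteq> hor (snd p)"
      using above[of "fst p" "snd p"] p(1) unfolding Z_def by auto
    then show ?thesis using p(2) by (intro exI[of _ "dist (hor (fst p)) (hor (snd p))"]) simp
  qed (intro exI[of _ 1], simp)
  then obtain \<delta> where \<delta>: "\<delta> > 0" "\<And>c d. c \<in> C \<Longrightarrow> d \<in> D \<Longrightarrow> d$3 \<le> c$3 \<Longrightarrow> \<delta> \<le> dist (hor c) (hor d)"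
    unfolding Z_def by force
  have "C \<times> D \<noteq> {}" using C(2) D(2) by simp
  moreover have "continuous_on (C \<times> D) (\<lambda>q. (fst q)$3 - (snd q)$3)" by (intro continuous_intros)
  ultimately obtain p0 where "p0 \<in> C \<times> D" and p0: "\<And>q. q \<in> C \<times> D \<Longrightarrow> (fst q)$3 - (snd q)$3 \<le> (fst p0)$3 - (snd p0)$3"
    using continuous_attains_sup[OF \<open>compact (C \<times> D)\<close>, of "\<lambda>q. (fst q)$3 - (snd q)$3"] by blast
  define B where "B = max 0 ((fst p0)$3 - (snd p0)$3)"
  have B1: "B \<ge> 0" unfolding B_def by simp
  have B2: "c$3 - d$3 \<le> B" if c: "c \<in> C" and d: "d \<in> D" for c d
    using p0[OF SigmaI[OF c d]] unfolding B_def by simp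
  note B = B1 B2
  define M where "M = (B + 1) / \<delta>"
  have M: "M \<ge> 0" "M * \<delta> = B + 1" using B(1) \<delta>(1) by (simp_all add: M_def)
  have key: "c$3 - M * dist (hor c) (hor d) < d$3" if "c \<in> C" "d \<in> D" for c d
  proof (cases "d$3 \<le> c$3")
    case True
    then have "M * \<delta> \<le> M * dist (hor c) (hor d)" using \<delta>(2)[OF that] M(1) by (intro mult_left_mono)
    then show ?thesis using B(2)[OF that] M(2) by linarith
  next
    case False
    moreover have "0 \<le> M * dist (hor c) (hor d)" using M(1) by simp
    ultimately show ?thesis by linarith
  qed
  define g where "g w c = c$3 - M * dist (hor c) w" for w :: complex and c :: "real^3"
  have gc: "continuous_on S (g w)" for S w unfolding g_def by (intro continuous_intros)
  define \<psi> where "\<psi> w = Sup (g w ` C)" for w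
  have bdd: "bdd_above (g w ` C)" for w
    by (intro bounded_imp_bdd_above compact_imp_bounded compact_continuous_image gc C(1))
  have up: "g w c \<le> \<psi> w" if "c \<in> C" for c w unfolding \<psi>_def by (rule cSUP_upper[OF that bdd])
  have att: "\<exists>c\<in>C. \<psi> w = g w c" for w
  proof -
    obtain c where c: "c \<in> C" "\<And>c'. c' \<in> C \<Longrightarrow> g w c' \<le> g w c" using continuous_attains_sup[OF C(1,2) gc] by blast
    then have "\<psi> w \<le> g w c" unfolding \<psi>_def by (intro cSUP_least C(2))
    with up[OF c(1)] c(1) show ?thesis by (metis antisym)
  qed
  have lip: "\<psi> w \<le> \<psi> w' + M * dist w w'" for w w'
  proof -
    obtain c where c: "c \<in> C" "\<psi> w = g w c" using att by blast
    have "dist (hor c) w' \<le> dist (hor c) w + dist w w'" by (rule dist_triangle)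
    then have "M * dist (hor c) w' \<le> M * (dist (hor c) w + dist w w')" using M(1) by (rule mult_left_mono)
    then have "g w c \<le> g w' c + M * dist w w'" unfolding g_def by (simp add: distrib_left)
    with up[OF c(1), of w'] c(2) show ?thesis by linarith
  qed
  have "dist (\<psi> w) (\<psi> w') \<le> M * dist w w'" for w w'
    using lip[of w w'] lip[of w' w] by (simp add: dist_real_def dist_commute abs_le_iff)
  then have "M-lipschitz_on UNIV \<psi>" using M(1) by (intro lipschitz_onI) auto
  then have \<psi>c: "continuous_on UNIV \<psi>" by (rule lipschitz_on_continuous_on)
  have low: "c$3 \<le> \<psi> (hor c)" if "c \<in> C" for c using up[OF that, of "hor c"] unfolding g_def by simp
  have high: "\<psi> (hor d) < d$3" if "d \<in> D" for d using att[of "hor d"] key that unfolding g_def by auto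
  have "continuous_on D (\<lambda>d. d$3 - \<psi> (hor d))"
    by (intro continuous_intros continuous_on_compose2[OF \<psi>c] continuous_on_hor) auto
  then obtain d0 where d0: "d0 \<in> D" "\<And>d. d \<in> D \<Longrightarrow> d0$3 - \<psi> (hor d0) \<le> d$3 - \<psi> (hor d)"
    using continuous_attains_inf[OF D] by blast
  define \<eta> where "\<eta> = (d0$3 - \<psi> (hor d0)) / 2"
  have \<eta>: "\<eta> > 0" "\<And>d. d \<in> D \<Longrightarrow> \<psi> (hor d) + \<eta> < d$3"
    using high[OF d0(1)] d0(2) unfolding \<eta>_def by (simp, force simp: field_simps)
  show ?thesis
  proof (intro exI[of _ "\<lambda>w. \<psi> w + \<eta>"] conjI ballI)
    show "continuous_on UNIV (\<lambda>w. \<psi> w + \<eta>)" by (intro continuous_intros \<psi>c)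
    show "c$3 < \<psi> (hor c) + \<eta>" if "c \<in> C" for c using low[OF that] \<eta>(1) by linarith
    show "\<psi> (hor d) + \<eta> < d$3" if "d \<in> D" for d by (rule \<eta>(2)[OF that])
  qed
qed

lemma split_link_sym:
  assumes "split_link K L"
  shows "split_link L K"
proof -
  obtain \<Sigma> U V where "tame \<Sigma>" "\<Sigma> homeomorphic (sphere 0 1 :: (real^3) set)" "\<Sigma> \<inter> (K \<union> L) = {}"
    "U \<in> components (S3 - \<Sigma>)" "V \<in> components (S3 - \<Sigma>)" "U \<noteq> V" "K \<subseteq> U" "L \<subseteq> V"
    using assms unfolding split_link_def by (elim exE conjE bexE)
  then show ?thesis unfolding split_link_def Un_commute[of L]
    by (intro exI[of _ \<Sigma>] conjI bexI[of _ V] bexI[of _ U] not_sym[of U V])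
qed

lemma connected_separated:
  assumes "connected W" "open A" "open B" "W \<subseteq> A \<union> B" "A \<inter> B \<inter> W = {}" "A \<inter> W \<noteq> {}" "B \<inter> W \<noteq> {}"
  shows False
  using connectedD[OF assms(1,2,3,5,4)] assms(6,7) by blast

text \<open>The boundary of the box is a tame sphere, being the union of the facets of the box in the chart. Its two
  sides are connected, and they are disjoint and relatively open, so they lie in different components.\<close>

lemma split_by_box:
  fixes h :: "real^4 \<Rightarrow> real^3"
  assumes hom: "homeomorphism (S3 - {p}) UNIV h k" "p \<in> S3"
    and box: "box a b \<noteq> {}" and C: "C \<subseteq> - cbox a b" and D: "D \<subseteq> box a b"
  shows "split_link (k ` D) (k ` C)"
proof -
  let ?\<Sigma> = "k ` frontier (cbox a b)"
  have ck: "continuous_on X k" for X by (rule continuous_on_subset[OF homeomorphism_cont2[OF hom(1)]]) simp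
  have kS: "k x \<in> S3" "k x \<noteq> p" for x using homeomorphism_image2[OF hom(1)] by blast+
  have hk: "h (k x) = x" for x by (rule homeomorphism_apply2[OF hom(1)]) simp
  have kinj: "k x = k y \<longleftrightarrow> x = y" for x y using arg_cong[of "k x" "k y" h] unfolding hk by blast
  have disjk: "k ` X \<inter> k ` Y = {} \<longleftrightarrow> X \<inter> Y = {}" for X Y using kinj by (auto simp: disjoint_iff)
  have subS: "k ` X \<subseteq> S3" for X using kS(1) by blast
  have himg: "h ` k ` X = X" for X unfolding image_image hk by simp
  have fr: "frontier (cbox a b) = cbox a b - box a b" by (rule frontier_cbox)
  have int_ne: "interior (cbox a b) \<noteq> {}" using box by (simp add: interior_cbox)
  have poly: "polytope (cbox a b)" by (rule polytope_interval)
  have facets: "frontier (cbox a b) = \<Union>{F. F facet_of cbox a b}"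
    using rel_boundary_of_polyhedron[OF polytope_imp_polyhedron[OF poly]] rel_frontier_nonempty_interior[OF int_ne]
      rel_frontier_def[of "cbox a b"] by (simp add: closure_closed[OF closed_cbox])
  have tame: "tame ?\<Sigma>"
    unfolding tame_def
  proof (intro conjI exI)
    show "?\<Sigma> \<subseteq> S3" by (rule subS)
    show "p \<in> S3 - ?\<Sigma>" using hom(2) kS(2) by blast
    show "homeomorphism (S3 - {p}) (UNIV :: (real^3) set) h k" by (rule hom(1))
    show "finite {F. F facet_of cbox a b}" by (rule finite_polytope_facets[OF poly])
    show "\<forall>P\<in>{F. F facet_of cbox a b}. polytope P"
      using face_of_polytope_polytope[OF poly] facet_of_imp_face_of by blast
    show "h ` ?\<Sigma> = \<Union>{F. F facet_of cbox a b}" unfolding himg by (rule facets)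
  qed
  have sph: "?\<Sigma> homeomorphic (sphere 0 1 :: (real^3) set)"
  proof -
    have 1: "frontier (cbox a b) homeomorphic ?\<Sigma>"
    proof (rule homeomorphic_compact)
      show "compact (frontier (cbox a b))" by (rule compact_frontier[OF compact_cbox])
      show "continuous_on (frontier (cbox a b)) k" by (rule ck)
      show "inj_on k (frontier (cbox a b))" using kinj by (simp add: inj_on_def)
    qed simp
    have "frontier (cbox a b) homeomorphic frontier (cball (0::real^3) 1)"
      by (rule homeomorphic_frontiers_same_dimension[OF homeomorphic_convex_compact_cball])
        (simp_all add: int_ne convex_box box closed_cbox)
    then have 2: "frontier (cbox a b) homeomorphic (sphere 0 1 :: (real^3) set)" by simp
    show ?thesis by (rule homeomorphic_trans[OF homeomorphic_sym[THEN iffD1, OF 1] 2])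
  qed
  define In Out where "In = k ` box a b" and "Out = S3 - k ` cbox a b"
  have "openin (top_of_set (S3 - {p})) In"
    unfolding In_def
    by (rule homeomorphism_imp_open_map[OF homeomorphism_symD[OF hom(1)]]) (simp add: open_box)
  moreover have "openin (top_of_set S3) (S3 - {p})" unfolding Diff_eq by (rule openin_open_Int[OF open_Compl]) simp
  ultimately have oI: "openin (top_of_set S3) In" by (rule openin_trans)
  have "compact (k ` cbox a b)" by (rule compact_continuous_image[OF ck compact_cbox])
  then have oO: "openin (top_of_set S3) Out"
    unfolding Out_def Diff_eq by (intro openin_open_Int open_Compl compact_imp_closed)
  have cover: "S3 - ?\<Sigma> \<subseteq> In \<union> Out" unfolding In_def Out_def fr using kinj by blast
  have IO: "In \<inter> Out = {}" unfolding In_def Out_def using box_subset_cbox by blast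
  have cI: "connected In" unfolding In_def by (intro connected_continuous_image ck) (simp add: convex_connected)
  have "connected (- cbox a b)"
    by (rule connected_complement_bounded_convex) (simp_all add: convex_box bounded_cbox)
  then have cO: "connected (k ` (- cbox a b))" by (intro connected_continuous_image ck)
  have I_sub: "In \<subseteq> S3 - ?\<Sigma>" unfolding In_def using subS[of "box a b"] disjk[of "box a b" "frontier (cbox a b)"] fr by auto
  have O_sub: "k ` (- cbox a b) \<subseteq> S3 - ?\<Sigma>"
    using subS[of "- cbox a b"] disjk[of "- cbox a b" "frontier (cbox a b)"] fr by auto
  have I_ne: "In \<noteq> {}" unfolding In_def using box by simp
  then have S_ne: "S3 - ?\<Sigma> \<noteq> {}" using I_sub by blast
  obtain U where U: "U \<in> components (S3 - ?\<Sigma>)" "In \<subseteq> U" using exists_component_superset[OF I_sub S_ne cI] by blast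
  obtain V where V: "V \<in> components (S3 - ?\<Sigma>)" "k ` (- cbox a b) \<subseteq> V" using exists_component_superset[OF O_sub S_ne cO] by blast
  have "- cbox a b \<noteq> {}" using bounded_cbox[of a b] not_bounded_UNIV by (metis Compl_eq_Diff_UNIV Diff_eq_empty_iff bounded_subset)
  then obtain z where z: "z \<in> - cbox a b" by blast
  have "U \<noteq> V"
  proof
    assume "U = V"
    then have zU: "k z \<in> U" using V(2) z by blast
    have US: "U \<subseteq> S3 - ?\<Sigma>" by (rule in_components_subset[OF U(1)])
    obtain TI TO where T: "open TI" "In = S3 \<inter> TI" "open TO" "Out = S3 \<inter> TO" using oI oO unfolding openin_open by blast
    show False
    proof (rule connected_separated[OF in_components_connected[OF U(1)] T(1,3)])
      show "U \<subseteq> TI \<union> TO" using US cover T(2,4) by blast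
      show "TI \<inter> TO \<inter> U = {}" using US IO T(2,4) by blast
      show "TI \<inter> U \<noteq> {}" using U(2) I_ne T(2) by blast
      have "k z \<notin> k ` cbox a b" using z by (simp add: image_iff kinj)
      then have "k z \<in> Out" unfolding Out_def using kS(1) by (rule DiffI[rotated])
      then show "TO \<inter> U \<noteq> {}" using zU T(4) by blast
    qed
  qed
  moreover have "k ` D \<subseteq> U" using U(2) D unfolding In_def by blast
  moreover have "k ` C \<subseteq> V" using V(2) C by blast
  moreover have "?\<Sigma> \<inter> (k ` D \<union> k ` C) = {}"
    unfolding image_Un[symmetric] disjk fr using C D box_subset_cbox by blast
  ultimately show ?thesis unfolding split_link_def using tame sph U(1) V(1) by blast
qed

text \<open>A vertical shear flattens the separating graph to a plane. The upper component is then enclosed in a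
  box that stands on this plane.\<close>

lemma split_if_above:
  fixes h :: "real^4 \<Rightarrow> real^3"
  assumes hom: "homeomorphism (S3 - {p}) UNIV h k" "p \<in> S3"
    and C: "compact C" "C \<noteq> {}" and D: "compact D" "D \<noteq> {}"
    and above: "\<And>c d. c \<in> C \<Longrightarrow> d \<in> D \<Longrightarrow> hor c = hor d \<Longrightarrow> c$3 < d$3"
  shows "split_link (k ` D) (k ` C)"
proof -
  obtain \<phi> :: "complex \<Rightarrow> real" where \<phi>: "continuous_on UNIV \<phi>" "\<And>c. c \<in> C \<Longrightarrow> c$3 < \<phi> (hor c)" "\<And>d. d \<in> D \<Longrightarrow> \<phi> (hor d) < d$3"
    using compact_shear[OF C D above] by blast
  define S where "S s x = x + (s * \<phi> (hor x)) *\<^sub>R axis 3 1" for s :: real and x :: "real^3"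
  have hS: "hor (S s x) = hor x" for s x unfolding S_def hor_def by (simp add: axis_def)
  have zS: "S s x $ 3 = x$3 + s * \<phi> (hor x)" for s x unfolding S_def by (simp add: axis_def)
  have inv: "S (-s) (S s x) = x" for s x
  proof -
    have "S (-s) (S s x) = S s x + (- s * \<phi> (hor x)) *\<^sub>R axis 3 1" unfolding S_def[of "-s"] hS ..
    then show ?thesis unfolding S_def by simp
  qed
  have cS: "continuous_on X (S s)" for X s
    unfolding S_def
    by (intro continuous_intros continuous_on_compose2[OF \<phi>(1)] continuous_on_hor) auto
  have "homeomorphism UNIV UNIV (S (-1)) (S 1)"
    by (rule homeomorphismI) (use cS inv[of 1] inv[of "-1"] in auto)
  from homeomorphism_compose[OF hom(1) this]
  have hom': "homeomorphism (S3 - {p}) UNIV (S (-1) \<circ> h) (k \<circ> S 1)" .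
  let ?C = "S (-1) ` C" and ?D = "S (-1) ` D"
  have cD: "compact ?D" by (rule compact_continuous_image[OF cS D(1)])
  have neg: "x$3 < 0" if "x \<in> ?C" for x using that \<phi>(2) by (auto simp: zS)
  have pos: "x$3 > 0" if "x \<in> ?D" for x using that \<phi>(3) by (auto simp: zS)
  obtain d0 where d0: "d0 \<in> ?D" "\<And>d. d \<in> ?D \<Longrightarrow> d0$3 \<le> d$3"
    using continuous_attains_inf[OF cD _ continuous_on_component[OF continuous_on_id], of 3] D(2) by auto
  obtain r where r: "r > 0" "\<And>x. x \<in> ?D \<Longrightarrow> norm x < r"
    using bounded_pos_less[THEN iffD1, OF compact_imp_bounded[OF cD]] by blast
  let ?a = "vector [-r, -r, d0$3 / 2] :: real^3" and ?b = "vector [r, r, r] :: real^3"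
  have mb: "x \<in> box ?a ?b \<longleftrightarrow> -r < x$1 \<and> x$1 < r \<and> -r < x$2 \<and> x$2 < r \<and> d0$3 / 2 < x$3 \<and> x$3 < r" for x
    by (auto simp: mem_box_cart forall_3)
  have DB: "?D \<subseteq> box ?a ?b"
  proof
    fix x assume x: "x \<in> ?D"
    have "\<bar>x$i\<bar> < r" for i using component_le_norm_cart[of x i] r(2)[OF x] by linarith
    from this[of 1] this[of 2] this[of 3] show "x \<in> box ?a ?b" unfolding mb using d0(2)[OF x] pos[OF d0(1)] by auto
  qed
  have CB: "?C \<subseteq> - cbox ?a ?b"
  proof
    fix x assume "x \<in> ?C"
    from neg[OF this] show "x \<in> - cbox ?a ?b" using pos[OF d0(1)] by (auto simp: mem_box_cart forall_3)
  qed
  have "box ?a ?b \<noteq> {}" using DB D(2) by blast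
  from split_by_box[OF hom' hom(2) this CB DB]
  have "split_link ((k \<circ> S 1) ` ?D) ((k \<circ> S 1) ` ?C)" .
  moreover have "(k \<circ> S 1) ` S (-1) ` X = k ` X" for X
    using inv[of "-1"] by (simp add: image_image)
  ultimately show ?thesis by simp
qed

section \<open>Eight points in space\<close>

definition pt :: "int \<times> int \<times> int \<Rightarrow> real^3" where
  "pt p = (case p of (x,y,z) \<Rightarrow> vector [of_int x, of_int y, of_int z])"

text \<open>The orientation of a triangle in the horizontal projection.\<close>

fun turn :: "int \<times> int \<times> int \<Rightarrow> int \<times> int \<times> int \<Rightarrow> int \<times> int \<times> int \<Rightarrow> int" where
  "turn (a1,a2,a3) (b1,b2,b3) (c1,c2,c3) = (b1 - a1) * (c2 - a2) - (b2 - a2) * (c1 - a1)"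

text \<open>With \<open>n\<close> the cross product of the two directions, the product of its third coordinate with the inner
  product of \<open>n\<close> and \<open>a - c\<close>: positive if the first line passes above the second one at the crossing of their
  projections.\<close>

fun tilt :: "int \<times> int \<times> int \<Rightarrow> int \<times> int \<times> int \<Rightarrow> int \<times> int \<times> int \<Rightarrow> int \<times> int \<times> int \<Rightarrow> int" where
  "tilt (a1,a2,a3) (b1,b2,b3) (c1,c2,c3) (d1,d2,d3) =
     (let n1 = (b2 - a2) * (d3 - c3) - (b3 - a3) * (d2 - c2); n2 = (b3 - a3) * (d1 - c1) - (b1 - a1) * (d3 - c3);
          n3 = (b1 - a1) * (d2 - c2) - (b2 - a2) * (d1 - c1) in
      n3 * (n1 * (a1 - c1) + n2 * (a2 - c2) + n3 * (a3 - c3)))"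

text \<open>Either the projections are disjoint, because one segment lies on one side of the other line, or the first line
  is the upper one.\<close>

definition passes_over where
  "passes_over a b c d \<longleftrightarrow> turn a b c * turn a b d > 0 \<or> turn c d a * turn c d b > 0 \<or> tilt a b c d > 0"

lemma pt_3: "pt (x,y,z) $ 3 = z" unfolding pt_def by simp
lemma pt_12: "pt (x,y,z) $ 1 = x" "pt (x,y,z) $ 2 = y" unfolding pt_def by simp_all

lemma passes_over:
  assumes "passes_over a b c d" "p \<in> closed_segment (pt a) (pt b)" "q \<in> closed_segment (pt c) (pt d)" "hor p = hor q"
  shows "p$3 > q$3"
proof -
  obtain a1 a2 a3 b1 b2 b3 where ab: "a = (a1,a2,a3)" "b = (b1,b2,b3)" by (cases a; cases b) auto
  obtain c1 c2 c3 d1 d2 d3 where cd: "c = (c1,c2,c3)" "d = (d1,d2,d3)" by (cases c; cases d) auto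
  obtain s where s: "0 \<le> s" "s \<le> 1" "p = (1 - s) *\<^sub>R pt a + s *\<^sub>R pt b" using assms(2) unfolding in_segment by blast
  obtain t where t: "0 \<le> t" "t \<le> 1" "q = (1 - t) *\<^sub>R pt c + t *\<^sub>R pt d" using assms(3) unfolding in_segment by blast
  have h: "p$1 = q$1" "p$2 = q$2" using assms(4) unfolding hor_def by simp_all
  have p: "p$1 = a1 + s * (real_of_int b1 - real_of_int a1)" "p$2 = a2 + s * (real_of_int b2 - real_of_int a2)" "p$3 = a3 + s * (real_of_int b3 - real_of_int a3)"
    unfolding s(3) ab by (simp_all add: pt_12 pt_3 algebra_simps)
  have q: "q$1 = c1 + t * (real_of_int d1 - real_of_int c1)" "q$2 = c2 + t * (real_of_int d2 - real_of_int c2)" "q$3 = c3 + t * (real_of_int d3 - real_of_int c3)"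
    unfolding t(3) cd by (simp_all add: pt_12 pt_3 algebra_simps)
  have e1: "a1 + s * (real_of_int b1 - real_of_int a1) = c1 + t * (real_of_int d1 - real_of_int c1)" and e2: "a2 + s * (real_of_int b2 - real_of_int a2) = c2 + t * (real_of_int d2 - real_of_int c2)"
    using h unfolding p q by simp_all
  have conv: False if "0 \<le> u" "u \<le> 1" "(1 - u) * x + u * y = 0" "x * y > 0" for u x y :: real
  proof -
    have "x > 0 \<and> y > 0 \<or> x < 0 \<and> y < 0" using that(4) by (auto simp: zero_less_mult_iff)
    then show False
    proof
      assume "x > 0 \<and> y > 0"
      then have "(1 - u) * x \<ge> 0" "u * y \<ge> 0" "(1 - u) * x > 0 \<or> u * y > 0"
        using that(1,2) by (auto simp: zero_le_mult_iff zero_less_mult_iff)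
      with that(3) show False by linarith
    next
      assume "x < 0 \<and> y < 0"
      then have "(1 - u) * x \<le> 0" "u * y \<le> 0" "(1 - u) * x < 0 \<or> u * y < 0"
        using that(1,2) by (auto simp: mult_le_0_iff mult_less_0_iff)
      with that(3) show False by linarith
    qed
  qed
  consider "turn a b c * turn a b d > 0" | "turn c d a * turn c d b > 0" | "tilt a b c d > 0"
    using assms(1) unfolding passes_over_def by blast
  then show ?thesis
  proof cases
    case 1
    have "(1 - t) * turn a b c + t * turn a b d = 0"
      unfolding ab cd turn.simps of_int_diff of_int_mult using e1 e2 by algebra
    moreover have "real_of_int (turn a b c) * turn a b d > 0" using 1 by (simp flip: of_int_mult)
    ultimately show ?thesis using conv[OF t(1,2)] by blast
  next
    case 2
    have "(1 - s) * turn c d a + s * turn c d b = 0"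
      unfolding ab cd turn.simps of_int_diff of_int_mult using e1 e2 by algebra
    moreover have "real_of_int (turn c d a) * turn c d b > 0" using 2 by (simp flip: of_int_mult)
    ultimately show ?thesis using conv[OF s(1,2)] by blast
  next
    case 3
    define n1 n2 n3 :: real where "n1 = (real_of_int b2 - real_of_int a2) * (real_of_int d3 - real_of_int c3) - (real_of_int b3 - real_of_int a3) * (real_of_int d2 - real_of_int c2)"
      and "n2 = (real_of_int b3 - real_of_int a3) * (real_of_int d1 - real_of_int c1) - (real_of_int b1 - real_of_int a1) * (real_of_int d3 - real_of_int c3)" and "n3 = (real_of_int b1 - real_of_int a1) * (real_of_int d2 - real_of_int c2) - (real_of_int b2 - real_of_int a2) * (real_of_int d1 - real_of_int c1)"
    have "real_of_int (tilt a b c d) = n3 * (n1 * (real_of_int a1 - real_of_int c1) + n2 * (real_of_int a2 - real_of_int c2) + n3 * (real_of_int a3 - real_of_int c3))"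
      unfolding ab cd tilt.simps Let_def n1_def n2_def n3_def by simp
    moreover have "n1 * (real_of_int a1 - real_of_int c1) + n2 * (real_of_int a2 - real_of_int c2) + n3 * (real_of_int a3 - real_of_int c3) = n3 * (p$3 - q$3)"
    proof -
      have "n1 * (real_of_int b1 - real_of_int a1) + n2 * (real_of_int b2 - real_of_int a2) + n3 * (real_of_int b3 - real_of_int a3) = 0" "n1 * (real_of_int d1 - real_of_int c1) + n2 * (real_of_int d2 - real_of_int c2) + n3 * (real_of_int d3 - real_of_int c3) = 0"
        unfolding n1_def n2_def n3_def by algebra+
      then show ?thesis unfolding p q using e1 e2 by algebra
    qed
    ultimately have "n3 * n3 * (p$3 - q$3) > 0" using 3 by (metis mult.assoc of_int_0_less_iff)
    then show ?thesis by (simp add: zero_less_mult_iff not_square_less_zero)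
  qed
qed

lemma not_collinear:
  assumes "turn a b c \<noteq> 0"
  shows "closed_segment (pt a) (pt b) \<inter> closed_segment (pt a) (pt c) = {pt a}" "pt a \<noteq> pt b" "pt c \<notin> closed_segment (pt a) (pt b)"
proof -
  obtain a1 a2 a3 b1 b2 b3 where ab: "a = (a1,a2,a3)" "b = (b1,b2,b3)" by (cases a; cases b) auto
  obtain c1 c2 c3 where c: "c = (c1,c2,c3)" by (cases c) auto
  have tn: "(real_of_int b1 - real_of_int a1) * (real_of_int c2 - real_of_int a2) - (real_of_int b2 - real_of_int a2) * (real_of_int c1 - real_of_int a1) \<noteq> 0"
    using assms unfolding ab c turn.simps by (simp only: of_int_diff[symmetric] of_int_mult[symmetric] of_int_eq_0_iff not_False_eq_True)
  have *: "s = 0 \<and> t = 0" if "(1 - s) *\<^sub>R pt a + s *\<^sub>R pt b = (1 - t) *\<^sub>R pt a + t *\<^sub>R pt c" for s t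
  proof -
    have "((1 - s) *\<^sub>R pt a + s *\<^sub>R pt b)$i = ((1 - t) *\<^sub>R pt a + t *\<^sub>R pt c)$i" for i using that by simp
    from this[of 1] this[of 2]
    have e: "s * (real_of_int b1 - real_of_int a1) = t * (real_of_int c1 - real_of_int a1)" "s * (real_of_int b2 - real_of_int a2) = t * (real_of_int c2 - real_of_int a2)"
      unfolding ab c by (simp_all add: pt_12 algebra_simps)
    have "s * ((real_of_int b1 - real_of_int a1) * (real_of_int c2 - real_of_int a2) - (real_of_int b2 - real_of_int a2) * (real_of_int c1 - real_of_int a1)) = 0" using e by algebra
    moreover have "t * ((real_of_int b1 - real_of_int a1) * (real_of_int c2 - real_of_int a2) - (real_of_int b2 - real_of_int a2) * (real_of_int c1 - real_of_int a1)) = 0" using e by algebra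
    ultimately show ?thesis using tn by simp
  qed
  show "closed_segment (pt a) (pt b) \<inter> closed_segment (pt a) (pt c) = {pt a}"
  proof
    show "closed_segment (pt a) (pt b) \<inter> closed_segment (pt a) (pt c) \<subseteq> {pt a}"
    proof
      fix x assume "x \<in> closed_segment (pt a) (pt b) \<inter> closed_segment (pt a) (pt c)"
      then have "x \<in> closed_segment (pt a) (pt b)" "x \<in> closed_segment (pt a) (pt c)" by simp_all
      then obtain s t where "x = (1 - s) *\<^sub>R pt a + s *\<^sub>R pt b" "x = (1 - t) *\<^sub>R pt a + t *\<^sub>R pt c"
        unfolding in_segment by blast
      then show "x \<in> {pt a}" using *[of s t] by simp
    qed
  qed simp
  show "pt a \<noteq> pt b" using *[of 1 0] by auto
  show "pt c \<notin> closed_segment (pt a) (pt b)"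
  proof
    assume "pt c \<in> closed_segment (pt a) (pt b)"
    then obtain s where "pt c = (1 - s) *\<^sub>R pt a + s *\<^sub>R pt b" unfolding in_segment by blast
    then show False using *[of s 1] by simp
  qed
qed

text \<open>The points 0, 1, 2 and 3, 4, 5 form an outer and an inner triangle of a prism that is looked at from above, and
  the only crossings of its fifteen edges are 04 over 13, 05 over 23 and 15 over 24. The points 6 and 7 are
  so high that the edges at them pass above all edges of the prism.\<close>

definition site :: "nat \<Rightarrow> int \<times> int \<times> int" where
  "site i = [(4,2,-1), (-4,5,1), (0,-4,0), (1,1,-1), (-1,1,0), (0,-1,1), (-1,2,6), (-2,-2,10)] ! i"

definition above :: "nat \<times> nat \<Rightarrow> nat \<times> nat \<Rightarrow> bool" where
  "above e f \<longleftrightarrow> passes_over (site (fst e)) (site (snd e)) (site (fst f)) (site (snd f))"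

text \<open>The pairs of disjoint edges of which the first passes below the second. All other pairs of edges
  do not meet in the projection or have the first edge on top.\<close>

definition not_above :: "((nat \<times> nat) \<times> (nat \<times> nat)) list" where
  "not_above = [((0,4),(2,6)), ((0,4),(3,6)), ((0,4),(5,6)), ((1,2),(0,7)), ((1,2),(3,7)), ((1,2),(4,7)), ((1,2),(5,7)), ((1,2),(6,7)), ((1,3),(0,4)), ((1,3),(0,6)), ((1,4),(6,7)), ((1,5),(0,7)), ((1,5),(2,6)), ((1,5),(3,7)), ((1,5),(4,7)), ((1,5),(6,7)), ((2,3),(0,5)), ((2,3),(0,7)), ((2,4),(0,7)), ((2,4),(1,5)), ((2,4),(3,7)), ((2,4),(5,7)), ((2,6),(0,7)), ((2,6),(3,7)), ((2,6),(5,7)), ((3,4),(2,6)), ((3,4),(5,6)), ((3,5),(0,7)), ((4,5),(0,7)), ((4,5),(2,6)), ((4,5),(3,7)), ((5,6),(0,7)), ((5,6),(3,7))]"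

lemma turn_swap: "turn b a c = - turn a b c"
  by (cases a; cases b; cases c) (simp add: algebra_simps)

lemma tilt_swap: "tilt b a c d = tilt a b c d" "tilt a b d c = tilt a b c d"
proof -
  obtain a1 a2 a3 b1 b2 b3 where ab: "a = (a1,a2,a3)" "b = (b1,b2,b3)" by (cases a; cases b) auto
  obtain c1 c2 c3 d1 d2 d3 where cd: "c = (c1,c2,c3)" "d = (d1,d2,d3)" by (cases c; cases d) auto
  show "tilt b a c d = tilt a b c d" "tilt a b d c = tilt a b c d"
    unfolding ab cd tilt.simps Let_def by algebra+
qed

lemma passes_over_swap: "passes_over b a c d = passes_over a b c d" "passes_over a b d c = passes_over a b c d"
  unfolding passes_over_def by (simp_all add: turn_swap[of b a] turn_swap[of d c] tilt_swap mult.commute)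

lemma sites_table: "\<forall>j\<in>set [0..<8]. \<forall>i\<in>set [0..<j]. \<forall>l\<in>set [0..<8]. l \<noteq> i \<longrightarrow> l \<noteq> j \<longrightarrow>
    (\<forall>k\<in>set [0..<l]. k \<noteq> i \<longrightarrow> k \<noteq> j \<longrightarrow> above (i,j) (k,l) \<or> ((i,j),(k,l)) \<in> set not_above)"
  by code_simp

lemma sites_turn: "\<forall>k\<in>set [0..<8]. \<forall>j\<in>set [0..<k]. \<forall>i\<in>set [0..<j]. turn (site i) (site j) (site k) \<noteq> 0"
  by code_simp

lemma not_above_asym: "list_all (\<lambda>(e,f). (f,e) \<notin> set not_above) not_above"
  by code_simp

section \<open>Layered drawings\<close>

definition dcycle :: "('a \<times> 'a) set \<Rightarrow> 'a list \<Rightarrow> bool" where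
  "dcycle R xs \<longleftrightarrow> xs \<noteq> [] \<and> distinct xs \<and> set (cyc_arcs xs) \<subseteq> R"

definition over_cycle :: "nat list \<Rightarrow> nat list \<Rightarrow> bool" where
  "over_cycle C D \<longleftrightarrow> (\<forall>e\<in>set (cyc_arcs C). \<forall>f\<in>set (cyc_arcs D). above e f)"

text \<open>The condition under which the straight-line drawing on the eight sites has no non-split link: of any two
  disjoint directed cycles, one lies above the other.\<close>

definition layered :: "(nat \<times> nat) set \<Rightarrow> bool" where
  "layered R \<longleftrightarrow> (\<forall>C D. dcycle R C \<longrightarrow> dcycle R D \<longrightarrow> set C \<inter> set D = {} \<longrightarrow> over_cycle C D \<or> over_cycle D C)"

lemma above_swap: "above (j,i) f = above (i,j) f" "above f (j,i) = above f (i,j)"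
  unfolding above_def by (simp_all add: passes_over_swap)

lemma above_cases:
  assumes "i < 8" "j < 8" "k < 8" "l < 8" "i \<noteq> j" "k \<noteq> l" "{i,j} \<inter> {k,l} = {}"
  shows "above (i,j) (k,l) \<or> ((min i j, max i j), (min k l, max k l)) \<in> set not_above"
proof -
  have "above (min i j, max i j) (min k l, max k l) \<or> ((min i j, max i j), (min k l, max k l)) \<in> set not_above"
    using sites_table[rule_format, of "max i j" "min i j" "max k l" "min k l"] assms
    by (auto simp: min_def max_def split: if_splits)
  then show ?thesis by (auto simp: min_def max_def above_swap split: if_splits)
qed

lemma above_total:
  assumes "i < 8" "j < 8" "k < 8" "l < 8" "i \<noteq> j" "k \<noteq> l" "{i,j} \<inter> {k,l} = {}"
  shows "above (i,j) (k,l) \<or> above (k,l) (i,j)"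
  using above_cases[OF assms] above_cases[of k l i j] assms not_above_asym by (auto simp: list_all_iff Int_commute)

lemma above_disjoint:
  assumes "above (i,j) (k,l)"
  shows "closed_segment (pt (site i)) (pt (site j)) \<inter> closed_segment (pt (site k)) (pt (site l)) = {}"
  using passes_over[OF assms[unfolded above_def fst_conv snd_conv]] by (metis disjoint_iff less_irrefl)

lemma turn_rotate: "turn b c a = turn a b c"
  by (cases a; cases b; cases c) (simp add: algebra_simps)

lemma turn_permuted:
  assumes "turn a b c \<noteq> 0"
  shows "turn b c a \<noteq> 0" "turn c a b \<noteq> 0" "turn b a c \<noteq> 0" "turn a c b \<noteq> 0" "turn c b a \<noteq> 0"
proof -
  show r: "turn b c a \<noteq> 0" "turn c a b \<noteq> 0" using assms turn_rotate[of b c a] turn_rotate[of c a b] by simp_all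
  show "turn b a c \<noteq> 0" "turn a c b \<noteq> 0" "turn c b a \<noteq> 0"
    using assms r turn_swap[of b a c] turn_swap[of a c b] turn_swap[of c b a] by simp_all
qed

lemma site_turn:
  assumes "i < 8" "j < 8" "k < 8" "i \<noteq> j" "i \<noteq> k" "j \<noteq> k"
  shows "turn (site i) (site j) (site k) \<noteq> 0"
proof -
  have *: "turn (site a) (site b) (site c) \<noteq> 0" if abc: "a < b" "b < c" "c < 8" for a b c
    using sites_turn[rule_format, of c b a] abc by simp
  consider "i < j" "j < k" | "i < k" "k < j" | "j < i" "i < k" | "j < k" "k < i" | "k < i" "i < j" | "k < j" "j < i"
    using assms by linarith
  then show ?thesis
  proof cases
    case 1 then show ?thesis using * assms by blast
  next
    case 2 then show ?thesis using turn_permuted(4)[OF *] assms by blast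
  next
    case 3 then show ?thesis using turn_permuted(3)[OF *] assms by blast
  next
    case 4 then show ?thesis using turn_permuted(2)[OF *] assms by blast
  next
    case 5 then show ?thesis using turn_permuted(1)[OF *] assms by blast
  next
    case 6 then show ?thesis using turn_permuted(5)[OF *] assms by blast
  qed
qed

lemma pcas_cyc_arcs:
  assumes "pcas u c u" "distinct (tl (pawalk_verts u c))" "c \<noteq> []"
  shows "c = cyc_arcs (map fst c)" "distinct (map fst c)"
proof -
  have 1: "links (map fst c @ [v]) = c" if "pcas u c v" "c \<noteq> []" for u v
    using that
  proof (induction c arbitrary: u)
    case (Cons e es)
    then show ?case by (cases es) auto
  qed simp
  have 2: "pawalk_verts u c = map fst c @ [v]" if "pcas u c v" for u v
    using that by (induction c arbitrary: u) auto
  have hd: "hd (map fst c) = u" using assms by (cases c) auto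
  show "c = cyc_arcs (map fst c)" unfolding cyc_arcs_def hd using 1[OF assms(1,3)] by simp
  have "distinct (tl (map fst c @ [u]))" using assms(2) 2[OF assms(1)] by simp
  then show "distinct (map fst c)" using assms(3) hd by (cases c) auto
qed

lemma links_map: "links (map g xs) = map (map_prod g g) (links xs)"
  by (induction xs rule: links.induct) auto

lemma cyc_arcs_map: "xs \<noteq> [] \<Longrightarrow> cyc_arcs (map g xs) = map (map_prod g g) (cyc_arcs xs)"
  unfolding cyc_arcs_def using links_map[of g "xs @ [hd xs]"] by (simp add: hd_map)

text \<open>Drawings in Euclidean space are transported to the 3-sphere by stereographic projection.\<close>

lemma stereographic: "\<exists>p h k. p \<in> S3 \<and> homeomorphism (S3 - {p}) (UNIV :: (real^3) set) h k"
proof -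
  have p: "axis 1 1 \<in> S3" by (simp add: norm_eq_1 inner_axis_axis)
  have "(S3 - {axis 1 1}) homeomorphic (UNIV :: (real^3) set)"
    by (rule homeomorphic_punctured_sphere_affine[OF _ p]) (simp_all add: aff_dim_UNIV)
  then show ?thesis using p unfolding homeomorphic_def by blast
qed

text \<open>The vertices are sent to the sites by the labelling \<open>lab\<close>, and the arcs to straight segments.\<close>

theorem layered_embedding:
  fixes G :: "nat pair_pre_digraph"
  assumes G: "tournament G" and lab: "inj_on lab (pverts G)" "lab ` pverts G \<subseteq> {0..<8}"
    and lay: "layered (map_prod lab lab ` parcs G)"
  shows "\<exists>f \<gamma>. tame_embedding_S3 (with_proj G) f \<gamma> \<and> \<not> contains_nonsplit_oriented_link (with_proj G) \<gamma>"
proof -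
  interpret tournament G by (rule G)
  obtain p :: "real^4" and h k where p: "p \<in> S3" and hom: "homeomorphism (S3 - {p}) (UNIV :: (real^3) set) h k"
    using stereographic by blast
  have ck: "continuous_on X k" for X by (rule continuous_on_subset[OF homeomorphism_cont2[OF hom]]) simp
  have kS: "k x \<in> S3" "k x \<noteq> p" for x using homeomorphism_image2[OF hom] by blast+
  have hk: "h (k x) = x" for x by (rule homeomorphism_apply2[OF hom]) simp
  have kinj: "k x = k y \<longleftrightarrow> x = y" for x y using arg_cong[of "k x" "k y" h] unfolding hk by blast
  have himg: "h ` k ` X = X" for X unfolding image_image hk by simp
  define pos where "pos v = pt (site (lab v))" for v
  define f where "f v = k (pos v)" for v
  define seg where "seg e = closed_segment (pos (fst e)) (pos (snd e))" for e
  define \<gamma> where "\<gamma> e = k \<circ> linepath (pos (fst e)) (pos (snd e))" for e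
  have img: "path_image (\<gamma> e) = k ` seg e" for e
    unfolding \<gamma>_def seg_def path_image_compose path_image_linepath ..
  have arcD: "fst e \<in> pverts G" "snd e \<in> pverts G" "fst e \<noteq> snd e" if "e \<in> parcs G" for e
    using that arc_fst_in_verts[of e] arc_snd_in_verts[of e] no_loops[of e] by simp_all
  have lab_lt: "lab v < 8" if "v \<in> pverts G" for v using lab(2) that by auto
  have lab_ne: "lab u \<noteq> lab v" if "u \<in> pverts G" "v \<in> pverts G" "u \<noteq> v" for u v
    using lab(1) that by (auto dest: inj_onD)
  have turn: "turn (site (lab u)) (site (lab v)) (site (lab w)) \<noteq> 0"
    if "u \<in> pverts G" "v \<in> pverts G" "w \<in> pverts G" "u \<noteq> v" "u \<noteq> w" "v \<noteq> w" for u v w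
    by (rule site_turn; intro lab_lt lab_ne that)
  have pos_ne: "pos u \<noteq> pos v" if uv: "u \<in> pverts G" "v \<in> pverts G" "u \<noteq> v" for u v
  proof -
    \<comment> \<open>No two sites coincide, because no three of them are collinear in the projection.\<close>
    have "\<exists>l<8. x \<noteq> l \<and> y \<noteq> l" for x y :: nat by presburger
    then obtain l where "l < 8" "lab u \<noteq> l" "lab v \<noteq> l" by blast
    then have "turn (site (lab u)) (site (lab v)) (site l) \<noteq> 0"
      by (intro site_turn lab_lt lab_ne uv)
    then show ?thesis unfolding pos_def by (rule not_collinear(2))
  qed
  have off: "pos w \<notin> seg e" if e: "e \<in> parcs G" and w: "w \<in> pverts G" "w \<noteq> fst e" "w \<noteq> snd e" for e w
    unfolding seg_def pos_def by (rule not_collinear(3)[OF turn]) (use arcD[OF e] w in auto)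
  have shared: "closed_segment (pos u) (pos v) \<inter> closed_segment (pos u) (pos w) = {pos u}"
    if "u \<in> pverts G" "v \<in> pverts G" "w \<in> pverts G" "u \<noteq> v" "u \<noteq> w" "v \<noteq> w" for u v w
    unfolding pos_def by (rule not_collinear(1)[OF turn[OF that]])
  have far: "seg e \<inter> seg e' = {}"
    if e: "e \<in> parcs G" "e' \<in> parcs G" and d: "{fst e, snd e} \<inter> {fst e', snd e'} = {}" for e e'
  proof -
    have "above (lab (fst e), lab (snd e)) (lab (fst e'), lab (snd e')) \<or> above (lab (fst e'), lab (snd e')) (lab (fst e), lab (snd e))"
      by (rule above_total; use arcD[OF e(1)] arcD[OF e(2)] lab_lt lab_ne d in auto)
    then show ?thesis unfolding seg_def pos_def using above_disjoint by (metis Int_commute)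
  qed
  have meet: "seg e \<inter> seg e' \<subseteq> pos ` pverts G" if e: "e \<in> parcs G" "e' \<in> parcs G" "e \<noteq> e'" for e e'
  proof (cases "{fst e, snd e} \<inter> {fst e', snd e'} = {}")
    case False
    have ne: "(snd e', fst e') \<noteq> e"
      using exactly_one_arc[of "fst e'" "snd e'"] arcD[OF e(2)] e(1,2) by auto
    obtain u v w where "{fst e, snd e} = {u,v}" "{fst e', snd e'} = {u,w}" "v \<noteq> w" "u \<noteq> v" "u \<noteq> w"
      using False e(3) ne arcD(3)[OF e(1)] arcD(3)[OF e(2)]
      by (cases e; cases e') (auto simp: doubleton_eq_iff)
    note uvw = this
    have V: "u \<in> pverts G" "v \<in> pverts G" "w \<in> pverts G" using uvw(1,2) arcD[OF e(1)] arcD[OF e(2)] by (auto simp: doubleton_eq_iff)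
    have "seg e = closed_segment (pos u) (pos v)" "seg e' = closed_segment (pos u) (pos w)"
      using uvw(1,2) unfolding seg_def by (auto simp: doubleton_eq_iff closed_segment_commute)
    then show ?thesis using shared[OF V uvw(4,5,3)] V(1) by simp
  qed (use far e in simp)
  have emb: "embedding_S3 (with_proj G) f \<gamma>"
    unfolding embedding_S3_def with_proj_simps
  proof (intro conjI ballI impI)
    show "inj_on f (pverts G)" unfolding f_def inj_on_def kinj using pos_ne by blast
    show "f ` pverts G \<subseteq> S3" unfolding f_def using kS(1) by blast
    show "simple_path (\<gamma> e)" if "e \<in> parcs G" for e
      unfolding \<gamma>_def
      by (rule simple_path_continuous_image)
        (use pos_ne arcD[OF that] kinj in \<open>auto simp: ck inj_on_def\<close>)
    show "path_image (\<gamma> e) \<subseteq> S3" for e unfolding img using kS(1) by blast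
    show "pathstart (\<gamma> e) = f (fst e)" "pathfinish (\<gamma> e) = f (snd e)" for e
      unfolding \<gamma>_def f_def pathstart_compose pathfinish_compose by simp_all
    show "v = fst e \<or> v = snd e" if "e \<in> parcs G" "v \<in> pverts G" "f v \<in> path_image (\<gamma> e)" for e v
    proof (rule ccontr)
      assume "\<not> (v = fst e \<or> v = snd e)"
      then have "pos v \<notin> seg e" using off[OF that(1,2)] by blast
      then show False using that(3) unfolding f_def img by (simp add: image_iff kinj)
    qed
    show "path_image (\<gamma> e) \<inter> path_image (\<gamma> e') \<subseteq> f ` pverts G" if "e \<in> parcs G" "e' \<in> parcs G" "e \<noteq> e'" for e e'
    proof -
      have "inj k" using kinj by (simp add: inj_def)
      then have "path_image (\<gamma> e) \<inter> path_image (\<gamma> e') = k ` (seg e \<inter> seg e')"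
        unfolding img by (rule image_Int[symmetric])
      moreover have "f ` pverts G = k ` pos ` pverts G" by (simp add: f_def image_image)
      ultimately show ?thesis using image_mono[OF meet[OF that]] by (simp only:)
    qed
  qed
  have tame: "tame (f ` pverts G \<union> (\<Union>e\<in>parcs G. path_image (\<gamma> e)))" (is "tame ?X")
  proof -
    have X: "?X = k ` (pos ` pverts G \<union> (\<Union>e\<in>parcs G. seg e))"
      unfolding f_def img by (simp add: image_Un image_UN image_image)
    let ?P = "(\<lambda>v. {pos v}) ` pverts G \<union> seg ` parcs G"
    show ?thesis
      unfolding tame_def
    proof (intro conjI exI)
      show "?X \<subseteq> S3" unfolding X using kS(1) by blast
      show "p \<in> S3 - ?X" unfolding X using p kS(2) by blast
      show "homeomorphism (S3 - {p}) (UNIV :: (real^3) set) h k" by (rule hom)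
      show "finite ?P" by simp
      show "\<forall>P\<in>?P. polytope P" unfolding seg_def by (auto simp: polytope_sing segment_convex_hull polytope_convex_hull)
      show "h ` ?X = \<Union>?P" unfolding X himg by auto
    qed
  qed
  have "\<not> contains_nonsplit_oriented_link (with_proj G) \<gamma>"
  proof
    assume "contains_nonsplit_oriented_link (with_proj G) \<gamma>"
    then obtain c d where cd: "pre_digraph.cycle (with_proj G) c" "pre_digraph.cycle (with_proj G) d"
      and disj: "fst ` set c \<inter> fst ` set d = {}"
      and ns: "\<not> split_link (\<Union>e\<in>set c. path_image (\<gamma> e)) (\<Union>e\<in>set d. path_image (\<gamma> e))"
      unfolding contains_nonsplit_oriented_link_def with_proj_simps by blast
    have cyc: "c = cyc_arcs (map fst c)" "dcycle (parcs G) (map fst c)" "c \<noteq> []" "set c \<subseteq> parcs G" "fst ` set c \<subseteq> pverts G"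
      if c: "pre_digraph.cycle (with_proj G) c" for c
    proof -
      obtain u where u: "set c \<subseteq> parcs G" "pcas u c u" "distinct (tl (pawalk_verts u c))" and ne: "c \<noteq> []"
        using c unfolding pre_digraph.cycle_def pre_digraph.awalk_def cas_with_proj_eq awalk_verts_with_proj_eq with_proj_simps
        by blast
      note * = pcas_cyc_arcs[OF u(2,3) ne]
      show "c = cyc_arcs (map fst c)" by (rule *(1))
      show "dcycle (parcs G) (map fst c)" unfolding dcycle_def *(1)[symmetric] using *(2) u(1) ne by simp
      show "c \<noteq> []" "set c \<subseteq> parcs G" by fact+
      show "fst ` set c \<subseteq> pverts G" using u(1) arcD(1) by blast
    qed
    have lc: "dcycle (map_prod lab lab ` parcs G) (map lab (map fst c))" "set (cyc_arcs (map lab (map fst c))) = map_prod lab lab ` set c"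
      if c: "pre_digraph.cycle (with_proj G) c" for c
    proof -
      note C = cyc[OF c]
      have ne: "map fst c \<noteq> []" using C(3) by simp
      show e: "set (cyc_arcs (map lab (map fst c))) = map_prod lab lab ` set c"
        unfolding cyc_arcs_map[OF ne] C(1)[symmetric] by simp
      have "distinct (map lab (map fst c))"
        using C(2,5) lab(1) unfolding dcycle_def distinct_map[of lab] by (auto intro: inj_on_subset)
      then show "dcycle (map_prod lab lab ` parcs G) (map lab (map fst c))"
        unfolding dcycle_def e using C(3,4) by blast
    qed
    have "lab ` fst ` set c \<inter> lab ` fst ` set d = {}"
      using inj_on_image_Int[OF lab(1) cyc(5)[OF cd(1)] cyc(5)[OF cd(2)]] disj by simp
    then have "set (map lab (map fst c)) \<inter> set (map lab (map fst d)) = {}" unfolding set_map .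
    from lay[unfolded layered_def, rule_format, OF lc(1)[OF cd(1)] lc(1)[OF cd(2)] this]
    have "over_cycle (map lab (map fst c)) (map lab (map fst d)) \<or> over_cycle (map lab (map fst d)) (map lab (map fst c))" .
    moreover have "split_link (\<Union>e\<in>set c. path_image (\<gamma> e)) (\<Union>e\<in>set d. path_image (\<gamma> e))"
      if c: "pre_digraph.cycle (with_proj G) c" and d: "pre_digraph.cycle (with_proj G) d"
        and ov: "over_cycle (map lab (map fst c)) (map lab (map fst d))" for c d
    proof -
      have comp: "compact (\<Union>e\<in>set c. seg e)" for c by (intro compact_UN) (simp_all add: seg_def)
      have ne: "(\<Union>e\<in>set c. seg e) \<noteq> {}" if "pre_digraph.cycle (with_proj G) c" for c
        using cyc(3)[OF that] by (cases c) (auto simp: seg_def)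
      have "y$3 < x$3" if x: "x \<in> (\<Union>e\<in>set c. seg e)" and y: "y \<in> (\<Union>e\<in>set d. seg e)" and xy: "hor y = hor x" for x y
      proof -
        obtain e e' where e: "e \<in> set c" "x \<in> seg e" "e' \<in> set d" "y \<in> seg e'" using x y by blast
        then have "above (map_prod lab lab e) (map_prod lab lab e')"
          using ov lc(2)[OF c] lc(2)[OF d] unfolding over_cycle_def by blast
        then have po: "passes_over (site (lab (fst e))) (site (lab (snd e))) (site (lab (fst e'))) (site (lab (snd e')))"
          unfolding above_def by simp
        show ?thesis by (rule passes_over[OF po]) (use e(2,4) xy in \<open>simp_all add: seg_def pos_def\<close>)
      qed
      from split_if_above[OF hom p comp ne[OF d] comp ne[OF c] this]
      show ?thesis unfolding img image_UN .
    qed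
    ultimately show False using ns cd split_link_sym by blast
  qed
  then show ?thesis using emb tame unfolding tame_embedding_S3_def with_proj_simps by blast
qed

section \<open>Placing six vertices on a prism\<close>

definition tri :: "('a \<Rightarrow> 'a \<Rightarrow> bool) \<Rightarrow> 'a \<Rightarrow> 'a \<Rightarrow> 'a \<Rightarrow> bool" where
  "tri t a b x \<longleftrightarrow> t a b \<and> t b x \<and> t x a \<or> t b a \<and> t a x \<and> t x b"

definition quad :: "('a \<Rightarrow> 'a \<Rightarrow> bool) \<Rightarrow> 'a \<Rightarrow> 'a \<Rightarrow> 'a \<Rightarrow> 'a \<Rightarrow> bool" where
  "quad t a b x y \<longleftrightarrow> t a b \<and> (t b x \<and> t x y \<and> t y a \<or> t b y \<and> t y x \<and> t x a) \<or>
     t b a \<and> (t a x \<and> t x y \<and> t y b \<or> t a y \<and> t y x \<and> t x b)"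

text \<open>No directed cycle of the subtournament on \<open>a\<close>, \<open>b\<close>, \<open>x\<close>, \<open>y\<close> runs through the edge
  between \<open>a\<close> and \<open>b\<close>.\<close>

definition acyclic_edge :: "('a \<Rightarrow> 'a \<Rightarrow> bool) \<Rightarrow> 'a \<Rightarrow> 'a \<Rightarrow> 'a \<Rightarrow> 'a \<Rightarrow> bool" where
  "acyclic_edge t a b x y \<longleftrightarrow> \<not> tri t a b x \<and> \<not> tri t a b y \<and> \<not> quad t a b x y"

definition matrix_rel :: "bool list list \<Rightarrow> nat \<Rightarrow> nat \<Rightarrow> bool" where
  "matrix_rel m i j \<longleftrightarrow> m ! i ! j"

text \<open>An upper edge of a crossing of the prism can only spoil the layering if it lies on a cycle that avoids the
  lower edge, hence has its vertices among the endpoints of the upper edge and the other two vertices.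
  The condition excludes such cycles for the three crossings.\<close>

fun prism_order :: "(nat \<Rightarrow> nat \<Rightarrow> bool) \<Rightarrow> nat list \<Rightarrow> bool" where
  "prism_order t [a,b,c,d,e,f] \<longleftrightarrow> acyclic_edge t a e c f \<and> acyclic_edge t a f b e \<and> acyclic_edge t b f a d"
| "prism_order t _ \<longleftrightarrow> False"

fun row_matches :: "bool list \<Rightarrow> nat list \<Rightarrow> bool list \<Rightarrow> bool" where
  "row_matches r [] [] \<longleftrightarrow> True"
| "row_matches r (i # is) (x # xs) \<longleftrightarrow> r ! i = x \<and> row_matches r is xs"
| "row_matches r _ _ \<longleftrightarrow> False"

definition matches :: "bool list list \<Rightarrow> nat list \<Rightarrow> bool list list \<Rightarrow> bool" where
  "matches m p x \<longleftrightarrow> list_all2 (\<lambda>i. row_matches (m ! i) p) p x"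

text \<open>Enough permutations to find a placement of the above kind for every tournament on six vertices that has one,
  provided that its vertices are sorted by score.\<close>

definition good_orders :: "nat list list" where
  "good_orders = [[0,2,4,1,3,5], [0,2,3,1,5,4], [1,0,4,2,3,5], [0,2,1,4,3,5], [1,0,5,2,3,4], [0,3,1,2,5,4], [1,0,3,4,2,5], [0,3,2,1,5,4], [1,0,4,3,2,5], [1,0,5,3,2,4], [1,0,3,2,5,4], [1,0,5,4,2,3], [2,3,1,0,5,4], [1,0,3,5,2,4], [1,0,4,5,2,3], [1,3,0,2,5,4], [2,3,0,1,5,4], [1,0,2,3,5,4], [1,5,0,2,3,4], [2,0,4,1,5,3], [2,1,3,0,5,4], [0,1,2,3,4,5], [1,0,4,2,5,3], [0,1,3,4,2,5], [0,2,4,1,5,3], [1,0,2,5,3,4], [2,0,3,1,5,4], [0,1,2,4,3,5], [0,1,2,5,4,3], [0,1,3,2,5,4], [0,1,3,5,2,4], [0,1,4,2,3,5], [0,1,4,2,5,3], [0,1,4,3,2,5], [0,1,4,5,2,3], [1,0,5,2,4,3], [1,2,4,0,3,5], [1,2,4,0,5,3], [2,0,4,1,3,5], [2,1,4,0,3,5], [2,1,4,0,5,3], [0,1,3,2,4,5], [0,1,5,2,3,4], [0,1,5,2,4,3], [0,2,3,1,4,5], [0,2,5,1,3,4], [0,2,5,1,4,3], [1,0,3,2,4,5], [1,2,3,0,4,5], [1,2,3,0,5,4], [1,2,5,0,3,4], [1,2,5,0,4,3], [2,0,3,1,4,5], [2,0,5,1,3,4], [2,0,5,1,4,3], [2,1,3,0,4,5],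 [2,1,5,0,3,4], [2,1,5,0,4,3]]"

text \<open>Permutations that identify the sorted copies of the three exceptional tournaments with the
  representatives below.\<close>

definition special_orders :: "nat list list" where
  "special_orders = [[0,1,2,3,4,5], [0,1,2,5,4,3], [0,1,3,2,4,5], [0,1,3,4,5,2], [0,1,4,5,2,3], [0,1,5,2,3,4], [0,1,5,3,2,4], [0,1,5,4,3,2], [0,2,1,5,4,3], [0,3,1,2,4,5], [1,0,2,3,4,5], [1,0,2,4,5,3], [1,0,2,5,3,4], [1,2,0,3,4,5], [1,2,0,3,5,4], [1,2,0,4,3,5], [1,2,0,4,5,3], [1,2,0,5,4,3], [1,2,3,0,4,5], [1,3,2,0,4,5], [2,1,0,3,4,5], [2,1,0,4,3,5], [2,1,0,5,4,3], [2,1,3,0,4,5], [3,0,1,2,4,5], [3,0,2,1,4,5]]"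

text \<open>Up to isomorphism, these three tournaments on six vertices are the only ones that have no placement of the above kind. Rows
  list the out-neighbours.\<close>

definition specials :: "bool list list list" where
  "specials = map (map (\<lambda>ns. map (\<lambda>j. j \<in> set ns) [0..<6])) [[[5], [0,5], [0,1,4], [0,1,2], [0,1,3], [2,3,4]], [[4,5], [0,3], [0,1], [0,2], [1,2,3], [1,2,3,4]], [[2,5], [0,4], [1,3], [0,1,4], [0,2,5], [1,2,3]]]"

definition classified :: "bool list list \<Rightarrow> bool" where
  "classified m \<longleftrightarrow> list_ex (prism_order (matrix_rel m)) good_orders \<or>
     list_ex (\<lambda>p. list_ex (matches m p) specials) special_orders"

text \<open>Checks a property of all tournament matrices whose row sums are non-decreasing. The matrix is built row by row: the
  entries left of the diagonal are determined by the previous rows.\<close>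

fun sorted_tournaments :: "(bool list list \<Rightarrow> bool) \<Rightarrow> nat \<Rightarrow> nat \<Rightarrow> bool list list \<Rightarrow> bool" where
  "sorted_tournaments P 0 s m \<longleftrightarrow> P m"
| "sorted_tournaments P (Suc n) s m \<longleftrightarrow> list_all (\<lambda>bs. let r = map (\<lambda>q. \<not> q ! length m) m @ False # bs; c = length (filter id r) in
     c < s \<or> sorted_tournaments P n c (m @ [r])) (List.n_lists n [False,True])"

section \<open>Layered placements\<close>

text \<open>A necessary condition for some directed cycle to contain the edge between \<open>c\<close> and \<open>d\<close> and otherwise only vertices of \<open>Z\<close>
  and the two high vertices: coming from the vertex 6, it enters through an out-neighbour of 6; from every
  other vertex it may return to 6. A cycle that avoids 6 is a triangle, as \<open>Z\<close> will have at most one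
  element.\<close>

definition entry :: "('a \<Rightarrow> 'a \<Rightarrow> bool) \<Rightarrow> ('a \<Rightarrow> bool) \<Rightarrow> 'a \<Rightarrow> 'a \<Rightarrow> 'a list \<Rightarrow> bool" where
  "entry t out c d Z \<longleftrightarrow> t c d \<and> (out c \<or> list_ex (\<lambda>z. t z c \<and> (out z \<or> t d z)) Z) \<or>
     t d c \<and> (out d \<or> list_ex (\<lambda>z. t z d \<and> (out z \<or> t c z)) Z)"

text \<open>No directed cycle through the upper edge \<open>ab\<close> of a crossing is disjoint from a directed cycle through
  its lower edge \<open>cd\<close>, where \<open>x\<close> and \<open>y\<close> are the remaining vertices of the prism.\<close>

definition fits :: "('a \<Rightarrow> 'a \<Rightarrow> bool) \<Rightarrow> ('a \<Rightarrow> bool) \<Rightarrow> 'a \<Rightarrow> 'a \<Rightarrow> 'a \<Rightarrow> 'a \<Rightarrow> 'a \<Rightarrow> 'a \<Rightarrow> bool" where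
  "fits t out a b c d x y \<longleftrightarrow> \<not> (tri t a b x \<and> entry t out c d [y]) \<and> \<not> (tri t a b y \<and> entry t out c d [x]) \<and>
     \<not> (quad t a b x y \<and> entry t out c d [])"

fun placement :: "('a \<Rightarrow> 'a \<Rightarrow> bool) \<Rightarrow> ('a \<Rightarrow> bool) \<Rightarrow> 'a list \<Rightarrow> bool" where
  "placement t out [a,b,c,d,e,f] \<longleftrightarrow> fits t out a e b d c f \<and> fits t out a f c d b e \<and> fits t out b f c e a d"
| "placement t out _ \<longleftrightarrow> False"

lemma prism_order_placement: "prism_order t p \<Longrightarrow> placement t out p"
  by (induction t p rule: prism_order.induct) (auto simp: acyclic_edge_def fits_def)

section \<open>Cycles\<close>

lemma links_snoc: "links (xs @ [a,b]) = links (xs @ [a]) @ [(a,b)]"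
  by (induction xs rule: links.induct) auto

lemma cyc_arcs_Cons: "cyc_arcs (a # xs) = (a, hd (xs @ [a])) # links (xs @ [a])"
  unfolding cyc_arcs_def by (cases xs) auto

lemma cyc_arcs_rotate1: "set (cyc_arcs (rotate1 xs)) = set (cyc_arcs xs)"
proof (cases xs)
  case (Cons a ys)
  show ?thesis
  proof (cases ys)
    case (Cons b zs)
    have "cyc_arcs (rotate1 xs) = links ((b # zs) @ [a, b])" using \<open>xs = a # ys\<close> Cons unfolding cyc_arcs_def by simp
    then show ?thesis using \<open>xs = a # ys\<close> Cons links_snoc[of "b # zs" a b] by (simp add: cyc_arcs_def insert_commute)
  qed (simp add: Cons)
qed simp

lemma cyc_arcs_rotate: "set (cyc_arcs (rotate n xs)) = set (cyc_arcs xs)"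
  by (induction n) (simp_all add: cyc_arcs_rotate1)

lemma dcycle_from:
  assumes "dcycle R xs" "a \<in> set xs"
  shows "\<exists>ys. dcycle R (a # ys) \<and> set (a # ys) = set xs \<and> set (cyc_arcs (a # ys)) = set (cyc_arcs xs)"
proof -
  obtain n where n: "n < length xs" "xs ! n = a" using assms(2) by (auto simp: in_set_conv_nth)
  then have "hd (rotate n xs) = a" by (subst hd_rotate_conv_nth) auto
  moreover have "rotate n xs \<noteq> []" using n(1) by auto
  ultimately obtain ys where ys: "rotate n xs = a # ys" by (metis list.collapse)
  show ?thesis
    using assms(1) cyc_arcs_rotate[of n xs] set_rotate[of n xs] distinct_rotate[of n xs]
    unfolding dcycle_def ys by (intro exI[of _ ys]) simp
qed

lemma dcycle_through:
  assumes "dcycle R xs" "(a,b) \<in> set (cyc_arcs xs)" "a \<noteq> b"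
  shows "\<exists>zs. dcycle R (a # b # zs) \<and> set (a # b # zs) = set xs"
proof -
  have fst_links: "fst ` set (links ys) = set (butlast ys)" for ys :: "'a list"
    by (induction ys rule: links.induct) auto
  have "xs \<noteq> []" using assms(1) unfolding dcycle_def by simp
  then have "a \<in> set xs" using cyc_arcs_tails[of xs] assms(2) by force
  from dcycle_from[OF assms(1) this] obtain ys
    where ys: "dcycle R (a # ys)" "set (a # ys) = set xs" "set (cyc_arcs (a # ys)) = set (cyc_arcs xs)" by blast
  have "a \<notin> fst ` set (links (ys @ [a]))" unfolding fst_links using ys(1) unfolding dcycle_def by simp
  then have "(a,b) \<notin> set (links (ys @ [a]))" by force
  then have "b = hd (ys @ [a])" using assms(2) ys(3)[symmetric] unfolding cyc_arcs_Cons by auto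
  then obtain zs where "ys = b # zs" using assms(3) by (cases ys) auto
  then show ?thesis using ys by blast
qed

lemma distinct_in_pair:
  assumes "distinct zs" "set zs \<subseteq> {x,y}"
  shows "zs = [] \<or> zs = [x] \<or> zs = [y] \<or> zs = [x,y] \<or> zs = [y,x]"
proof -
  have "length zs \<le> 2"
    using distinct_card[OF assms(1)] card_mono[OF _ assms(2)] card_insert_le_m1[of 2 "{y}" x] by (simp add: card_insert_if split: if_splits)
  then show ?thesis using assms by (cases zs rule: remdups_adj.cases) (auto simp: numeral_2_eq_2)
qed

lemma tri_sym: "tri t b a x = tri t a b x"
  unfolding tri_def by blast

lemma quad_sym: "quad t b a x y = quad t a b x y"
  unfolding quad_def by blast

lemma cycle_in_four:
  assumes D: "dcycle R D" "(a,b) \<in> set (cyc_arcs D)" "a \<noteq> b" "set D \<subseteq> {a,b,x,y}"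
    and asym: "(b,a) \<notin> R"
  shows "tri (\<lambda>u v. (u,v) \<in> R) a b x \<and> x \<in> set D \<or> tri (\<lambda>u v. (u,v) \<in> R) a b y \<and> y \<in> set D \<or>
     quad (\<lambda>u v. (u,v) \<in> R) a b x y \<and> x \<in> set D \<and> y \<in> set D"
proof -
  obtain zs where zs: "dcycle R (a # b # zs)" "set (a # b # zs) = set D" using dcycle_through[OF D(1-3)] by blast
  have d: "distinct (a # b # zs)" and s: "set (cyc_arcs (a # b # zs)) \<subseteq> R" using zs(1) unfolding dcycle_def by simp_all
  have "set zs \<subseteq> {x,y}" using d zs(2) D(4) by auto
  with d have "zs = [] \<or> zs = [x] \<or> zs = [y] \<or> zs = [x,y] \<or> zs = [y,x]" by (intro distinct_in_pair) simp
  then show ?thesis using s asym unfolding zs(2)[symmetric] tri_def quad_def by (elim disjE) (simp_all add: cyc_arcs_def)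
qed

text \<open>The last vertex before \<open>c\<close> is 6 or an element of \<open>Z\<close>, since the only arc that may leave 7 goes to 6;
  in the second case the same argument applies to the vertex before it.\<close>

lemma cycle_enters:
  assumes C: "dcycle R C" "(c,d) \<in> set (cyc_arcs C)" "c \<noteq> d" "set C \<subseteq> {c,d,6,7} \<union> Z" "Z \<subseteq> {z}"
    and asym: "(d,c) \<notin> R" and c: "c \<noteq> 6" "z \<noteq> 6" "z \<noteq> c" and sink: "\<And>u. (7,u) \<in> R \<Longrightarrow> u = 6"
  shows "(c,d) \<in> R \<and> ((6,c) \<in> R \<or> (\<exists>z\<in>Z. (z,c) \<in> R \<and> ((6,z) \<in> R \<or> (d,z) \<in> R)))"
proof -
  obtain zs where zs: "dcycle R (c # d # zs)" "set (c # d # zs) = set C" using dcycle_through[OF C(1-3)] by blast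
  have dist: "distinct (c # d # zs)" and s: "set (cyc_arcs (c # d # zs)) \<subseteq> R" using zs(1) unfolding dcycle_def by simp_all
  have sub: "set zs \<subseteq> {6,7} \<union> Z" using dist zs(2) C(4) by auto
  have arcs: "(c,d) \<in> R" "set (links (d # zs @ [c])) \<subseteq> R" using s by (simp_all add: cyc_arcs_def)
  have "zs \<noteq> []" using arcs(2) asym by auto
  then obtain ys l where l: "zs = ys @ [l]" by (metis rev_exhaust)
  have lc: "(l,c) \<in> R" using arcs(2) links_snoc[of "d # ys" l c] unfolding l by simp
  have "l \<noteq> 7" using sink lc c by blast
  then consider "l = 6" | "l = z" "z \<in> Z" using sub C(5) unfolding l by auto
  then show ?thesis
  proof cases
    case 1 then show ?thesis using lc arcs(1) by blast
  next
    case 2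
    have "(6,z) \<in> R \<or> (d,z) \<in> R"
    proof (cases ys rule: rev_cases)
      case Nil then show ?thesis using arcs(2) l 2 by simp
    next
      case (snoc xs q)
      have ql: "(q,l) \<in> R" using arcs(2) links_snoc[of "d # xs @ [q]" l c] links_snoc[of "d # xs" q l] unfolding l snoc by simp
      have "q \<noteq> z" using dist 2 unfolding l snoc by simp
      then have "q = 6 \<or> q = 7" using sub C(5) unfolding l snoc by auto
      then show ?thesis using ql sink[of l] 2 c by auto
    qed
    then show ?thesis using lc arcs(1) 2 by blast
  qed
qed

lemma fits_blocks:
  fixes R :: "(nat \<times> nat) set"
  assumes fits: "fits (\<lambda>u v. (u,v) \<in> R) (\<lambda>v. (6,v) \<in> R) a b c d x y"
    and six: "{a,b,c,d,x,y} = {0..<6}" "distinct [a,b,c,d,x,y]"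
    and asym: "\<And>u v. (u,v) \<in> R \<Longrightarrow> u < 6 \<Longrightarrow> v < 6 \<Longrightarrow> (v,u) \<notin> R" and sink: "\<And>u. (7,u) \<in> R \<Longrightarrow> u = 6"
    and C: "dcycle R C" "set C \<subseteq> {0..<8}" "(c,d) \<in> set (cyc_arcs C) \<or> (d,c) \<in> set (cyc_arcs C)"
    and D: "dcycle R D" "set D \<subseteq> {0..<6}" "(a,b) \<in> set (cyc_arcs D) \<or> (b,a) \<in> set (cyc_arcs D)"
    and disj: "set C \<inter> set D = {}"
  shows False
proof -
  let ?t = "\<lambda>u v. (u,v) \<in> R" and ?out = "\<lambda>v. (6,v) \<in> R"
  have lt: "a < 6" "b < 6" "c < 6" "d < 6" "x < 6" "y < 6" using six(1) by (metis atLeastLessThan_iff insert_iff)+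
  have eight: "{0..<8::nat} = {a,b,c,d,x,y} \<union> {6,7}" unfolding six(1) by auto
  have tails: "fst ` set (cyc_arcs xs) = set xs" if "dcycle R xs" for xs
    using cyc_arcs_tails that unfolding dcycle_def by blast
  have heads: "v \<in> set xs" if "dcycle R xs" "(u,v) \<in> set (cyc_arcs xs)" for u v xs
    using that links_subset[of u v "xs @ [hd xs]"] unfolding cyc_arcs_def dcycle_def by auto
  have cdC: "c \<in> set C" "d \<in> set C" using C(3) tails[OF C(1)] heads[OF C(1)] by force+
  then have D4: "set D \<subseteq> {a,b,x,y}" using D(2) disj unfolding six(1)[symmetric] by blast
  have abD: "a \<in> set D" "b \<in> set D" using D(3) tails[OF D(1)] heads[OF D(1)] by force+
  have entry: "entry ?t ?out c d Z" if Z: "set C \<subseteq> {c,d,6,7} \<union> set Z" "set Z \<subseteq> {z}" and z: "z \<noteq> c" "z \<noteq> d" "z < 6" for Z z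
  proof -
    have enters: "(u,v) \<in> R \<and> ((6,u) \<in> R \<or> (\<exists>z\<in>set Z. (z,u) \<in> R \<and> ((6,z) \<in> R \<or> (v,z) \<in> R)))"
      if uv: "(u,v) \<in> set (cyc_arcs C)" "{u,v} = {c,d}" for u v
    proof (rule cycle_enters[OF C(1) uv(1) _ _ Z(2)])
      show "u \<noteq> v" using uv(2) six(2) by (auto simp: doubleton_eq_iff)
      show "set C \<subseteq> {u,v,6,7} \<union> set Z" using Z(1) uv(2) by auto
      have "(u,v) \<in> R" using uv(1) C(1) unfolding dcycle_def by blast
      then show "(v,u) \<notin> R" by (rule asym) (use uv(2) lt in \<open>auto simp: doubleton_eq_iff\<close>)
      show "u \<noteq> 6" "z \<noteq> 6" "z \<noteq> u" using uv(2) lt z by (auto simp: doubleton_eq_iff)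
      show "\<And>w. (7,w) \<in> R \<Longrightarrow> w = 6" by (rule sink)
    qed
    show ?thesis using C(3)
    proof
      assume "(c,d) \<in> set (cyc_arcs C)"
      from enters[OF this refl] show ?thesis unfolding entry_def list_ex_iff by blast
    next
      assume "(d,c) \<in> set (cyc_arcs C)"
      from enters[OF this insert_commute] show ?thesis unfolding entry_def list_ex_iff by blast
    qed
  qed
  have "(tri ?t a b x \<and> x \<in> set D \<or> tri ?t a b y \<and> y \<in> set D) \<or> quad ?t a b x y \<and> x \<in> set D \<and> y \<in> set D"
  proof -
    have ne: "a \<noteq> b" using six(2) by simp
    show ?thesis using D(3)
    proof
      assume ab: "(a,b) \<in> set (cyc_arcs D)"
      then have "(b,a) \<notin> R" using asym[of a b] lt D(1) unfolding dcycle_def by blast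
      from cycle_in_four[OF D(1) ab ne D4 this] show ?thesis by blast
    next
      assume ba: "(b,a) \<in> set (cyc_arcs D)"
      then have n: "(a,b) \<notin> R" using asym[of b a] lt D(1) unfolding dcycle_def by blast
      have "set D \<subseteq> {b,a,x,y}" using D4 by blast
      from cycle_in_four[OF D(1) ba ne[symmetric] this n] show ?thesis unfolding tri_sym[of _ b] quad_sym[of _ b] by blast
    qed
  qed
  then consider "tri ?t a b x" "x \<in> set D" | "tri ?t a b y" "y \<in> set D" | "quad ?t a b x y" "x \<in> set D" "y \<in> set D"
    by blast
  then show False
  proof cases
    case 1
    have "set C \<subseteq> {c,d,6,7} \<union> set [y]" using C(2) disj abD 1(2) unfolding eight by auto
    from entry[OF this, of y] show False using fits 1(1) six(2) lt unfolding fits_def by auto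
  next
    case 2
    have "set C \<subseteq> {c,d,6,7} \<union> set [x]" using C(2) disj abD 2(2) unfolding eight by auto
    from entry[OF this, of x] show False using fits 2(1) six(2) lt unfolding fits_def by auto
  next
    case 3
    have "set C \<subseteq> {c,d,6,7} \<union> set []" using C(2) disj abD 3(2,3) unfolding eight by auto
    from entry[OF this, of x] show False using fits 3(1) six(2) lt unfolding fits_def by auto
  qed
qed

lemma low_not_above: "list_all (\<lambda>(e,f). \<not> snd f < 6 \<or> (e,f) \<in> set [((1,3),(0,4)), ((2,3),(0,5)), ((2,4),(1,5))]) not_above"
  by code_simp

lemma dcycle_subset:
  assumes "dcycle R C" "R \<subseteq> V \<times> V"
  shows "set C \<subseteq> V"
  using cyc_arcs_tails[of C] assms unfolding dcycle_def by fastforce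

text \<open>Of two disjoint cycles one avoids 6, and then also 7, as every arc from 7 goes to 6. It is the lower one: the edges at the
  two high vertices pass over the prism, and the remaining crossings are controlled by \<open>fits_blocks\<close>.\<close>

lemma placement_layered:
  fixes R :: "(nat \<times> nat) set"
  assumes placed: "placement (\<lambda>u v. (u,v) \<in> R) (\<lambda>v. (6,v) \<in> R) [0,1,2,3,4,5]"
    and R: "R \<subseteq> {0..<8} \<times> {0..<8}" and irr: "\<And>u. (u,u) \<notin> R"
    and asym: "\<And>u v. (u,v) \<in> R \<Longrightarrow> u < 6 \<Longrightarrow> v < 6 \<Longrightarrow> (v,u) \<notin> R" and sink: "\<And>u. (7,u) \<in> R \<Longrightarrow> u = 6"
  shows "layered R"
proof -
  have heads: "v \<in> set xs" "u \<in> set xs" if "dcycle R xs" "(u,v) \<in> set (cyc_arcs xs)" for u v xs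
    using that links_subset[of u v "xs @ [hd xs]"] unfolding cyc_arcs_def dcycle_def by auto
  have over: "over_cycle C D" if C: "dcycle R C" and D: "dcycle R D" and disj: "set C \<inter> set D = {}" and low: "set D \<subseteq> {0..<6}" for C D
    unfolding over_cycle_def
  proof (intro ballI, rule ccontr)
    fix e f assume e: "e \<in> set (cyc_arcs C)" and f: "f \<in> set (cyc_arcs D)" and no: "\<not> above e f"
    obtain i j k l where ef: "e = (i,j)" "f = (k,l)" by (cases e; cases f) auto
    have ijkl: "i \<in> set C" "j \<in> set C" "k \<in> set D" "l \<in> set D" using heads[OF C] heads[OF D] e f unfolding ef by auto
    have "(i,j) \<in> R" "(k,l) \<in> R" using e f C D unfolding ef dcycle_def by auto
    then have "i \<noteq> j" "k \<noteq> l" using irr by auto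
    note ne = this
    have C8: "set C \<subseteq> {0..<8}" using dcycle_subset[OF C R] .
    have lt: "i < 8" "j < 8" "k < 6" "l < 6" using subsetD[OF C8] subsetD[OF low] ijkl by auto
    have "i \<noteq> k" "i \<noteq> l" "j \<noteq> k" "j \<noteq> l" using ijkl disj unfolding disjoint_iff by metis+
    then have "above (i,j) (k,l) \<or> ((min i j, max i j), (min k l, max k l)) \<in> set not_above"
      using ne lt by (intro above_cases) simp_all
    then have "((min i j, max i j), (min k l, max k l)) \<in> set not_above" using no unfolding ef by blast
    moreover have "max k l < 6" using lt by simp
    ultimately have "((min i j, max i j), (min k l, max k l)) \<in> set [((1,3),(0,4)), ((2,3),(0,5)), ((2,4),(1,5))]"
      using low_not_above[unfolded list_all_iff] by fastforce
    then consider "min i j = 1" "max i j = 3" "min k l = 0" "max k l = 4" | "min i j = 2" "max i j = 3" "min k l = 0" "max k l = 5"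
      | "min i j = 2" "max i j = 4" "min k l = 1" "max k l = 5" by auto
    then have cases: "(min i j = 1 \<and> max i j = 3) \<and> (min k l = 0 \<and> max k l = 4) \<or> (min i j = 2 \<and> max i j = 3) \<and> (min k l = 0 \<and> max k l = 5)
      \<or> (min i j = 2 \<and> max i j = 4) \<and> (min k l = 1 \<and> max k l = 5)" by cases simp_all
    have unordered: "(p,q) \<in> X \<or> (q,p) \<in> X" if "min u v = p \<and> max u v = q" "(u,v) \<in> X" for u v p q :: nat and X
      using that by (auto simp: min_def max_def split: if_splits)
    from cases consider "(1,3) \<in> set (cyc_arcs C) \<or> (3,1) \<in> set (cyc_arcs C)" "(0,4) \<in> set (cyc_arcs D) \<or> (4,0) \<in> set (cyc_arcs D)"
      | "(2,3) \<in> set (cyc_arcs C) \<or> (3,2) \<in> set (cyc_arcs C)" "(0,5) \<in> set (cyc_arcs D) \<or> (5,0) \<in> set (cyc_arcs D)"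
      | "(2,4) \<in> set (cyc_arcs C) \<or> (4,2) \<in> set (cyc_arcs C)" "(1,5) \<in> set (cyc_arcs D) \<or> (5,1) \<in> set (cyc_arcs D)"
      using unordered[OF _ e[unfolded ef]] unordered[OF _ f[unfolded ef]] by blast
    then show False
    proof cases
      case 1
      show False
        by (rule fits_blocks[of R 0 4 1 3 2 5, OF _ _ _ asym sink C C8 1(1) D low 1(2) disj]) (use placed in auto)
    next
      case 2
      show False
        by (rule fits_blocks[of R 0 5 2 3 1 4, OF _ _ _ asym sink C C8 2(1) D low 2(2) disj]) (use placed in auto)
    next
      case 3
      show False
        by (rule fits_blocks[of R 1 5 2 4 0 3, OF _ _ _ asym sink C C8 3(1) D low 3(2) disj]) (use placed in auto)
    qed
  qed
  have low: "set D \<subseteq> {0..<6}" if D: "dcycle R D" and "6 \<notin> set D" for D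
  proof -
    have "7 \<notin> set D"
    proof
      assume "7 \<in> set D"
      from dcycle_from[OF D this] obtain ys where "dcycle R (7 # ys)" "set (7 # ys) = set D" by blast
      then have "(7, hd (ys @ [7])) \<in> R" "set (7 # ys) = set D" unfolding dcycle_def cyc_arcs_Cons by auto
      then have "6 \<in> set D" using sink[of "hd (ys @ [7])"] by (cases ys) auto
      then show False using that(2) by blast
    qed
    have "x < 6" if x: "x \<in> set D" for x
    proof -
      have "x < 8" using dcycle_subset[OF D R] x by auto
      moreover have "x \<noteq> 6" "x \<noteq> 7" using x \<open>6 \<notin> set D\<close> \<open>7 \<notin> set D\<close> by blast+
      ultimately show ?thesis by linarith
    qed
    then show ?thesis by auto
  qed
  show ?thesis
    unfolding layered_def
  proof (intro allI impI)
    fix C D assume C: "dcycle R C" and D: "dcycle R D" and disj: "set C \<inter> set D = {}"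
    show "over_cycle C D \<or> over_cycle D C"
    proof (cases "6 \<in> set D")
      case True
      then have "6 \<notin> set C" using disj by blast
      from over[OF D C _ low[OF C this]] show ?thesis using disj by (simp add: Int_commute)
    qed (use over[OF C D disj low[OF D]] in simp)
  qed
qed

section \<open>Enumeration of cycles\<close>

text \<open>The bound \<open>n\<close> on the number of intermediate vertices makes the recursion structural and allows short
  cycles to be enumerated separately.\<close>

fun returns :: "('a \<Rightarrow> 'a \<Rightarrow> bool) \<Rightarrow> 'a \<Rightarrow> nat \<Rightarrow> 'a \<Rightarrow> 'a list \<Rightarrow> 'a list list" where
  "returns r s 0 u vs = (if r u s then [[]] else [])"
| "returns r s (Suc n) u vs = (if r u s then [[]] else []) @
     concat (map (\<lambda>x. if r u x then map ((#) x) (returns r s n x (remove1 x vs)) else []) vs)"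

fun cycles_within :: "('a \<Rightarrow> 'a \<Rightarrow> bool) \<Rightarrow> nat \<Rightarrow> 'a list \<Rightarrow> 'a list list" where
  "cycles_within r n [] = []"
| "cycles_within r n (v # vs) = map ((#) v) (returns r v n v vs) @ cycles_within r n vs"

lemma returns_complete:
  assumes "distinct ps" "set ps \<subseteq> set vs" "length ps \<le> n" "\<And>a b. (a,b) \<in> set (links (u # ps @ [s])) \<Longrightarrow> r a b"
  shows "ps \<in> set (returns r s n u vs)"
  using assms
proof (induction ps arbitrary: n u vs)
  case Nil then show ?case by (cases n) auto
next
  case (Cons x ps)
  then obtain m where n: "n = Suc m" by (cases n) auto
  have "set ps \<subseteq> set (remove1 x vs)"
  proof
    fix y assume "y \<in> set ps"
    then have "y \<noteq> x" "y \<in> set vs" using Cons.prems(1,2) by auto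
    then show "y \<in> set (remove1 x vs)" by (simp add: in_set_remove1)
  qed
  then have "ps \<in> set (returns r s m x (remove1 x vs))"
    using Cons.prems n by (intro Cons.IH) auto
  moreover have "r u x" using Cons.prems(4) by simp
  ultimately show ?case using Cons.prems(2) unfolding n by auto
qed

lemma cycles_within_complete:
  assumes "dcycle R xs" "set xs \<subseteq> set vs" "length xs \<le> Suc n" "\<And>a b. (a,b) \<in> R \<Longrightarrow> r a b"
  shows "\<exists>ys\<in>set (cycles_within r n vs). set ys = set xs \<and> set (cyc_arcs ys) = set (cyc_arcs xs)"
  using assms(2)
proof (induction vs)
  case Nil then show ?case using assms(1) unfolding dcycle_def by simp
next
  case (Cons v vs)
  show ?case
  proof (cases "v \<in> set xs")
    case True
    from dcycle_from[OF assms(1) this] obtain ys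
      where ys: "dcycle R (v # ys)" "set (v # ys) = set xs" "set (cyc_arcs (v # ys)) = set (cyc_arcs xs)" by blast
    have d: "distinct (v # ys)" using ys(1) unfolding dcycle_def by blast
    have "length (v # ys) = length xs"
      using distinct_card[OF d] ys(2) assms(1) distinct_card[of xs] unfolding dcycle_def by simp
    then have "length ys \<le> n" using assms(3) by simp
    moreover have "set ys \<subseteq> set vs" using d ys(2) Cons.prems by auto
    moreover have "r a b" if "(a,b) \<in> set (links (v # ys @ [v]))" for a b
      using ys(1) that assms(4) unfolding dcycle_def cyc_arcs_def by auto
    ultimately have "ys \<in> set (returns r v n v vs)" using d by (intro returns_complete) auto
    then have "v # ys \<in> set (cycles_within r n (v # vs))" by simp
    then show ?thesis using ys(2,3) by blast
  next
    case False
    then have "set xs \<subseteq> set vs" using Cons.prems by auto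
    from Cons.IH[OF this] show ?thesis by auto
  qed
qed

definition above_listed :: "nat list \<Rightarrow> nat list \<Rightarrow> bool" where
  "above_listed C D \<longleftrightarrow> (let es = map (\<lambda>(i,j). (min i j, max i j)) (cyc_arcs C); fs = map (\<lambda>(i,j). (min i j, max i j)) (cyc_arcs D) in
     list_all (\<lambda>(e,f). e \<notin> set es \<or> f \<notin> set fs) not_above)"

text \<open>One of two disjoint cycles on eight vertices has at most four vertices.\<close>

definition layered_check :: "(nat \<Rightarrow> nat \<Rightarrow> bool) \<Rightarrow> bool" where
  "layered_check r \<longleftrightarrow> list_all (\<lambda>D. list_all (\<lambda>C. above_listed C D \<or> above_listed D C)
     (cycles_within r 7 (filter (\<lambda>v. v \<notin> set D) [0..<8]))) (cycles_within r 3 [0..<8])"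

lemma above_listed_over_cycle:
  assumes "above_listed C D" and C: "\<And>i j. (i,j) \<in> set (cyc_arcs C) \<Longrightarrow> i \<in> set C \<and> j \<in> set C \<and> i \<noteq> j"
    and D: "\<And>i j. (i,j) \<in> set (cyc_arcs D) \<Longrightarrow> i \<in> set D \<and> j \<in> set D \<and> i \<noteq> j"
    and lt: "set C \<subseteq> {0..<8}" "set D \<subseteq> {0..<8}" and disj: "set C \<inter> set D = {}"
  shows "over_cycle C D"
  unfolding over_cycle_def
proof (intro ballI)
  fix e f assume e: "e \<in> set (cyc_arcs C)" and f: "f \<in> set (cyc_arcs D)"
  obtain i j k l where ef: "e = (i,j)" "f = (k,l)" by (cases e; cases f) auto
  have i: "i \<in> set C" "j \<in> set C" "i \<noteq> j" and k: "k \<in> set D" "l \<in> set D" "k \<noteq> l" using C D e f unfolding ef by blast+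
  have "i < 8" "j < 8" "k < 8" "l < 8" using subsetD[OF lt(1)] subsetD[OF lt(2)] i k by auto
  moreover have "i \<noteq> k" "i \<noteq> l" "j \<noteq> k" "j \<noteq> l" using i k disj unfolding disjoint_iff by metis+
  ultimately have *: "above (i,j) (k,l) \<or> ((min i j, max i j), (min k l, max k l)) \<in> set not_above"
    using i(3) k(3) by (intro above_cases) simp_all
  let ?n = "\<lambda>(i,j). (min i j, max i j)"
  have "?n e \<in> set (map ?n (cyc_arcs C))" "?n f \<in> set (map ?n (cyc_arcs D))" using e f by simp_all
  then have mem: "(min i j, max i j) \<in> set (map ?n (cyc_arcs C))" "(min k l, max k l) \<in> set (map ?n (cyc_arcs D))"
    unfolding ef prod.case .
  have "((min i j, max i j), (min k l, max k l)) \<notin> set not_above"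
  proof
    assume "((min i j, max i j), (min k l, max k l)) \<in> set not_above"
    from bspec[OF assms(1)[unfolded above_listed_def Let_def list_all_iff] this]
    show False using mem unfolding prod.case by blast
  qed
  then show "above e f" using * unfolding ef by blast
qed

lemma layered_checked:
  assumes "layered_check r" and R: "R \<subseteq> {0..<8} \<times> {0..<8}" "\<And>i j. (i,j) \<in> R \<Longrightarrow> r i j" and irr: "\<And>i. (i,i) \<notin> R"
  shows "layered R"
proof -
  have short: "over_cycle C D \<or> over_cycle D C"
    if C: "dcycle R C" and D: "dcycle R D" and disj: "set C \<inter> set D = {}" and len: "length D \<le> 4" for C D
  proof -
    have C8: "set C \<subseteq> {0..<8}" and D8: "set D \<subseteq> {0..<8}" using dcycle_subset[OF _ R(1)] C D by blast+
    \<comment> \<open>The enumeration counts the vertices after the first one, hence the offset.\<close>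
    have "set D \<subseteq> set [0..<8]" "length D \<le> Suc 3" using D8 len by auto
    from cycles_within_complete[OF D this, of r, OF R(2)] obtain D'
      where D': "D' \<in> set (cycles_within r 3 [0..<8])" "set D' = set D" "set (cyc_arcs D') = set (cyc_arcs D)" by blast
    have "length C \<le> card {0..<8::nat}" using C C8 distinct_card[of C] card_mono[OF _ C8] unfolding dcycle_def by simp
    then have lC: "length C \<le> Suc 7" by simp
    have "set C \<subseteq> set (filter (\<lambda>v. v \<notin> set D') [0..<8])" using C8 disj D'(2) by auto
    from cycles_within_complete[OF C this lC, of r, OF R(2)] obtain C'
      where C': "C' \<in> set (cycles_within r 7 (filter (\<lambda>v. v \<notin> set D') [0..<8]))" "set C' = set C" "set (cyc_arcs C') = set (cyc_arcs C)" by blast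
    have arcs: "i \<in> set X \<and> j \<in> set X \<and> i \<noteq> j" if "dcycle R X" "(i,j) \<in> set (cyc_arcs X)" for X i j
      using that links_subset[of i j "X @ [hd X]"] irr unfolding cyc_arcs_def dcycle_def by auto
    have "above_listed C' D' \<or> above_listed D' C'"
      using assms(1) D'(1) C'(1) unfolding layered_check_def list_all_iff by blast
    then have "over_cycle C' D' \<or> over_cycle D' C'"
    proof
      assume "above_listed C' D'"
      then have "over_cycle C' D'"
        by (rule above_listed_over_cycle) (use arcs[OF C] arcs[OF D] C' D' C8 D8 disj in auto)
      then show ?thesis ..
    next
      assume "above_listed D' C'"
      then have "over_cycle D' C'"
        by (rule above_listed_over_cycle) (use arcs[OF C] arcs[OF D] C' D' C8 D8 disj in auto)
      then show ?thesis ..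
    qed
    then show ?thesis unfolding over_cycle_def C'(3) D'(3) .
  qed
  show ?thesis
    unfolding layered_def
  proof (intro allI impI)
    fix C D assume C: "dcycle R C" and D: "dcycle R D" and disj: "set C \<inter> set D = {}"
    have "length C + length D \<le> 8"
    proof -
      have "set C \<union> set D \<subseteq> {0..<8}" using dcycle_subset[OF _ R(1)] C D by blast
      from card_mono[OF _ this] show ?thesis
        using C D disj distinct_card[of C] distinct_card[of D] unfolding dcycle_def by (simp add: card_Un_disjoint)
    qed
    then consider "length D \<le> 4" | "length C \<le> 4" by linarith
    then show "over_cycle C D \<or> over_cycle D C"
    proof cases
      case 1 then show ?thesis by (rule short[OF C D disj])
    next
      case 2
      have "set D \<inter> set C = {}" using disj by (simp add: Int_commute)
      from short[OF D C this 2] show ?thesis by blast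
    qed
  qed
qed

section \<open>Orders that keep the drawing layered\<close>

definition entry_orders :: "nat list list" where
  "entry_orders = [[0,1,5,4,2,3], [0,1,2,5,3,4], [0,1,2,5,4,3], [2,0,5,1,3,4], [1,0,5,2,3,4], [1,0,4,2,3,5], [4,2,0,3,5,1], [4,1,0,2,5,3], [4,1,0,3,5,2], [0,1,5,3,2,4], [1,0,2,4,5,3], [2,0,3,4,1,5], [0,1,2,3,5,4], [2,0,1,4,3,5], [1,2,0,5,4,3]]"

lemma orders_are_permutations:
  "list_all (\<lambda>p. distinct p \<and> length p = 6 \<and> list_all (\<lambda>i. i < 6) p) (good_orders @ special_orders @ entry_orders)"
  by code_simp

definition count_true :: "bool list \<Rightarrow> nat" where
  "count_true bs = length (filter id bs)"

text \<open>The score sequences with a vertex of score 1 for which some tournament admits no layered placement. All of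
  them turn out to have an intrinsically linked representative.\<close>

definition obstructed :: "nat list list" where
  "obstructed = [[1,2,3,4,4,4,4,6], [1,2,3,4,4,4,5,5], [1,3,3,3,3,4,5,6], [1,3,3,3,4,4,5,5], [1,3,3,4,4,4,4,5]]"

text \<open>Here \<open>bs\<close> says which of the six vertices of the exceptional tournament \<open>x\<close> are out-neighbours of the vertex 6.
  If no placement works, then 6 does not have the smallest score in the tournament without 7, and the scores of the
  whole tournament, in which 7 has score 1, are obstructed; the only exception is a tournament in which 6 beats all six vertices.\<close>

definition special_checked :: "bool list list \<Rightarrow> bool list \<Rightarrow> bool" where
  "special_checked x bs \<longleftrightarrow> list_ex (placement (matrix_rel x) ((!) bs)) entry_orders \<or>
     list_ex (\<lambda>i. count_true (x ! i) + (if bs ! i then 0 else 1) < count_true bs) [0..<6] \<and>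
     (sort (map (\<lambda>i. count_true (x ! i) + (if bs ! i then 0 else 1) + 1) [0..<6] @ [count_true bs, 1]) \<in> set obstructed
      \<or> x = specials ! 2 \<and> bs = replicate 6 True)"

lemma specials_checked: "list_all (\<lambda>x. list_all (special_checked x) (List.n_lists 6 [False,True])) specials"
  by code_simp

section \<open>Listing all tournaments by score\<close>

lemma sorted_tournaments_complete:
  assumes T: "\<And>i j. i < N \<Longrightarrow> j < N \<Longrightarrow> i \<noteq> j \<Longrightarrow> T j i \<longleftrightarrow> \<not> T i j" "\<And>i. i < N \<Longrightarrow> \<not> T i i"
    and mono: "\<And>i. Suc i < N \<Longrightarrow> count_true (map (T i) [0..<N]) \<le> count_true (map (T (Suc i)) [0..<N])"
    and P: "sorted_tournaments P n s (map (\<lambda>i. map (T i) [0..<N]) [0..<k])" "n + k = N"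
    and s: "k < N \<Longrightarrow> s \<le> count_true (map (T k) [0..<N])"
  shows "P (map (\<lambda>i. map (T i) [0..<N]) [0..<N])"
  using P s
proof (induction n arbitrary: k s)
  case 0 then show ?case by simp
next
  case (Suc n)
  let ?m = "map (\<lambda>i. map (T i) [0..<N]) [0..<k]"
  let ?bs = "map (T k) [Suc k..<N]"
  have k: "k < N" using Suc.prems(2) by simp
  have "length ?bs = n" using Suc.prems(2) by simp
  then have bs: "?bs \<in> set (List.n_lists n [False,True])" by (auto simp: set_n_lists)
  have "map (\<lambda>q. \<not> q ! length ?m) ?m = map (T k) [0..<k]" 
  proof -
    have "(\<not> T i k) = T k i" if "i < k" for i using T(1)[of i k] that k by simp
    then have "map (\<lambda>i. \<not> T i k) [0..<k] = map (T k) [0..<k]" by (intro map_cong) auto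
    then show ?thesis using k by (simp add: comp_def)
  qed
  moreover have "[0..<N] = [0..<k] @ [k..<N]" using upt_add_eq_append[of 0 k "N - k"] k by simp
  moreover have "[k..<N] = k # [Suc k..<N]" using k by (rule upt_conv_Cons)
  ultimately have row: "map (\<lambda>q. \<not> q ! length ?m) ?m @ False # ?bs = map (T k) [0..<N]" using T(2)[OF k] by simp
  from Suc.prems(1) have "\<forall>bs\<in>set (List.n_lists n [False,True]). let r = map (\<lambda>q. \<not> q ! length ?m) ?m @ False # bs; c = length (filter id r) in
     c < s \<or> sorted_tournaments P n c (?m @ [r])" by (simp only: sorted_tournaments.simps list_all_iff)
  from bspec[OF this bs] have "count_true (map (T k) [0..<N]) < s \<or>
      sorted_tournaments P n (count_true (map (T k) [0..<N])) (?m @ [map (T k) [0..<N]])"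
    unfolding Let_def row count_true_def[symmetric] .
  then have "sorted_tournaments P n (count_true (map (T k) [0..<N])) (?m @ [map (T k) [0..<N]])"
    by (rule disjE) (use Suc.prems(3)[OF k] in linarith)
  moreover have "?m @ [map (T k) [0..<N]] = map (\<lambda>i. map (T i) [0..<N]) [0..<Suc k]" by simp
  ultimately have step: "sorted_tournaments P n (count_true (map (T k) [0..<N])) (map (\<lambda>i. map (T i) [0..<N]) [0..<Suc k])"
    by (simp only:)
  show ?case
  proof (rule Suc.IH[OF step])
    show "n + Suc k = N" using Suc.prems(2) by simp
    show "count_true (map (T k) [0..<N]) \<le> count_true (map (T (Suc k)) [0..<N])" if "Suc k < N" using mono[OF that] .
  qed
qed

lemma prism_order_map: "prism_order t (map g p) = prism_order (\<lambda>i j. t (g i) (g j)) p"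
  by (induction "\<lambda>i j. t (g i) (g j)" p rule: prism_order.induct) (auto simp: acyclic_edge_def tri_def quad_def)

lemma prism_order_cong:
  "(\<And>i j. i \<in> set p \<Longrightarrow> j \<in> set p \<Longrightarrow> t i j = t' i j) \<Longrightarrow> prism_order t p = prism_order t' p"
  by (induction t p rule: prism_order.induct) (simp_all add: acyclic_edge_def tri_def quad_def)

lemma placement_map: "placement t out (map g p) = placement (\<lambda>i j. t (g i) (g j)) (\<lambda>i. out (g i)) p"
  by (induction "\<lambda>i j. t (g i) (g j)" "\<lambda>i. out (g i)" p rule: placement.induct)
    (simp_all add: fits_def entry_def tri_def quad_def)

lemma placement_cong:
  "(\<And>i j. i \<in> set p \<Longrightarrow> j \<in> set p \<Longrightarrow> t i j = t' i j) \<Longrightarrow> (\<And>i. i \<in> set p \<Longrightarrow> out i = out' i) \<Longrightarrow>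
     placement t out p = placement t' out' p"
  by (induction t out p rule: placement.induct) (simp_all add: fits_def entry_def tri_def quad_def)

lemma matches_iff:
  assumes "matches m p x" "k < length p" "l < length p"
  shows "m ! (p ! k) ! (p ! l) = x ! k ! l"
proof -
  have row: "r ! (q ! l) = xs ! l" if "row_matches r q xs" "l < length q" for r q xs l
    using that by (induction r q xs arbitrary: l rule: row_matches.induct) (auto simp: nth_Cons split: nat.splits)
  have "row_matches (m ! (p ! k)) p (x ! k)"
    using assms(1,2) unfolding matches_def by (auto simp: list_all2_conv_all_nth)
  from row[OF this assms(3)] show ?thesis .
qed

lemma relisting:
  assumes ws: "distinct ws" "length ws = n" and p: "distinct p" "length p = n" "\<forall>i\<in>set p. i < n"
  shows "distinct (map ((!) ws) p)" "set (map ((!) ws) p) = set ws"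
proof -
  have "set p = {0..<n}" using p by (intro card_subset_eq) (auto simp: distinct_card)
  then show "set (map ((!) ws) p) = set ws" using nth_image[of n ws] ws(2) by simp
  show "distinct (map ((!) ws) p)" using ws p by (auto simp: distinct_map inj_on_def nth_eq_iff_index_eq)
qed

definition bool_rows :: "nat \<Rightarrow> nat list list \<Rightarrow> bool list list" where
  "bool_rows n = map (\<lambda>ns. map (\<lambda>j. j \<in> set ns) [0..<n])"

text \<open>The remaining case of the previous check. It has a layered drawing too, but with the vertices of the
  prism chosen differently.\<close>

definition dominating :: "bool list list" where
  "dominating = bool_rows 8 [[1,2,4,5,6,7], [3,4,7], [1,3,5], [0], [2,3,6], [1,3,4,7], [1,2,3,5], [2,3,4,6]]"

lemma dominating_layered: "layered_check (matrix_rel dominating)"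
  by code_simp

lemma dominating_matches:
  "matches (map (\<lambda>r. r @ [False, True]) (specials ! 2) @ [replicate 6 True @ [False, False], replicate 6 False @ [True, False]])
     [6,0,1,7,2,4,3,5] dominating"
  by code_simp

text \<open>The four isomorphism types of tournaments with score sequence 2,2,2,2,5,5,5,5, numbered in such a way
  that the drawing on the eight sites is layered.\<close>

definition two_five_tournaments :: "bool list list list" where
  "two_five_tournaments = map (bool_rows 8) [[[2,3], [0,3], [1,3], [6,7], [0,1,2,3,6], [0,1,2,3,4], [0,1,2,5,7], [0,1,2,4,5]],
     [[1,3], [2,3], [0,5], [2,7], [0,1,2,3,7], [0,1,3,4,6], [0,1,2,3,4], [0,1,2,5,6]],
     [[1,3], [2,3], [0,7], [2,4], [0,1,2,5,6], [0,1,2,3,7], [0,1,2,3,5], [0,1,3,4,6]],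
     [[1,3], [2,3], [0,4], [2,4], [0,1,5,6,7], [0,1,2,3,7], [0,1,2,3,5], [0,1,2,3,6]]]"

lemma two_five_layered: "list_all (\<lambda>m. layered_check (matrix_rel m)) two_five_tournaments"
  by code_simp

lemma six_classified: "sorted_tournaments classified 6 0 []"
  by code_simp

section \<open>Listings of abstract tournaments\<close>

definition tour :: "nat set \<Rightarrow> (nat \<times> nat) set \<Rightarrow> bool" where
  "tour V A \<longleftrightarrow> finite V \<and> A \<subseteq> V \<times> V \<and> (\<forall>u\<in>V. (u,u) \<notin> A) \<and>
     (\<forall>u\<in>V. \<forall>v\<in>V. u \<noteq> v \<longrightarrow> ((u,v) \<in> A) \<noteq> ((v,u) \<in> A))"

definition outdeg :: "(nat \<times> nat) set \<Rightarrow> nat \<Rightarrow> nat" where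
  "outdeg A u = card {x. (u,x) \<in> A}"

definition score_list :: "nat set \<Rightarrow> (nat \<times> nat) set \<Rightarrow> nat list" where
  "score_list V A = sorted_list_of_multiset (image_mset (outdeg A) (mset_set V))"

text \<open>The \<open>i\<close>-th entry of the list is the vertex that is put on the \<open>i\<close>-th site.\<close>

definition layered_listing :: "nat set \<Rightarrow> (nat \<times> nat) set \<Rightarrow> nat list \<Rightarrow> bool" where
  "layered_listing V A ys \<longleftrightarrow> distinct ys \<and> set ys = V \<and> length ys = 8 \<and> layered {(i,j). i < 8 \<and> j < 8 \<and> (ys ! i, ys ! j) \<in> A}"

lemma count_true_card: "distinct ws \<Longrightarrow> count_true (map P ws) = card {x \<in> set ws. P x}"
  unfolding count_true_def filter_map comp_def id_def length_map
  by (metis distinct_card distinct_filter set_filter)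

lemma score_list_listing: "distinct ws \<Longrightarrow> set ws = V \<Longrightarrow> score_list V A = sort (map (outdeg A) ws)"
  unfolding score_list_def by (metis mset_map mset_set_set sorted_list_of_multiset_mset)

lemma outdeg_listing:
  assumes "tour V A" "distinct ws" "set ws = V"
  shows "outdeg A u = count_true (map (\<lambda>x. (u,x) \<in> A) ws)"
proof -
  have "{x. (u,x) \<in> A} = {x \<in> set ws. (u,x) \<in> A}" using assms(1,3) unfolding tour_def by blast
  then show ?thesis unfolding outdeg_def count_true_card[OF assms(2)] by (rule arg_cong)
qed

lemma tour_asym:
  assumes "tour V A" "(u,v) \<in> A"
  shows "(v,u) \<notin> A" "u \<noteq> v" "u \<in> V" "v \<in> V"
proof -
  show V: "u \<in> V" "v \<in> V" using assms unfolding tour_def by blast+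
  show "u \<noteq> v" using assms V unfolding tour_def by blast
  then show "(v,u) \<notin> A" using assms V unfolding tour_def by blast
qed

lemma tour_total:
  assumes "tour V A" "u \<in> V" "v \<in> V" "u \<noteq> v"
  shows "(v,u) \<in> A \<longleftrightarrow> (u,v) \<notin> A"
  using assms unfolding tour_def by metis

lemma placement_listing:
  assumes t: "tour V A" and ys: "distinct (xs @ [w,v])" "set (xs @ [w,v]) = V" "length xs = 6"
    and sink: "\<And>z. (v,z) \<in> A \<Longrightarrow> z = w" and placed: "placement (\<lambda>u v. (u,v) \<in> A) (\<lambda>u. (w,u) \<in> A) xs"
  shows "layered_listing V A (xs @ [w,v])"
proof -
  let ?ys = "xs @ [w,v]"
  let ?R = "{(i,j). i < 8 \<and> j < 8 \<and> (?ys ! i, ?ys ! j) \<in> A}"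
  have len: "length ?ys = 8" using ys(3) by simp
  have inj: "i = j" if "?ys ! i = ?ys ! j" "i < 8" "j < 8" for i j
    using that nth_eq_iff_index_eq[OF ys(1)] len by metis
  have w: "?ys ! 6 = w" and v: "?ys ! 7 = v" using ys(3) by (simp_all add: nth_append)
  have "xs = map ((!) ?ys) [0,1,2,3,4,5]"
    by (rule nth_equalityI) (use ys(3) in \<open>auto simp: nth_append nth_Cons numeral_eq_Suc split: nat.splits\<close>)
  then have "placement (\<lambda>i j. (?ys ! i, ?ys ! j) \<in> A) (\<lambda>i. (w, ?ys ! i) \<in> A) [0,1,2,3,4,5]"
    using placed placement_map[of "\<lambda>u v. (u,v) \<in> A" "\<lambda>u. (w,u) \<in> A" "(!) ?ys" "[0,1,2,3,4,5]"] by (simp only:)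
  moreover have "placement (\<lambda>i j. (i,j) \<in> ?R) (\<lambda>i. (6,i) \<in> ?R) [0,1,2,3,4,5] =
      placement (\<lambda>i j. (?ys ! i, ?ys ! j) \<in> A) (\<lambda>i. (w, ?ys ! i) \<in> A) [0,1,2,3,4,5]"
    by (rule placement_cong) (use w in auto)
  ultimately have "placement (\<lambda>i j. (i,j) \<in> ?R) (\<lambda>i. (6,i) \<in> ?R) [0,1,2,3,4,5]" by (simp only:)
  then have "layered ?R"
  proof (rule placement_layered)
    show "?R \<subseteq> {0..<8} \<times> {0..<8}" by auto
    show "(i,i) \<notin> ?R" for i using tour_asym(2)[OF t] by blast
    show "(j,i) \<notin> ?R" if "(i,j) \<in> ?R" for i j using tour_asym(1)[OF t] that by blast
    show "i = 6" if "(7,i) \<in> ?R" for i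
    proof -
      have "?ys ! i = w" "i < 8" using that sink v by auto
      then show ?thesis using inj[of i 6] w by simp
    qed
  qed
  then show ?thesis unfolding layered_listing_def using ys len by blast
qed

lemma matches_listing:
  assumes t: "tour V A" and ws: "distinct ws" "set ws = V" "length ws = 8" and p: "distinct p" "length p = 8" "\<forall>i\<in>set p. i < 8"
    and m: "matches (map (\<lambda>u. map (\<lambda>x. (u,x) \<in> A) ws) ws) p m" and lay: "layered_check (matrix_rel m)"
  shows "layered_listing V A (map ((!) ws) p)"
proof -
  let ?ys = "map ((!) ws) p"
  let ?R = "{(i,j). i < 8 \<and> j < 8 \<and> (?ys ! i, ?ys ! j) \<in> A}"
  have "layered ?R"
  proof (rule layered_checked[OF lay])
    show "?R \<subseteq> {0..<8} \<times> {0..<8}" by auto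
    show "(i,i) \<notin> ?R" for i using tour_asym(2)[OF t] by blast
    show "matrix_rel m i j" if "(i,j) \<in> ?R" for i j
    proof -
      have ij: "i < length p" "j < length p" "(ws ! (p ! i), ws ! (p ! j)) \<in> A" using that p(2) by auto
      have "p ! i < length ws" "p ! j < length ws" using ij(1,2) p(3) ws(3) nth_mem by metis+
      then show ?thesis using matches_iff[OF m ij(1,2)] ij(3) unfolding matrix_rel_def by simp
    qed
  qed
  then show ?thesis unfolding layered_listing_def using relisting[OF ws(1,3) p] ws(2) p(2) by simp
qed

lemma sorted_listing:
  fixes W :: "nat set"
  assumes "finite W"
  obtains ws where "distinct ws" "set ws = W" "sorted (map key ws)"
proof
  show "distinct (sort_key key (sorted_list_of_set W))" by simp
  show "set (sort_key key (sorted_list_of_set W)) = W" using assms by simp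
  show "sorted (map key (sort_key key (sorted_list_of_set W)))" by (rule sorted_sort_key)
qed

text \<open>Every tournament can be listed with non-decreasing scores, so the matrix enumeration covers it.\<close>

lemma tournaments_checked:
  assumes t: "tour V A" and W: "W \<subseteq> V" "card W = n" and P: "sorted_tournaments P n 0 []"
  obtains ws where "distinct ws" "set ws = W" "length ws = n" "P (map (\<lambda>u. map (\<lambda>x. (u,x) \<in> A) ws) ws)"
proof -
  have "finite W" using t W(1) unfolding tour_def by (blast intro: finite_subset)
  then obtain ws where ws: "distinct ws" "set ws = W" "sorted (map (\<lambda>u. card {x \<in> W. (u,x) \<in> A}) ws)"
    by (rule sorted_listing)
  have len: "length ws = n" using distinct_card[OF ws(1)] ws(2) W(2) by simp
  define T where "T i j \<longleftrightarrow> (ws ! i, ws ! j) \<in> A" for i j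
  have row: "map (T i) [0..<n] = map (\<lambda>x. (ws ! i, x) \<in> A) ws" for i
    unfolding T_def len[symmetric] using map_nth[of ws] by (metis (no_types, lifting) map_map comp_def map_eq_conv)
  have wsV: "ws ! i \<in> V" if "i < n" for i using that len ws(2) W(1) nth_mem by blast
  have ne: "ws ! i \<noteq> ws ! j" if "i < n" "j < n" "i \<noteq> j" for i j using that ws(1) len nth_eq_iff_index_eq by metis
  have "P (map (\<lambda>i. map (T i) [0..<n]) [0..<n])"
  proof (rule sorted_tournaments_complete)
    show "T j i \<longleftrightarrow> \<not> T i j" if "i < n" "j < n" "i \<noteq> j" for i j
      unfolding T_def using tour_total[OF t wsV[OF that(1)] wsV[OF that(2)] ne[OF that]] .
    show "\<not> T i i" for i unfolding T_def using tour_asym(2)[OF t] by blast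
    show "count_true (map (T i) [0..<n]) \<le> count_true (map (T (Suc i)) [0..<n])" if "Suc i < n" for i
    proof -
      have "map (\<lambda>u. card {x \<in> W. (u,x) \<in> A}) ws ! i \<le> map (\<lambda>u. card {x \<in> W. (u,x) \<in> A}) ws ! Suc i"
        using sorted_nth_mono[OF ws(3), of i "Suc i"] that len by simp
      then show ?thesis unfolding row count_true_card[OF ws(1)] ws(2) using that len by simp
    qed
    show "sorted_tournaments P n 0 (map (\<lambda>i. map (T i) [0..<n]) [0..<0])" using P by simp
  qed simp_all
  moreover have "map (\<lambda>i. map (T i) [0..<n]) [0..<n] = map (\<lambda>u. map (\<lambda>x. (u,x) \<in> A) ws) ws"
    unfolding row using map_nth[of ws] len by (metis (no_types, lifting) map_map comp_def map_eq_conv)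
  ultimately show thesis using that[OF ws(1,2) len] by simp
qed

section \<open>A vertex of score at most one\<close>

lemma specials_square: "list_all (\<lambda>x. length x = 6 \<and> list_all (\<lambda>r. length r = 6) x) specials"
  by code_simp

lemma dominating_order: "distinct [6,0,1,7,2,4,3,5::nat]" "length [6,0,1,7,2,4,3,5::nat] = 8" "\<forall>i\<in>set [6,0,1,7,2,4,3,5::nat]. i < 8"
  by simp_all

text \<open>The vertex \<open>v\<close> goes to the site 7 and its only possible out-neighbour \<open>w\<close> to the site 6. If \<open>v\<close> is a sink, \<open>w\<close>
  is chosen with minimal score.\<close>

lemma low_vertex:
  assumes t: "tour V A" and V: "card V = 8" "v \<in> V" "w \<in> V" "v \<noteq> w" and sink: "\<And>z. (v,z) \<in> A \<Longrightarrow> z = w"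
    and min: "\<And>u. (v,w) \<notin> A \<Longrightarrow> u \<in> V - {v,w} \<Longrightarrow> outdeg A w \<le> outdeg A u"
    and seq: "(v,w) \<in> A \<Longrightarrow> score_list V A \<notin> set obstructed"
  shows "\<exists>ys. layered_listing V A ys"
proof -
  have "card (V - {v,w}) = 6" using V card_Diff_subset[of "{v,w}" V] by simp
  from tournaments_checked[OF t _ this six_classified]
  obtain ws where ws: "distinct ws" "set ws = V - {v,w}" "length ws = 6" and cl: "classified (map (\<lambda>u. map (\<lambda>x. (u,x) \<in> A) ws) ws)"
    by blast
  let ?m = "map (\<lambda>u. map (\<lambda>x. (u,x) \<in> A) ws) ws"
  have perm: "distinct p" "length p = 6" "\<forall>i\<in>set p. i < 6" if "p \<in> set (good_orders @ special_orders @ entry_orders)" for p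
    using orders_are_permutations that unfolding list_all_iff by blast+
  have listed: "distinct (xs @ [w,v])" "set (xs @ [w,v]) = V" "length xs = 6" if "distinct xs" "set xs = V - {v,w}" for xs
  proof -
    show "distinct (xs @ [w,v])" using that V(4) by auto
    show "set (xs @ [w,v]) = V" using that V(2,3) by auto
    show "length xs = 6" using distinct_card[OF that(1)] that(2) \<open>card (V - {v,w}) = 6\<close> by simp
  qed
  from cl consider p where "p \<in> set good_orders" "prism_order (matrix_rel ?m) p"
    | p x where "p \<in> set special_orders" "x \<in> set specials" "matches ?m p x"
    unfolding classified_def list_ex_iff by blast
  then show ?thesis
  proof cases
    case (1 p)
    have p: "distinct p" "length p = 6" "\<forall>i\<in>set p. i < 6" using perm[of p] 1(1) by simp_all
    have "prism_order (\<lambda>i j. (ws ! i, ws ! j) \<in> A) p"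
      using 1(2) prism_order_cong[of p "matrix_rel ?m" "\<lambda>i j. (ws ! i, ws ! j) \<in> A"] p(3) ws(3) by (simp add: matrix_rel_def)
    then have "prism_order (\<lambda>u x. (u,x) \<in> A) (map ((!) ws) p)" unfolding prism_order_map .
    note placed = prism_order_placement[OF this]
    note xs = relisting[OF ws(1,3) p]
    show ?thesis
      by (rule exI, rule placement_listing[OF t listed sink placed]) (use xs ws(2) in simp_all)
  next
    case (2 p x)
    have p: "distinct p" "length p = 6" "\<forall>i\<in>set p. i < 6" using perm[of p] 2(1) by simp_all
    define xs where "xs = map ((!) ws) p"
    have xs: "distinct xs" "set xs = V - {v,w}" using relisting[OF ws(1,3) p] ws(2) unfolding xs_def by simp_all
    note L = listed[OF xs]
    note L' = listed
    have x6: "length x = 6" "\<forall>r\<in>set x. length r = 6" using specials_square 2(2) unfolding list_all_iff by blast+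
    have x: "x = map (\<lambda>u. map (\<lambda>y. (u,y) \<in> A) xs) xs"
    proof (rule nth_equalityI)
      fix k assume k: "k < length x"
      have kp: "k < length p" "length (x ! k) = 6" using k x6 p(2) by simp_all
      show "x ! k = map (\<lambda>u. map (\<lambda>y. (u,y) \<in> A) xs) xs ! k"
      proof (rule nth_equalityI)
        fix l assume l: "l < length (x ! k)"
        then have lp: "l < length p" using kp p(2) by simp
        have "p ! k < length ws" "p ! l < length ws" using kp(1) lp p(3) ws(3) nth_mem by metis+
        then show "x ! k ! l = map (\<lambda>u. map (\<lambda>y. (u,y) \<in> A) xs) xs ! k ! l"
          using matches_iff[OF 2(3) kp(1) lp] kp(1) lp unfolding xs_def by simp
      qed (use kp k L(3) x6 in simp)
    qed (use x6 L(3) in simp)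
    define bs where "bs = map (\<lambda>u. (w,u) \<in> A) xs"
    have bs: "bs \<in> set (List.n_lists 6 [False,True])" unfolding bs_def set_n_lists using L(3) by auto
    have checked: "special_checked x bs" using specials_checked 2(2) bs unfolding list_all_iff by blast
    have xi: "xs ! i \<in> V - {v,w}" if "i < 6" for i using that L(3) xs(2) nth_mem by metis
    have to_v: "(u,v) \<in> A" if "u \<in> V - {v,w}" for u using tour_total[OF t, of v u] sink[of u] that V(2) by blast
    have out: "outdeg A (xs ! i) = count_true (x ! i) + (if bs ! i then 0 else 1) + 1" if i: "i < 6" for i
    proof -
      have "(xs ! i, w) \<in> A \<longleftrightarrow> \<not> bs ! i" using tour_total[OF t, of w "xs ! i"] xi[OF i] V(3) i L(3) unfolding bs_def by auto
      moreover have "x ! i = map (\<lambda>y. (xs ! i,y) \<in> A) xs" unfolding x using i L(3) by simp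
      ultimately show ?thesis unfolding outdeg_listing[OF t L(1,2)] count_true_def using to_v[OF xi[OF i]] by simp
    qed
    have out_w: "outdeg A w = count_true bs + (if (w,v) \<in> A then 1 else 0)"
    proof -
      have "(w,w) \<notin> A" using tour_asym(2)[OF t] by blast
      then show ?thesis unfolding outdeg_listing[OF t L(1,2)] count_true_def bs_def by simp
    qed
    let ?l = "sort (map (\<lambda>i. count_true (x ! i) + (if bs ! i then 0 else 1) + 1) [0..<6] @ [count_true bs, 1])"
    have "(\<exists>q\<in>set entry_orders. placement (matrix_rel x) ((!) bs) q) \<or>
        (\<exists>i\<in>set [0..<6]. count_true (x ! i) + (if bs ! i then 0 else 1) < count_true bs) \<and>
        (?l \<in> set obstructed \<or> x = specials ! 2 \<and> bs = replicate 6 True)"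
      using checked unfolding special_checked_def list_ex_iff .
    then consider (found) "\<exists>q\<in>set entry_orders. placement (matrix_rel x) ((!) bs) q"
      | (excluded) "\<exists>i\<in>set [0..<6]. count_true (x ! i) + (if bs ! i then 0 else 1) < count_true bs"
          "?l \<in> set obstructed \<or> x = specials ! 2 \<and> bs = replicate 6 True"
      by (elim disjE[of "\<exists>q\<in>set entry_orders. placement (matrix_rel x) ((!) bs) q"] conjE)
    then show ?thesis
    proof cases
      case found
      then obtain q where 1: "q \<in> set entry_orders" "placement (matrix_rel x) ((!) bs) q" by blast
      have q: "distinct q" "length q = 6" "\<forall>i\<in>set q. i < 6" using perm[of q] 1(1) by simp_all
      have "placement (\<lambda>i j. (xs ! i, xs ! j) \<in> A) (\<lambda>i. (w, xs ! i) \<in> A) q"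
        using 1(2) placement_cong[of q "matrix_rel x" "\<lambda>i j. (xs ! i, xs ! j) \<in> A" "(!) bs" "\<lambda>i. (w, xs ! i) \<in> A"] q(3) L(3)
        unfolding x bs_def by (simp add: matrix_rel_def)
      then have placed: "placement (\<lambda>u x. (u,x) \<in> A) (\<lambda>u. (w,u) \<in> A) (map ((!) xs) q)" unfolding placement_map .
      note ys = relisting[OF xs(1) L(3) q]
      show ?thesis
        by (rule exI, rule placement_listing[OF t L' sink placed]) (use ys xs(2) in simp_all)
    next
      case excluded
      then obtain i where 2: "i < 6" "count_true (x ! i) + (if bs ! i then 0 else 1) < count_true bs" by auto
      show ?thesis
      proof (cases "(v,w) \<in> A")
        case False
        then have "(w,v) \<in> A" using tour_total[OF t, of v w] V by blast
        then have "outdeg A (xs ! i) < outdeg A w" using out[OF 2(1)] out_w 2(2) by simp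
        then show ?thesis using min[OF False xi[OF 2(1)]] by simp
      next
        case True
        then have wv: "(w,v) \<notin> A" using tour_asym(1)[OF t] by blast
        have "{z. (v,z) \<in> A} = {w}" using True sink by blast
        then have out_v: "outdeg A v = 1" unfolding outdeg_def by simp
        \<comment> \<open>The scores in the whole tournament: everyone but \<open>w\<close> beats \<open>v\<close>.\<close>
        have "map (outdeg A) xs = map (\<lambda>i. count_true (x ! i) + (if bs ! i then 0 else 1) + 1) [0..<6]"
          by (rule nth_equalityI) (use L(3) out in simp_all)
        then have "score_list V A = sort (map (\<lambda>i. count_true (x ! i) + (if bs ! i then 0 else 1) + 1) [0..<6] @ [count_true bs, 1])"
          unfolding score_list_listing[OF L(1,2)] map_append using out_w out_v wv by simp
        with seq[OF True] excluded(2) have wh: "x = specials ! 2" "bs = replicate 6 True" by simp_all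
        have "\<forall>b\<in>set bs. b" unfolding wh(2) by simp
        then have wu: "(w,u) \<in> A" if "u \<in> set xs" for u using that unfolding bs_def by simp
        have uw: "(u,w) \<notin> A" if "u \<in> set xs" for u using tour_asym(1)[OF t wu[OF that]] .
        have uv: "(u,v) \<in> A" if "u \<in> set xs" for u using to_v that unfolding xs(2) .
        have vu: "(v,u) \<notin> A" if "u \<in> set xs" for u using tour_asym(1)[OF t uv[OF that]] .
        have ww: "(w,w) \<notin> A" "(v,v) \<notin> A" using tour_asym(2)[OF t] by blast+
        have "map (\<lambda>u. map (\<lambda>y. (u,y) \<in> A) (xs @ [w,v])) (xs @ [w,v]) =
            map (\<lambda>r. r @ [False, True]) (specials ! 2) @ [replicate 6 True @ [False, False], replicate 6 False @ [True, False]]"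
        proof -
          have "map (\<lambda>u. map (\<lambda>y. (u,y) \<in> A) (xs @ [w,v])) xs = map (\<lambda>r. r @ [False, True]) x"
            unfolding x map_map comp_def by (rule map_cong) (simp_all add: uw uv)
          moreover have "map (\<lambda>y. (w,y) \<in> A) (xs @ [w,v]) = replicate 6 True @ [False, False]"
            using wh(2)[unfolded bs_def] wv ww by simp
          moreover have "map (\<lambda>y. (v,y) \<in> A) (xs @ [w,v]) = replicate 6 False @ [True, False]"
          proof -
            have "map (\<lambda>y. (v,y) \<in> A) xs = map (\<lambda>_. False) xs" by (rule map_cong) (simp_all add: vu)
            then show ?thesis using True ww L(3) by (simp add: map_replicate_const)
          qed
          ultimately show ?thesis unfolding wh(1)[symmetric] map_append by simp
        qed
        with dominating_matches have m: "matches (map (\<lambda>u. map (\<lambda>y. (u,y) \<in> A) (xs @ [w,v])) (xs @ [w,v])) [6,0,1,7,2,4,3,5] dominating"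
          by (simp only:)
        have "length (xs @ [w,v]) = 8" using L(3) by simp
        from matches_listing[OF t L(1,2) this dominating_order m dominating_layered] show ?thesis by blast
      qed
    qed
  qed
qed

section \<open>Score sequence 2,2,2,2,5,5,5,5\<close>

definition two_five_orders :: "nat list list" where
  "two_five_orders = [[3,2,0,1,7,4,5,6], [3,2,0,1,7,5,4,6], [2,3,0,1,7,4,5,6], [2,3,0,1,7,5,4,6], [3,2,1,0,7,4,5,6], [3,2,1,0,7,5,4,6], [2,3,1,0,7,4,5,6], [2,3,1,0,7,5,4,6], [3,1,2,0,4,5,7,6], [3,1,2,0,4,5,6,7], [3,1,2,0,5,4,7,6], [2,3,1,0,5,4,6,7], [3,2,1,0,4,5,7,6], [2,1,3,0,4,5,6,7], [3,2,1,0,5,4,7,6], [2,1,3,0,5,4,6,7], [3,2,0,1,6,4,5,7], [3,2,0,1,4,6,5,7], [3,2,0,1,4,7,5,6], [3,2,0,1,6,5,4,7], [3,2,0,1,5,6,4,7], [3,2,0,1,5,7,4,6], [2,3,0,1,6,4,5,7], [2,3,0,1,4,6,5,7], [2,3,0,1,4,7,5,6], [2,3,0,1,6,5,4,7], [2,3,0,1,5,6,4,7], [2,3,0,1,5,7,4,6], [3,2,1,0,4,6,5,7], [3,2,1,0,6,4,5,7], [3,2,1,0,4,7,5,6], [3,2,1,0,5,6,4,7], [3,2,1,0,6,5,4,7], [3,2,1,0,5,7,4,6], [2,3,1,0,4,6,5,7], [2,3,1,0,6,4,5,7], [2,3,1,0,4,7,5,6], [2,3,1,0,5,6,4,7], [2,3,1,0,6,5,4,7],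 [2,3,1,0,5,7,4,6]]"

lemma two_five_orders_permutations: "list_all (\<lambda>p. distinct p \<and> length p = 8 \<and> list_all (\<lambda>i. i < 8) p) two_five_orders"
  by code_simp

text \<open>The vertices of score 2 are listed first. A row of \<open>ups\<close> contains the arcs from such a vertex to the vertices of score
  5; its sum is determined by the score inside the first block.\<close>

fun up_rows :: "(bool list list \<Rightarrow> bool) \<Rightarrow> bool list list \<Rightarrow> bool list list \<Rightarrow> bool" where
  "up_rows P [] ups \<longleftrightarrow> P ups"
| "up_rows P (r # rs) ups \<longleftrightarrow> list_all (\<lambda>bs. count_true r + count_true bs \<noteq> 2 \<or> up_rows P rs (ups @ [bs])) (List.n_lists 4 [False,True])"

definition two_blocks :: "bool list list \<Rightarrow> bool list list \<Rightarrow> bool list list \<Rightarrow> bool list list" where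
  "two_blocks mb mt ups = map2 (@) mb ups @ map (\<lambda>j. map (\<lambda>r. \<not> r ! j) ups @ mt ! j) [0..<4]"

definition ups_checked :: "bool list list \<Rightarrow> bool list list \<Rightarrow> bool" where
  "ups_checked mb mt \<longleftrightarrow> up_rows (\<lambda>ups.
     list_ex (\<lambda>j. count_true (mt ! j) + count_true (map (\<lambda>r. \<not> r ! j) ups) \<noteq> 5) [0..<4] \<or>
     list_ex (\<lambda>p. list_ex (matches (two_blocks mb mt ups) p) two_five_tournaments) two_five_orders) mb []"

lemma two_five_checked: "sorted_tournaments (\<lambda>mb. sorted_tournaments (ups_checked mb) 4 0 []) 4 0 []"
  by code_simp

lemma up_rows_complete:
  assumes "up_rows P rs ups" "length us = length rs" "\<And>r u. (r,u) \<in> set (zip rs us) \<Longrightarrow> length u = 4 \<and> count_true r + count_true u = 2"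
  shows "P (ups @ us)"
  using assms
proof (induction P rs ups arbitrary: us rule: up_rows.induct)
  case (1 P ups) then show ?case by simp
next
  case (2 P r rs ups)
  then obtain u vs where us: "us = u # vs" by (cases us) auto
  have u: "length u = 4" "count_true r + count_true u = 2" using 2(4)[of r u] unfolding us by simp_all
  have "u \<in> set (List.n_lists 4 [False,True])" unfolding set_n_lists using u(1) by auto
  note un = this
  then have step: "up_rows P rs (ups @ [u])" using 2(2) u(2) unfolding up_rows.simps list_all_iff by blast
  have len: "length vs = length rs" using 2(3) unfolding us by simp
  have el: "length u' = 4 \<and> count_true r' + count_true u' = 2" if "(r',u') \<in> set (zip rs vs)" for r' u'
    using 2(4)[of r' u'] that unfolding us by simp
  from 2(1)[OF un step len el] show ?case unfolding us by simp
qed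

lemma score_class_card:
  assumes "finite V"
  shows "card {u \<in> V. outdeg A u = s} = count_list (score_list V A) s"
proof -
  have "count_list (score_list V A) s = count (image_mset (outdeg A) (mset_set V)) s"
    unfolding score_list_def count_mset[symmetric] by simp
  also have "\<dots> = card {u \<in> V. outdeg A u = s}"
    unfolding count_image_mset using assms by (simp add: Collect_conj_eq Int_commute vimage_def cong: conj_cong)
  finally show ?thesis by simp
qed

lemma two_five:
  assumes t: "tour V A" and S: "score_list V A = [2,2,2,2,5,5,5,5]"
  shows "\<exists>ys. layered_listing V A ys"
proof -
  have fin: "finite V" using t unfolding tour_def by blast
  define B where "B = {u \<in> V. outdeg A u = 2}"
  define H where "H = {u \<in> V. outdeg A u = 5}"
  have card: "card B = 4" "card H = 4" unfolding B_def H_def score_class_card[OF fin] S by simp_all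
  have "set_mset (image_mset (outdeg A) (mset_set V)) = set (score_list V A)"
    unfolding score_list_def by (metis mset_sorted_list_of_multiset set_mset_mset)
  then have "outdeg A ` V = {2,5}" unfolding S using fin by auto
  then have V: "V = B \<union> H" unfolding B_def H_def by auto
  have disj: "B \<inter> H = {}" unfolding B_def H_def by auto
  have "B \<subseteq> V" "H \<subseteq> V" using V by blast+
  from tournaments_checked[OF t this(1) card(1) two_five_checked] obtain bs
    where bs: "distinct bs" "set bs = B" "length bs = 4"
      and cb: "sorted_tournaments (ups_checked (map (\<lambda>u. map (\<lambda>x. (u,x) \<in> A) bs) bs)) 4 0 []" by metis
  from tournaments_checked[OF t \<open>H \<subseteq> V\<close> card(2) cb] obtain hs
    where hs: "distinct hs" "set hs = H" "length hs = 4"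
      and ch: "ups_checked (map (\<lambda>u. map (\<lambda>x. (u,x) \<in> A) bs) bs) (map (\<lambda>u. map (\<lambda>x. (u,x) \<in> A) hs) hs)" by metis
  let ?mb = "map (\<lambda>u. map (\<lambda>x. (u,x) \<in> A) bs) bs" and ?mh = "map (\<lambda>u. map (\<lambda>x. (u,x) \<in> A) hs) hs"
    and ?ups = "map (\<lambda>u. map (\<lambda>x. (u,x) \<in> A) hs) bs"
  have ws: "distinct (bs @ hs)" "set (bs @ hs) = V" "length (bs @ hs) = 8" using bs hs V disj by auto
  have out: "outdeg A u = count_true (map (\<lambda>x. (u,x) \<in> A) bs) + count_true (map (\<lambda>x. (u,x) \<in> A) hs)" for u
    unfolding outdeg_listing[OF t ws(1,2)] count_true_def by simp
  have "length u = 4 \<and> count_true r + count_true u = 2" if ru: "(r,u) \<in> set (zip ?mb ?ups)" for r u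
  proof -
    have "zip ?mb ?ups = map (\<lambda>b. (map (\<lambda>x. (b,x) \<in> A) bs, map (\<lambda>x. (b,x) \<in> A) hs)) bs"
      by (rule nth_equalityI) simp_all
    note Z = this
    obtain b where "b \<in> set bs" "r = map (\<lambda>x. (b,x) \<in> A) bs" "u = map (\<lambda>x. (b,x) \<in> A) hs"
      using ru[unfolded Z] by auto
    moreover from this(1) have "outdeg A b = 2" unfolding bs(2) B_def by simp
    ultimately show ?thesis using out[of b] hs(3) by simp
  qed
  from up_rows_complete[OF ch[unfolded ups_checked_def], of ?ups, simplified, OF this]
  have "list_ex (\<lambda>j. count_true (?mh ! j) + count_true (map (\<lambda>r. \<not> r ! j) ?ups) \<noteq> 5) [0..<4] \<or>
     list_ex (\<lambda>p. list_ex (matches (two_blocks ?mb ?mh ?ups) p) two_five_tournaments) two_five_orders" by simp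
  moreover have col: "map (\<lambda>r. \<not> r ! j) ?ups = map (\<lambda>x. (hs ! j, x) \<in> A) bs" if j: "j < 4" for j
  proof -
    have "(hs ! j, b) \<in> A \<longleftrightarrow> (b, hs ! j) \<notin> A" if b: "b \<in> set bs" for b
    proof (rule tour_total[OF t])
      have "hs ! j \<in> H" using j hs(2,3) nth_mem by metis
      then show "b \<in> V" "hs ! j \<in> V" "b \<noteq> hs ! j" using b bs(2) V disj by auto
    qed
    then show ?thesis using j hs(3) by simp
  qed
  moreover have "count_true (?mh ! j) + count_true (map (\<lambda>r. \<not> r ! j) ?ups) = 5" if j: "j < 4" for j
  proof -
    have "hs ! j \<in> H" using j hs(2,3) nth_mem by metis
    then have "outdeg A (hs ! j) = 5" unfolding H_def by simp
    then show ?thesis unfolding col[OF j] using out[of "hs ! j"] j hs(3) by simp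
  qed
  ultimately obtain p m where p: "p \<in> set two_five_orders" and m: "m \<in> set two_five_tournaments" "matches (two_blocks ?mb ?mh ?ups) p m"
    unfolding list_ex_iff by auto
  have "two_blocks ?mb ?mh ?ups = map (\<lambda>u. map (\<lambda>x. (u,x) \<in> A) (bs @ hs)) (bs @ hs)"
  proof -
    have "map2 (@) ?mb ?ups = map (\<lambda>u. map (\<lambda>x. (u,x) \<in> A) (bs @ hs)) bs"
      by (rule nth_equalityI) simp_all
    moreover have "map (\<lambda>j. map (\<lambda>r. \<not> r ! j) ?ups @ ?mh ! j) [0..<4] = map (\<lambda>u. map (\<lambda>x. (u,x) \<in> A) (bs @ hs)) hs"
    proof (rule nth_equalityI)
      fix j assume "j < length (map (\<lambda>j. map (\<lambda>r. \<not> r ! j) ?ups @ ?mh ! j) [0..<4])"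
      then have "j < 4" by simp
      then show "map (\<lambda>j. map (\<lambda>r. \<not> r ! j) ?ups @ ?mh ! j) [0..<4] ! j = map (\<lambda>u. map (\<lambda>x. (u,x) \<in> A) (bs @ hs)) hs ! j"
        using col[of j] hs(3) by simp
    qed (use hs(3) in simp)
    ultimately show ?thesis unfolding two_blocks_def by simp
  qed
  then have m': "matches (map (\<lambda>u. map (\<lambda>x. (u,x) \<in> A) (bs @ hs)) (bs @ hs)) p m" using m(2) by (simp only:)
  have p': "distinct p" "length p = 8" "\<forall>i\<in>set p. i < 8"
    using two_five_orders_permutations p unfolding list_all_iff by blast+
  have "layered_check (matrix_rel m)" using two_five_layered m(1) unfolding list_all_iff by blast
  from matches_listing[OF t ws p' m' this] show ?thesis by blast
qed

section \<open>Reversal\<close>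

lemma links_rev: "links (rev ys) = rev (map prod.swap (links ys))"
proof (induction ys rule: induct_list012)
  case (3 u v xs)
  have "links (rev (u # v # xs)) = links (rev xs @ [v, u])" by simp
  then show ?case using 3 by (simp add: links_snoc)
qed auto

lemma cyc_arcs_rev: "xs \<noteq> [] \<Longrightarrow> set (cyc_arcs (rev xs)) = (set (cyc_arcs xs))\<inverse>"
proof -
  assume xs: "xs \<noteq> []"
  then obtain ys l where l: "xs = ys @ [l]" by (metis rev_exhaust)
  have "cyc_arcs (rev xs) = links (rev (l # xs))" unfolding cyc_arcs_def l by simp
  then have "set (cyc_arcs (rev xs)) = prod.swap ` set (links (l # xs))" unfolding links_rev by simp
  also have "links (l # xs) = cyc_arcs (l # ys)" unfolding cyc_arcs_def l by simp
  also have "set (cyc_arcs (l # ys)) = set (cyc_arcs xs)" using cyc_arcs_rotate1[of "l # ys"] l by simp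
  finally show ?thesis by auto
qed

text \<open>Being above does not depend on the orientation of edges.\<close>

lemma layered_converse:
  assumes "layered R"
  shows "layered (R\<inverse>)"
proof -
  have d: "dcycle R (rev C)" if "dcycle (R\<inverse>) C" for C
    using that cyc_arcs_rev[of C] unfolding dcycle_def by auto
  have o: "over_cycle C D" if o: "over_cycle (rev C) (rev D)" and C: "dcycle (R\<inverse>) C" and D: "dcycle (R\<inverse>) D" for C D
    unfolding over_cycle_def
  proof (intro ballI)
    fix e f assume e: "e \<in> set (cyc_arcs C)" and f: "f \<in> set (cyc_arcs D)"
    obtain i j k l where ef: "e = (i,j)" "f = (k,l)" by (cases e; cases f) auto
    have "(j,i) \<in> set (cyc_arcs (rev C))" "(l,k) \<in> set (cyc_arcs (rev D))"
      using e f cyc_arcs_rev[of C] cyc_arcs_rev[of D] C D unfolding ef dcycle_def by simp_all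
    then have "above (j,i) (l,k)" using o unfolding over_cycle_def by blast
    then show "above e f" unfolding ef above_swap(1)[of j i] above_swap(2)[of _ l k] .
  qed
  show ?thesis
    unfolding layered_def
  proof (intro allI impI)
    fix C D assume C: "dcycle (R\<inverse>) C" and D: "dcycle (R\<inverse>) D" and "set C \<inter> set D = {}"
    then have "set (rev C) \<inter> set (rev D) = {}" by simp
    then have "over_cycle (rev C) (rev D) \<or> over_cycle (rev D) (rev C)"
      using assms d[OF C] d[OF D] unfolding layered_def by blast
    then show "over_cycle C D \<or> over_cycle D C" using o C D by blast
  qed
qed

lemma tour_converse: "tour V A \<Longrightarrow> tour V (A\<inverse>)"
  unfolding tour_def by blast

lemma layered_listing_converse:
  assumes "layered_listing V (A\<inverse>) ys"
  shows "layered_listing V A ys"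
proof -
  let ?R = "\<lambda>A. {(i,j). i < 8 \<and> j < 8 \<and> (ys ! i, ys ! j) \<in> A}"
  note L = assms[unfolded layered_listing_def]
  note ys = L[THEN conjunct1] L[THEN conjunct2, THEN conjunct1] L[THEN conjunct2, THEN conjunct2, THEN conjunct1]
    and l = L[THEN conjunct2, THEN conjunct2, THEN conjunct2]
  have eq: "(?R (A\<inverse>))\<inverse> = ?R A" by auto
  show ?thesis unfolding layered_listing_def by (intro conjI ys layered_converse[OF l, unfolded eq])
qed

lemma outdeg_converse:
  assumes t: "tour V A" and V: "u \<in> V"
  shows "outdeg (A\<inverse>) u = card V - 1 - outdeg A u" "outdeg A u \<le> card V - 1"
proof -
  have fin: "finite V" and sub: "A \<subseteq> V \<times> V" using t unfolding tour_def by blast+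
  have "{x. (u,x) \<in> A\<inverse>} = V - {u} - {x. (u,x) \<in> A}" (is "?I = V - {u} - ?O")
  proof (rule set_eqI)
    fix x show "x \<in> ?I \<longleftrightarrow> x \<in> V - {u} - ?O"
      using tour_total[OF t V, of x] tour_asym[OF t, of x u] tour_asym(2)[OF t, of u u] by auto
  qed
  moreover have O: "?O \<subseteq> V - {u}" using sub tour_asym(2)[OF t, of u u] by auto
  moreover have "card (V - {u}) = card V - 1" using V fin by simp
  ultimately show "outdeg (A\<inverse>) u = card V - 1 - outdeg A u"
    unfolding outdeg_def using card_Diff_subset[of ?O "V - {u}"] finite_subset[OF O] fin by simp
  show "outdeg A u \<le> card V - 1"
    unfolding outdeg_def using card_mono[OF _ O] fin V by simp
qed

lemma score_list_converse:
  assumes t: "tour V A" and c: "card V = 8"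
  shows "score_list V (A\<inverse>) = rev (map (\<lambda>s. 7 - s) (score_list V A))"
proof -
  have fin: "finite V" using t unfolding tour_def by blast
  let ?l = "rev (map (\<lambda>s. 7 - s) (score_list V A))"
  have "sorted (score_list V A)" unfolding score_list_def by simp
  then have "sorted ?l" unfolding sorted_wrt_rev sorted_wrt_map by (auto elim: sorted_wrt_mono_rel[rotated])
  moreover have "mset ?l = image_mset (outdeg (A\<inverse>)) (mset_set V)"
  proof -
    have "mset ?l = image_mset (\<lambda>u. 7 - outdeg A u) (mset_set V)" unfolding score_list_def by (simp add: multiset.map_comp comp_def)
    also have "\<dots> = image_mset (outdeg (A\<inverse>)) (mset_set V)"
      by (rule image_mset_cong) (use outdeg_converse[OF t] c fin in simp)
    finally show ?thesis .
  qed
  ultimately show ?thesis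
    unfolding score_list_def[of V "A\<inverse>"] using sorted_list_of_multiset_mset[of ?l] sorted_sort_id[of ?l] by simp
qed

section \<open>Linkless score sequences\<close>

lemma score_attained:
  assumes "tour V A" "s \<in> set (score_list V A)"
  obtains v where "v \<in> V" "outdeg A v = s"
proof -
  have fin: "finite V" using assms(1) unfolding tour_def by blast
  have "set (score_list V A) = set_mset (mset (score_list V A))" by (rule set_mset_mset[symmetric])
  also have "\<dots> = outdeg A ` V" unfolding score_list_def using fin by simp
  finally have "s \<in> outdeg A ` V" using assms(2) by blast
  then show thesis using that by blast
qed

text \<open>For a vertex of score 1 its out-neighbour is the second high vertex; for a sink, any vertex of minimal score among
  the others.\<close>

lemma low_score:
  assumes t: "tour V A" and c: "card V = 8" and s: "s \<in> set (score_list V A)" "s \<le> 1" and S: "score_list V A \<notin> set obstructed"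
  shows "\<exists>ys. layered_listing V A ys"
proof -
  have fin: "finite V" using t unfolding tour_def by blast
  obtain v where v: "v \<in> V" "outdeg A v = s" using score_attained[OF t s(1)] by blast
  have "finite {x. (v,x) \<in> A}" by (rule finite_subset[OF _ fin]) (use tour_asym[OF t] in blast)
  note finO = this
  consider "s = 0" | "s = 1" using s(2) by linarith
  then show ?thesis
  proof cases
    case 1
    then have none: "(v,z) \<notin> A" for z using v(2) finO unfolding outdeg_def by auto
    have "card (V - {v}) = 7" using c v(1) fin by simp
    then have "V - {v} \<noteq> {}" by (intro notI) simp
    note arg_min_if_finite[OF finite_Diff[OF fin] this, of "outdeg A"]
    then obtain w where w: "w \<in> V - {v}" "\<And>u. u \<in> V - {v} \<Longrightarrow> outdeg A w \<le> outdeg A u"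
      by (metis not_less)
    show ?thesis 
    proof (rule low_vertex[OF t c v(1)])
      show "w \<in> V" "v \<noteq> w" using w(1) by auto
      show "outdeg A w \<le> outdeg A u" if "u \<in> V - {v,w}" for u by (rule w(2)) (use that in blast)
    qed (use none in blast)+
  next
    case 2
    then obtain w where w: "{x. (v,x) \<in> A} = {w}" using v(2) unfolding outdeg_def by (metis card_1_singletonE)
    then have "(v,w) \<in> A" by blast
    note vw = tour_asym[OF t this]
    show ?thesis 
    proof (rule low_vertex[OF t c v(1) vw(4,2)])
      show "z = w" if "(v,z) \<in> A" for z using that w by blast
    qed (use \<open>(v,w) \<in> A\<close> S in blast)+
  qed
qed

text \<open>Scores at least 6 are reduced to scores at most 1 by reversing all arcs.\<close>

definition unobstructed :: "nat list \<Rightarrow> bool" where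
  "unobstructed S \<longleftrightarrow> list_ex (\<lambda>s. s \<le> 1) S \<and> S \<notin> set obstructed \<or>
     list_ex (\<lambda>s. 6 \<le> s) S \<and> rev (map (\<lambda>s. 7 - s) S) \<notin> set obstructed \<or> S = [2,2,2,2,5,5,5,5]"

lemma unobstructed_layered:
  assumes t: "tour V A" and c: "card V = 8" and S: "unobstructed (score_list V A)"
  shows "\<exists>ys. layered_listing V A ys"
proof -
  from S consider s where "s \<in> set (score_list V A)" "s \<le> 1" "score_list V A \<notin> set obstructed"
    | s where "s \<in> set (score_list V A)" "6 \<le> s" "rev (map (\<lambda>s. 7 - s) (score_list V A)) \<notin> set obstructed"
    | "score_list V A = [2,2,2,2,5,5,5,5]"
    unfolding unobstructed_def list_ex_iff by blast
  then show ?thesis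
  proof cases
    case 1 then show ?thesis by (rule low_score[OF t c])
  next
    case (2 s)
    have "7 - s \<in> set (score_list V (A\<inverse>))" unfolding score_list_converse[OF t c] using 2(1) by auto
    from low_score[OF tour_converse[OF t] c this] have "\<exists>ys. layered_listing V (A\<inverse>) ys"
      using 2(2,3) unfolding score_list_converse[OF t c] by simp
    then show ?thesis using layered_listing_converse by blast
  next
    case 3 then show ?thesis by (rule two_five[OF t])
  qed
qed

lemma tournament_tour:
  assumes "tournament (G :: nat pair_pre_digraph)"
  shows "tour (pverts G) (parcs G)" "score_sequence G = score_list (pverts G) (parcs G)"
proof -
  interpret tournament G by (rule assms)
  show "tour (pverts G) (parcs G)"
    unfolding tour_def
  proof (intro conjI ballI impI)
    show "finite (pverts G)" by simp
    show "parcs G \<subseteq> pverts G \<times> pverts G" using arc_fst_in_verts arc_snd_in_verts by fastforce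
    show "(u,u) \<notin> parcs G" for u using no_loops[of "(u,u)"] by auto
    show "((u,v) \<in> parcs G) \<noteq> ((v,u) \<in> parcs G)" if "u \<in> pverts G" "v \<in> pverts G" "u \<noteq> v" for u v
      by (rule exactly_one_arc[OF that])
  qed
  have "out_degree (with_proj G) = outdeg (parcs G)"
  proof
    fix u
    have "out_arcs (with_proj G) u = Pair u ` {x. (u,x) \<in> parcs G}" unfolding out_arcs_def by auto
    then show "out_degree (with_proj G) u = outdeg (parcs G) u" unfolding out_degree_def outdeg_def by (simp add: card_image inj_on_def)
  qed
  then show "score_sequence G = score_list (pverts G) (parcs G)" unfolding score_sequence_def score_list_def by simp
qed

lemma length_score_list: "length (score_list V A) = card V"
proof -
  have "length (score_list V A) = size (mset (score_list V A))" by (rule size_mset[symmetric])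
  then show ?thesis unfolding score_list_def by simp
qed

theorem unobstructed_linkless:
  assumes "unobstructed S" "length S = 8"
  shows "linkless S"
  unfolding linkless_def
proof (intro allI impI, elim conjE)
  fix G :: "nat pair_pre_digraph" assume G: "tournament G" and S: "score_sequence G = S"
  note t = tournament_tour[OF G]
  have "card (pverts G) = 8" using S t(2) length_score_list assms(2) by metis
  then obtain ys where ys: "layered_listing (pverts G) (parcs G) ys"
    using unobstructed_layered[OF t(1)] assms(1) S t(2) by metis
  then have d: "distinct ys" "set ys = pverts G" "length ys = 8"
    and lay: "layered {(i,j). i < 8 \<and> j < 8 \<and> (ys ! i, ys ! j) \<in> parcs G}" unfolding layered_listing_def by blast+
  define lab where "lab = the_inv_into {0..<8} ((!) ys)"
  have inj: "inj_on ((!) ys) {0..<8}" using d by (auto simp: inj_on_def nth_eq_iff_index_eq)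
  have img: "(!) ys ` {0..<8} = pverts G" using d(2,3) nth_image[of 8 ys] by simp
  have lab: "lab u < 8" "ys ! lab u = u" if "u \<in> pverts G" for u
    using the_inv_into_into[OF inj, of u "{0..<8}"] f_the_inv_into_f[OF inj, of u] that img unfolding lab_def by auto
  show "\<exists>f \<gamma>. tame_embedding_S3 (with_proj G) f \<gamma> \<and> \<not> contains_nonsplit_oriented_link (with_proj G) \<gamma>"
  proof (rule layered_embedding[OF G])
    show "inj_on lab (pverts G)" using lab(2) by (metis inj_onI)
    show "lab ` pverts G \<subseteq> {0..<8}" using lab(1) by auto
    have "map_prod lab lab ` parcs G \<subseteq> {(i,j). i < 8 \<and> j < 8 \<and> (ys ! i, ys ! j) \<in> parcs G}"
      using lab tour_asym(3,4)[OF t(1)] by auto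
    then show "layered (map_prod lab lab ` parcs G)"
      using lay unfolding layered_def dcycle_def by (meson order_trans)
  qed
qed

section \<open>Tournaments given by arc lists\<close>

definition arc_list_graph :: "(nat \<times> nat) list \<Rightarrow> nat pair_pre_digraph" where
  "arc_list_graph es = \<lparr>pverts = {0..<8}, parcs = set es\<rparr>"

text \<open>Twenty-eight arcs with distinct underlying edges exhaust the edges of the complete graph on eight vertices.\<close>

definition orients_K8 :: "(nat \<times> nat) list \<Rightarrow> bool" where
  "orients_K8 es \<longleftrightarrow> length es = 28 \<and> list_all (\<lambda>(i,j). i < 8 \<and> j < 8 \<and> i \<noteq> j) es \<and>
     distinct (map (\<lambda>(i,j). (min i j, max i j)) es)"

definition arc_scores :: "(nat \<times> nat) list \<Rightarrow> nat list" where
  "arc_scores es = sort (map (\<lambda>i. length (filter (\<lambda>e. fst e = i) es)) [0..<8])"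

lemma arc_list_tournament:
  assumes "orients_K8 es"
  shows "tournament (arc_list_graph es)" "score_sequence (arc_list_graph es) = arc_scores es"
proof -
  let ?n = "\<lambda>(i,j). (min i j, max i j) :: nat \<times> nat"
  let ?P = "set (concat (map (\<lambda>j. map (\<lambda>i. (i,j)) [0..<j]) [0..<8]))"
  have bounds: "i < 8 \<and> j < 8 \<and> i \<noteq> j" if "(i,j) \<in> set es" for i j
    using assms that unfolding orients_K8_def list_all_iff by blast
  have inj: "inj_on ?n (set es)" and dist: "distinct es" and len: "length es = 28"
    using assms unfolding orients_K8_def distinct_map by blast+
  have pairs: "(i,j) \<in> ?P \<longleftrightarrow> i < j \<and> j < 8" for i j by (auto simp: image_iff)
  have "card (?n ` set es) = 28" using card_image[OF inj] distinct_card[OF dist] len by simp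
  moreover have "card ?P \<le> 28" by (rule order_trans[OF card_length]) (simp add: length_concat upt_rec)
  moreover have "?n ` set es \<subseteq> ?P"
  proof
    fix e assume "e \<in> ?n ` set es"
    then obtain i j where "(i,j) \<in> set es" "e = (min i j, max i j)" by auto
    then show "e \<in> ?P" unfolding \<open>e = _\<close> pairs using bounds[of i j] by auto
  qed
  ultimately have all: "?n ` set es = ?P" by (intro card_seteq) simp_all
  have one: "((i,j) \<in> set es) \<noteq> ((j,i) \<in> set es)" if ij: "i < 8" "j < i" for i j
  proof -
    have "(j,i) \<in> ?n ` set es" unfolding all pairs using ij by simp
    then obtain a b where "(a,b) \<in> set es" "min a b = j" "max a b = i" by auto
    then have "(i,j) \<in> set es \<or> (j,i) \<in> set es" by (auto simp: min_def max_def split: if_splits)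
    moreover have "\<not> ((i,j) \<in> set es \<and> (j,i) \<in> set es)"
      using inj_onD[OF inj, of "(i,j)" "(j,i)"] ij by auto
    ultimately show ?thesis by blast
  qed
  show T: "tournament (arc_list_graph es)"
  proof unfold_locales
    show "fst e \<in> pverts (arc_list_graph es)" "snd e \<in> pverts (arc_list_graph es)" if "e \<in> parcs (arc_list_graph es)" for e
      using bounds[of "fst e" "snd e"] that unfolding arc_list_graph_def by simp_all
    show "fst e \<noteq> snd e" if "e \<in> parcs (arc_list_graph es)" for e
      using bounds[of "fst e" "snd e"] that unfolding arc_list_graph_def by simp
    show "finite (pverts (arc_list_graph es))" "finite (parcs (arc_list_graph es))" unfolding arc_list_graph_def by simp_all
    show "((u,v) \<in> parcs (arc_list_graph es)) \<noteq> ((v,u) \<in> parcs (arc_list_graph es))"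
      if "u \<in> pverts (arc_list_graph es)" "v \<in> pverts (arc_list_graph es)" "u \<noteq> v" for u v
      using one[of u v] one[of v u] that unfolding arc_list_graph_def by (cases "u < v") auto
  qed
  have "outdeg (set es) i = length (filter (\<lambda>e. fst e = i) es)" for i
  proof -
    have "set (filter (\<lambda>e. fst e = i) es) = Pair i ` {x. (i,x) \<in> set es}" by force
    then show ?thesis unfolding outdeg_def using distinct_card[OF distinct_filter[OF dist], of "\<lambda>e. fst e = i"]
      by (simp add: card_image inj_on_def)
  qed
  then have "outdeg (set es) = (\<lambda>i. length (filter (\<lambda>e. fst e = i) es))" by (rule ext)
  then show "score_sequence (arc_list_graph es) = arc_scores es"
    unfolding tournament_tour(2)[OF T] arc_scores_def
    by (subst score_list_listing[of "[0..<8]"]) (simp_all add: arc_list_graph_def)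
qed

section \<open>Intrinsically linked representatives\<close>

text \<open>The three families of pairs of cycles were found by linear algebra over the field with two elements.
  Each uses 23 arcs; the five remaining edges may be oriented arbitrarily, which is how three families suffice for
  fifteen score sequences.\<close>

definition links_a :: "(nat list \<times> nat list) list" where
  "links_a = [([0,7,4,5],[1,3,2]), ([0,7,4,6,5],[1,3,2]), ([0,7,5],[1,3,2]), ([0,7,5,1],[2,4,6,3]), ([0,7,5,1,3],[2,4,6]), ([0,7,5,2],[1,3,4,6]), ([0,7,5,2,1],[3,4,6]), ([0,7,5,3],[1,4,6,2]), ([0,7,5,3,2],[1,4,6]), ([0,7,6,1],[2,4,5,3]), ([0,7,6,1,3],[2,4,5]), ([0,7,6,2],[1,3,4,5]), ([0,7,6,2,1],[3,4,5]), ([0,7,6,3],[1,4,5,2]), ([0,7,6,3,2],[1,4,5]), ([0,7,6,5],[1,3,2])]"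

definition links_b :: "(nat list \<times> nat list) list" where
  "links_b = [([0,7,2],[4,6,5]), ([0,7,2,1],[4,6,5]), ([0,7,2,1,3],[4,6,5]), ([0,7,2,3],[4,6,5]), ([0,7,4,1],[2,3,6,5]), ([0,7,4,2],[1,3,6,5]), ([0,7,4,6,1],[2,3,5]), ([0,7,4,6,2],[1,3,5]), ([0,7,5,1],[2,3,4,6]), ([0,7,5,2],[1,3,4,6]), ([0,7,5,4,1],[2,3,6]), ([0,7,5,4,2],[1,3,6]), ([0,7,6,1],[2,3,5,4]), ([0,7,6,2],[1,3,5,4]), ([0,7,6,5,1],[2,3,4]), ([0,7,6,5,2],[1,3,4])]"

definition links_c :: "(nat list \<times> nat list) list" where
  "links_c = [([0,6,2],[3,5,4]), ([0,6,2,1],[3,5,4]), ([0,6,3,1],[2,7,5,4]), ([0,6,3,2],[1,7,5,4]), ([0,6,3,5,1],[2,7,4]), ([0,6,3,5,2],[1,7,4]), ([0,6,4,1],[2,7,3,5]), ([0,6,4,2],[1,7,3,5]), ([0,6,4,3,1],[2,7,5]), ([0,6,4,3,2],[1,7,5]), ([0,6,5,1],[2,7,4,3]), ([0,6,5,2],[1,7,4,3]), ([0,6,5,4,1],[2,7,3]), ([0,6,5,4,2],[1,7,3]), ([1,7,6,2],[3,5,4]), ([2,7,6],[3,5,4])]"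

definition disjoint_cycles :: "nat list \<times> nat list \<Rightarrow> bool" where
  "disjoint_cycles p \<longleftrightarrow> fst p \<noteq> [] \<and> snd p \<noteq> [] \<and> distinct (fst p @ snd p)"

definition arcs_a :: "(nat \<times> nat) list" where
  "arcs_a = [(0,7),(1,0),(1,3),(1,4),(2,0),(2,1),(2,4),(3,0),(3,2),(3,4),(4,5),(4,6),(5,0),(5,1),(5,2),(5,3),(6,1),(6,2),(6,3),(6,5),(7,4),(7,5),(7,6)]"

definition arcs_b :: "(nat \<times> nat) list" where
  "arcs_b = [(0,7),(1,0),(1,3),(2,0),(2,1),(2,3),(3,0),(3,4),(3,5),(3,6),(4,1),(4,2),(4,6),(5,1),(5,2),(5,4),(6,1),(6,2),(6,5),(7,2),(7,4),(7,5),(7,6)]"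

definition arcs_c :: "(nat \<times> nat) list" where
  "arcs_c = [(0,6),(1,0),(1,7),(2,0),(2,1),(2,7),(3,1),(3,2),(3,5),(4,1),(4,2),(4,3),(5,1),(5,2),(5,4),(6,2),(6,3),(6,4),(6,5),(7,3),(7,4),(7,5),(7,6)]"

definition certificate :: "(nat list \<times> nat list) list \<Rightarrow> (nat \<times> nat) list \<Rightarrow> bool" where
  "certificate P es \<longleftrightarrow> odd_certificate P \<and> list_all disjoint_cycles P \<and>
     list_all (\<lambda>(C,D). list_all (\<lambda>e. e \<in> set es) (cyc_arcs C @ cyc_arcs D)) P"

lemma certificates: "certificate links_a arcs_a" "certificate links_b arcs_b" "certificate links_c arcs_c"
  by code_simp+

definition linked_instances :: "((nat list \<times> nat list) list \<times> (nat \<times> nat) list \<times> (nat \<times> nat) list \<times> nat list) list" where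
  "linked_instances =
    [(links_b, arcs_b, [(4,0),(5,0),(6,0),(7,1),(7,3)], [1,2,3,4,4,4,4,6]),
     (links_b, arcs_b, [(4,0),(5,0),(6,0),(7,1),(3,7)], [1,2,3,4,4,4,5,5]),
     (links_a, arcs_a, [(4,0),(6,0),(7,1),(7,2),(7,3)], [1,3,3,3,3,4,5,6]),
     (links_a, arcs_a, [(4,0),(6,0),(7,1),(7,2),(3,7)], [1,3,3,3,4,4,5,5]),
     (links_b, arcs_b, [(4,0),(5,0),(6,0),(1,7),(7,3)], [1,3,3,4,4,4,4,5]),
     (links_a, arcs_a, [(0,4),(6,0),(7,1),(7,2),(7,3)], [2,2,3,3,3,4,5,6]),
     (links_b, arcs_b, [(4,0),(5,0),(0,6),(7,1),(7,3)], [2,2,3,3,4,4,4,6]),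
     (links_b, arcs_b, [(4,0),(5,0),(0,6),(7,1),(3,7)], [2,2,3,3,4,4,5,5]),
     (links_a, arcs_a, [(0,4),(6,0),(7,1),(2,7),(3,7)], [2,2,3,4,4,4,4,5]),
     (links_b, arcs_b, [(4,0),(0,5),(0,6),(7,1),(7,3)], [2,3,3,3,3,4,4,6]),
     (links_b, arcs_b, [(4,0),(0,5),(0,6),(7,1),(3,7)], [2,3,3,3,3,4,5,5]),
     (links_b, arcs_b, [(4,0),(5,0),(0,6),(1,7),(7,3)], [2,3,3,3,4,4,4,5]),
     (links_a, arcs_a, [(4,0),(0,6),(7,1),(2,7),(3,7)], [2,3,3,4,4,4,4,4]),
     (links_b, arcs_b, [(4,0),(0,5),(0,6),(1,7),(7,3)], [3,3,3,3,3,4,4,5]),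
     (links_c, arcs_c, [(3,0),(4,0),(0,5),(0,7),(1,6)], [3,3,3,3,4,4,4,4])]"

lemma instances_checked: "list_all (\<lambda>(P,es,fs,S). orients_K8 (es @ fs) \<and> arc_scores (es @ fs) = S) linked_instances"
  by code_simp

lemma linked_representative:
  assumes I: "(P,es,fs,S) \<in> set linked_instances"
  shows "has_intrinsically_linked_representative S"
proof -
  have "list_all (\<lambda>(P,es,fs,S). certificate P es) linked_instances" unfolding linked_instances_def using certificates by simp
  then have "certificate P es" using I unfolding list_all_iff by fast
  then have P: "odd_certificate P" "\<And>C D. (C,D) \<in> set P \<Longrightarrow> disjoint_cycles (C,D)"
    "\<And>C D. (C,D) \<in> set P \<Longrightarrow> set (cyc_arcs C) \<subseteq> set es \<and> set (cyc_arcs D) \<subseteq> set es"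
    unfolding certificate_def list_all_iff by auto
  have chk: "orients_K8 (es @ fs)" "arc_scores (es @ fs) = S"
    using instances_checked I unfolding list_all_iff by fast+
  let ?G = "arc_list_graph (es @ fs)"
  note T = arc_list_tournament[OF chk(1)]
  interpret tournament ?G by (rule T(1))
  have "intrinsically_linked_digraph (with_proj ?G)"
  proof (rule certificate_intrinsically_linked[OF _ P(1)])
    show "pair_wf_digraph ?G" by unfold_locales
    fix C D assume CD: "(C,D) \<in> set P"
    have "set (cyc_arcs C) \<subseteq> parcs ?G" "set (cyc_arcs D) \<subseteq> parcs ?G" using P(3)[OF CD] unfolding arc_list_graph_def by auto
    moreover note P(2)[OF CD]
    ultimately show "C \<noteq> [] \<and> D \<noteq> [] \<and> set C \<inter> set D = {} \<and> distinct C \<and> distinct D \<and>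
      set (cyc_arcs C) \<subseteq> parcs ?G \<and> set (cyc_arcs D) \<subseteq> parcs ?G"
      unfolding disjoint_cycles_def by simp
  qed
  then show ?thesis unfolding has_intrinsically_linked_representative_def using T chk(2) by blast
qed

section \<open>The score sequences on eight vertices\<close>

text \<open>Non-decreasing lists whose prefix sums reach the thresholds \<open>ts\<close> (Landau's condition) and whose total is
  \<open>N\<close>. The bound from above prunes the search: all later entries are at least \<open>s\<close>.\<close>

fun landau_lists :: "nat \<Rightarrow> nat list \<Rightarrow> nat \<Rightarrow> nat \<Rightarrow> nat list list" where
  "landau_lists N [] p m = [[]]"
| "landau_lists N (t # ts) p m = concat (map (\<lambda>s. if p + s < t \<or> N < p + s * Suc (length ts) then []
     else map ((#) s) (landau_lists N ts (p + s) s)) [m..<8])"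

definition landau8 :: "nat list list" where
  "landau8 = landau_lists 28 [0,1,3,6,10,15,21,28] 0 0"

lemma landau_lists_complete:
  assumes "length xs = length ts" "sorted xs" "\<forall>x\<in>set xs. m \<le> x \<and> x < 8"
    and "\<And>j. j < length ts \<Longrightarrow> ts ! j \<le> p + sum_list (take (Suc j) xs)" "p + sum_list xs = N"
  shows "xs \<in> set (landau_lists N ts p m)"
  using assms
proof (induction ts arbitrary: xs p m)
  case (Cons t ts)
  obtain x ys where xs: "xs = x # ys" using Cons.prems(1) by (cases xs) auto
  have ge: "t \<le> p + x" using Cons.prems(4)[of 0] unfolding xs by simp
  have "x * length ys \<le> sum_list ys" if "\<forall>y\<in>set ys. x \<le> y" for ys using that by (induction ys) auto
  then have le: "p + x * Suc (length ts) \<le> N" using Cons.prems(1,2,5) unfolding xs by force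
  have "ys \<in> set (landau_lists N ts (p + x) x)"
  proof (rule Cons.IH)
    show "length ys = length ts" "sorted ys" "\<forall>y\<in>set ys. x \<le> y \<and> y < 8" using Cons.prems(1-3) unfolding xs by auto
    show "ts ! j \<le> p + x + sum_list (take (Suc j) ys)" if "j < length ts" for j
      using Cons.prems(4)[of "Suc j"] that unfolding xs by (simp add: add.assoc)
    show "p + x + sum_list ys = N" using Cons.prems(5) unfolding xs by (simp add: add.assoc)
  qed
  moreover have "x \<in> set [m..<8]" using Cons.prems(3) unfolding xs by simp
  moreover have "\<not> (p + x < t \<or> N < p + x * Suc (length ts))" using ge le by simp
  ultimately show ?case unfolding xs landau_lists.simps by (auto simp del: set_upt intro!: bexI[of _ x])
qed simp

lemma landau_lists_distinct: "distinct (landau_lists N ts p m)"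
proof (induction ts arbitrary: p m)
  case (Cons t ts)
  let ?f = "\<lambda>s. if p + s < t \<or> N < p + s * Suc (length ts) then [] else map ((#) s) (landau_lists N ts (p + s) s)"
  have "distinct (concat (map ?f xs))" if "distinct xs" for xs
    using that by (induction xs) (auto simp: distinct_map Cons.IH)
  from this[of "[m..<8]"] show ?case by simp
qed simp

text \<open>Landau's condition is necessary, since the arcs inside a set of vertices already contribute that much to its scores.\<close>

lemma inner_arcs:
  assumes t: "tour V A" and U: "U \<subseteq> V"
  shows "(\<Sum>u\<in>U. card {x \<in> U. (u,x) \<in> A}) = card U choose 2"
proof -
  have "finite V" using t unfolding tour_def by blast
  then have "finite U" using U by (rule finite_subset[rotated])
  then show ?thesis using U
  proof (induction U)
    case (insert w U)
    have wV: "w \<in> V" "U \<subseteq> V" using insert.prems by auto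
    have ww: "(w,w) \<notin> A" using tour_asym(2)[OF t] by blast
    have "card {x \<in> insert w U. (u,x) \<in> A} = card {x \<in> U. (u,x) \<in> A} + of_bool ((u,w) \<in> A)" if "u \<in> U" for u
    proof -
      have "{x \<in> insert w U. (u,x) \<in> A} = {x \<in> U. (u,x) \<in> A} \<union> (if (u,w) \<in> A then {w} else {})" by auto
      then show ?thesis using insert.hyps by (simp add: card_insert_if)
    qed
    moreover have "{x \<in> insert w U. (w,x) \<in> A} = {x \<in> U. (w,x) \<in> A}" using ww by auto
    ultimately have "(\<Sum>u\<in>insert w U. card {x \<in> insert w U. (u,x) \<in> A}) =
        card {x \<in> U. (w,x) \<in> A} + (\<Sum>u\<in>U. of_bool ((u,w) \<in> A)) + (card U choose 2)"
      using insert by (simp add: sum.distrib)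
    also have "(\<Sum>u\<in>U. of_bool ((u,w) \<in> A)) = card {u \<in> U. (u,w) \<in> A}" using insert.hyps(1) by (simp add: sum_of_bool_eq Int_def)
    also have "{u \<in> U. (u,w) \<in> A} = U - {x \<in> U. (w,x) \<in> A}"
    proof -
      have "(u,w) \<in> A \<longleftrightarrow> (w,u) \<notin> A" if "u \<in> U" for u using tour_total[OF t wV(1), of u] wV(2) that insert.hyps(2) by blast
      then show ?thesis by blast
    qed
    also have "card {x \<in> U. (w,x) \<in> A} + card (U - {x \<in> U. (w,x) \<in> A}) = card U"
    proof -
      have sub: "{x \<in> U. (w,x) \<in> A} \<subseteq> U" by blast
      show ?thesis using card_Diff_subset[OF finite_subset[OF sub insert.hyps(1)] sub] card_mono[OF insert.hyps(1) sub] by linarith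
    qed
    finally show ?case using insert.hyps by (simp add: numeral_2_eq_2)
  qed simp
qed

lemma score_list_landau:
  assumes t: "tour V A" and c: "card V = 8"
  shows "score_list V A \<in> set landau8"
proof -
  have fin: "finite V" using t unfolding tour_def by blast
  obtain ws where ws: "distinct ws" "set ws = V" "sorted (map (outdeg A) ws)" using sorted_listing[OF fin] by blast
  have len: "length ws = 8" using distinct_card[OF ws(1)] ws(2) c by simp
  have S: "score_list V A = map (outdeg A) ws" using score_list_listing[OF ws(1,2)] sorted_sort_id[OF ws(3)] by simp
  have part: "card (set us) choose 2 \<le> sum_list (map (outdeg A) us)" if us: "distinct us" "set us \<subseteq> V" for us
  proof -
    have "card {x \<in> set us. (u,x) \<in> A} \<le> outdeg A u" for u
      unfolding outdeg_def by (rule card_mono) (use tour_asym(4)[OF t] in \<open>auto intro: finite_subset[OF _ fin]\<close>)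
    then have "(\<Sum>u\<in>set us. card {x \<in> set us. (u,x) \<in> A}) \<le> (\<Sum>u\<in>set us. outdeg A u)" by (rule sum_mono)
    then show ?thesis unfolding inner_arcs[OF t us(2)] by (simp add: sum_list_distinct_conv_sum_set[OF us(1)])
  qed
  \<comment> \<open>Landau's bounds are the numbers of arcs inside the first \<open>j + 1\<close> vertices.\<close>
  have thresholds: "[0,1,3,6,10,15,21,28] = map (\<lambda>j. Suc j choose 2) [0..<8]" by (simp add: upt_rec choose_two)
  have "map (outdeg A) ws \<in> set (landau_lists 28 [0,1,3,6,10,15,21,28] 0 0)"
  proof (rule landau_lists_complete)
    show "length (map (outdeg A) ws) = length [0,1,3,6,10,15,21,28::nat]" "sorted (map (outdeg A) ws)" using len ws(3) by simp_all
    show "\<forall>x\<in>set (map (outdeg A) ws). 0 \<le> x \<and> x < 8" using outdeg_converse(2)[OF t] ws(2) c by force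
    show "[0,1,3,6,10,15,21,28] ! j \<le> 0 + sum_list (take (Suc j) (map (outdeg A) ws))" if "j < length [0,1,3,6,10,15,21,28::nat]" for j
    proof -
      have j: "j < 8" using that by simp
      have d: "distinct (take (Suc j) ws)" "set (take (Suc j) ws) \<subseteq> V" using ws(1,2) set_take_subset[of "Suc j" ws] by auto
      have "card (set (take (Suc j) ws)) = Suc j" using distinct_card[OF d(1)] len j by simp
      then show ?thesis unfolding thresholds using part[OF d] j by (simp add: take_map)
    qed
    have "(\<Sum>u\<in>V. outdeg A u) = (\<Sum>u\<in>V. card {x \<in> V. (u,x) \<in> A})"
    proof (rule sum.cong[OF refl])
      fix u
      have "{x. (u,x) \<in> A} = {x \<in> V. (u,x) \<in> A}" using tour_asym(4)[OF t] by blast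
      then show "outdeg A u = card {x \<in> V. (u,x) \<in> A}" unfolding outdeg_def by (rule arg_cong)
    qed
    then show "0 + sum_list (map (outdeg A) ws) = 28"
      using inner_arcs[OF t order_refl] choose_two[of 8] c ws(2) by (simp add: sum_list_distinct_conv_sum_set[OF ws(1)])
  qed
  then show ?thesis unfolding S landau8_def .
qed

text \<open>Landau's construction: the vertex of smallest score \<open>s\<close> beats the next \<open>s\<close> vertices and loses to the others,
  whose scores within the remaining tournament drop by one.\<close>

function realizable :: "(nat \<times> nat) list \<Rightarrow> bool" where
  "realizable [] \<longleftrightarrow> True"
| "realizable ((s,v) # ps) \<longleftrightarrow> s \<le> length ps \<and> list_all (\<lambda>p. fst p \<noteq> 0) (drop s ps) \<and>
     realizable (sort_key fst (take s ps @ map (\<lambda>p. (fst p - 1, snd p)) (drop s ps)))"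
  by pat_completeness auto
termination by (relation "Wellfounded.measure length") auto

lemma realizable_tour:
  assumes "realizable ps" "distinct (map snd ps)"
  shows "\<exists>A. tour (snd ` set ps) A \<and> (\<forall>(s,v)\<in>set ps. outdeg A v = s)"
  using assms
proof (induction ps rule: realizable.induct)
  case 1
  have "tour (snd ` set []) {}" unfolding tour_def by simp
  then show ?case by auto
next
  case (2 s v ps)
  let ?lo = "take s ps" and ?hi = "drop s ps"
  let ?qs = "?lo @ map (\<lambda>p. (fst p - 1, snd p)) ?hi"
  have ps: "?lo @ ?hi = ps" by (rule append_take_drop_id)
  have "map snd ?qs = map snd (?lo @ ?hi)" by (simp only: map_append map_map comp_def snd_conv)
  then have snds: "map snd ?qs = map snd ps" unfolding ps .
  have len: "length ?lo = s" and nz: "\<forall>p\<in>set ?hi. fst p \<noteq> 0" and r: "realizable (sort_key fst ?qs)"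
    using 2(2) unfolding realizable.simps list_all_iff by auto
  have vs: "v \<notin> snd ` set ps" and dist: "distinct (map snd ps)" using 2(3) by auto
  have "mset (map snd (sort_key fst ?qs)) = mset (map snd ?qs)" by (simp only: mset_map mset_sort)
  then have "distinct (map snd (sort_key fst ?qs))" using dist mset_eq_imp_distinct_iff unfolding snds by blast
  from 2(1)[OF r this] obtain A where t: "tour (snd ` set ?qs) A" and out: "\<forall>(s,v)\<in>set ?qs. outdeg A v = s"
    unfolding set_sort by (elim exE conjE)
  have W: "snd ` set ?qs = snd ` set ps" using arg_cong[OF snds, of set] by (simp only: set_map)
  let ?L = "snd ` set ?lo" and ?H = "snd ` set ?hi"
  have LH: "?L \<union> ?H = snd ` set ps" using arg_cong[OF ps, of "\<lambda>xs. snd ` set xs"] by (simp only: set_append image_Un)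
  have "distinct (map snd (?lo @ ?hi))" unfolding ps by (rule dist)
  then have D: "distinct (map snd ?lo) \<and> distinct (map snd ?hi) \<and> set (map snd ?lo) \<inter> set (map snd ?hi) = {}"
    unfolding map_append distinct_append .
  note split = D[THEN conjunct1] D[THEN conjunct2, THEN conjunct2]
  have disj: "?L \<inter> ?H = {}" using split(2) unfolding set_map .
  have cL: "card ?L = s" using distinct_card[OF split(1)] len unfolding set_map length_map by simp
  define B where "B = A \<union> {v} \<times> ?L \<union> ?H \<times> {v}"
  have tA: "A \<subseteq> snd ` set ps \<times> snd ` set ps" "finite (snd ` set ps)" using t unfolding tour_def W by blast+
  have "tour (insert v (snd ` set ps)) B"
    unfolding tour_def
  proof (intro conjI ballI impI)
    show "finite (insert v (snd ` set ps))" by simp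
    show "B \<subseteq> insert v (snd ` set ps) \<times> insert v (snd ` set ps)" unfolding B_def using tA LH by blast
    show "(u,u) \<notin> B" if "u \<in> insert v (snd ` set ps)" for u
      using tour_asym(2)[OF t, of u u] vs LH unfolding B_def by blast
    fix x y assume xy: "x \<in> insert v (snd ` set ps)" "y \<in> insert v (snd ` set ps)" "x \<noteq> y"
    consider "x = v" "y \<in> snd ` set ps" | "y = v" "x \<in> snd ` set ps" | "x \<in> snd ` set ps" "y \<in> snd ` set ps" using xy by blast
    then show "((x,y) \<in> B) \<noteq> ((y,x) \<in> B)"
    proof cases
      case 1
      then have "(v,y) \<notin> A" "(y,v) \<notin> A" "y \<noteq> v" using tA vs by blast+
      then show ?thesis unfolding B_def 1(1) using 1(2) disj LH by auto
    next
      case 2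
      then have "(v,x) \<notin> A" "(x,v) \<notin> A" "x \<noteq> v" using tA vs by blast+
      then show ?thesis unfolding B_def 2(1) using 2(2) disj LH by auto
    next
      case 3
      then have "x \<noteq> v" "y \<noteq> v" using vs by blast+
      then have "(x,y) \<in> B \<longleftrightarrow> (x,y) \<in> A" "(y,x) \<in> B \<longleftrightarrow> (y,x) \<in> A" unfolding B_def by blast+
      moreover have "(y,x) \<in> A \<longleftrightarrow> (x,y) \<notin> A" by (rule tour_total[OF t]) (use 3 xy(3) W in auto)
      ultimately show ?thesis by blast
    qed
  qed
  moreover have "outdeg B u = k" if ku: "(k,u) \<in> set ((s,v) # ps)" for k u
  proof -
    have fin: "finite {x. (u,x) \<in> A}" by (rule finite_subset[OF _ tA(2)]) (use tA(1) in blast)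
    have "(k,u) \<in> insert (s,v) (set ?lo \<union> set ?hi)" using ku unfolding set_append[symmetric] ps by simp
    then consider "k = s" "u = v" | "(k,u) \<in> set ?lo" | "(k,u) \<in> set ?hi" by blast
    then show ?thesis
    proof cases
      case 1
      have "{x. (v,x) \<in> B} = ?L" unfolding B_def using tA(1) vs LH by blast
      then show ?thesis unfolding outdeg_def 1 using cL by simp
    next
      case 2
      then have "u \<in> ?L" by force
      then have "u \<noteq> v" "u \<notin> ?H" using vs LH disj by blast+
      then have "{x. (u,x) \<in> B} = {x. (u,x) \<in> A}" unfolding B_def by blast
      then show ?thesis using out 2 unfolding outdeg_def by auto
    next
      case 3
      then have "u \<in> ?H" by force
      then have "u \<noteq> v" using vs LH by blast
      then have "{x. (u,x) \<in> B} = insert v {x. (u,x) \<in> A}" unfolding B_def using \<open>u \<in> ?H\<close> by blast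
      moreover have "v \<notin> {x. (u,x) \<in> A}" using tA(1) vs by blast
      moreover have "(k - 1, u) \<in> set ?qs" using 3 by force
      ultimately have "outdeg B u = Suc (k - 1)" using out fin unfolding outdeg_def by auto
      then show ?thesis using nz 3 by force
    qed
  qed
  ultimately show ?case by (intro exI[of _ B]) auto
qed

lemma landau8_realizable: "list_all (\<lambda>S. length S = 8 \<and> sorted S \<and> realizable (zip S [0..<8])) landau8"
  by code_simp

lemma landau8_counts: "length landau8 = 167" "length (filter unobstructed landau8) = 147"
  by code_simp+

theorem score_sequences_8: "score_sequences 8 = set landau8"
proof (intro equalityI subsetI)
  fix S assume "S \<in> score_sequences 8"
  then obtain G :: "nat pair_pre_digraph" where G: "tournament G" "card (pverts G) = 8" "S = score_sequence G"
    unfolding score_sequences_def by blast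
  then show "S \<in> set landau8" using score_list_landau[OF tournament_tour(1)[OF G(1)] G(2)] tournament_tour(2)[OF G(1)] by simp
next
  fix S assume "S \<in> set landau8"
  then have S: "length S = 8" "sorted S" "realizable (zip S [0..<8])" using landau8_realizable unfolding list_all_iff by blast+
  have "map snd (zip S [0..<8]) = [0..<8]" using S(1) by simp
  then have V: "snd ` set (zip S [0..<8]) = {0..<8}" "distinct (map snd (zip S [0..<8]))" by (metis set_map set_upt, simp)
  from realizable_tour[OF S(3) V(2)] obtain A where A: "tour {0..<8} A" "\<forall>(s,v)\<in>set (zip S [0..<8]). outdeg A v = s"
    unfolding V(1) by blast
  let ?G = "\<lparr>pverts = {0..<8}, parcs = A\<rparr>"
  have fin: "finite A" by (rule finite_subset[of _ "{0..<8} \<times> {0..<8}"]) (use A(1) in \<open>auto simp: tour_def\<close>)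
  have T: "tournament ?G"
  proof unfold_locales
    show "fst e \<in> pverts ?G" "snd e \<in> pverts ?G" "fst e \<noteq> snd e" if "e \<in> parcs ?G" for e
      using tour_asym[OF A(1), of "fst e" "snd e"] that by simp_all
    show "((u,v) \<in> parcs ?G) \<noteq> ((v,u) \<in> parcs ?G)" if "u \<in> pverts ?G" "v \<in> pverts ?G" "u \<noteq> v" for u v
      using tour_total[OF A(1), of u v] that by simp
  qed (simp_all add: fin)
  have "map (outdeg A) [0..<8] = S"
  proof (rule nth_equalityI)
    fix i assume "i < length (map (outdeg A) [0..<8])"
    then have "(S ! i, i) \<in> set (zip S [0..<8])" using S(1) by (auto simp: set_zip)
    then show "map (outdeg A) [0..<8] ! i = S ! i" using A(2) \<open>i < _\<close> by auto
  qed (simp add: S(1))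
  then have "score_list {0..<8} A = S" using score_list_listing[of "[0..<8]" "{0..<8}" A] sorted_sort_id[OF S(2)] by simp
  then have "score_sequence ?G = S" using tournament_tour(2)[OF T] by simp
  then show "S \<in> score_sequences 8" unfolding score_sequences_def using T by force
qed

theorem mainTheorem1:
  shows "card (score_sequences 8) = 167 \<and>
    card {S \<in> score_sequences 8. linkless S} \<ge> 147 \<and>
    card {S \<in> score_sequences 8. has_intrinsically_linked_representative S} \<ge> 15"
proof (intro conjI)
  have dist: "distinct landau8" unfolding landau8_def by (rule landau_lists_distinct)
  show "card (score_sequences 8) = 167" unfolding score_sequences_8 using distinct_card[OF dist] landau8_counts(1) by simp
  have fin: "finite {S \<in> score_sequences 8. Q S}" for Q unfolding score_sequences_8 by simp
  have "set (filter unobstructed landau8) \<subseteq> {S \<in> score_sequences 8. linkless S}"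
    unfolding score_sequences_8 using unobstructed_linkless landau8_realizable unfolding list_all_iff by auto
  from card_mono[OF fin this] show "card {S \<in> score_sequences 8. linkless S} \<ge> 147"
    using distinct_card[OF distinct_filter[OF dist, of unobstructed]] landau8_counts(2) by simp
  have "has_intrinsically_linked_representative S \<and> S \<in> score_sequences 8" if S: "S \<in> (\<lambda>(P,es,fs,S). S) ` set linked_instances" for S
  proof -
    obtain P es fs where I: "(P,es,fs,S) \<in> set linked_instances" using S by auto
    from linked_representative[OF this] have r: "has_intrinsically_linked_representative S" .
    then obtain G :: "nat pair_pre_digraph" where G: "tournament G" "score_sequence G = S"
      unfolding has_intrinsically_linked_representative_def by blast
    have "list_all (\<lambda>(P,es,fs,S). length S = 8) linked_instances" unfolding linked_instances_def by simp
    then have "length S = 8" using I unfolding list_all_iff by fast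
    then have "card (pverts G) = 8" using G(2) tournament_tour(2)[OF G(1)] length_score_list by metis
    then show ?thesis using r G unfolding score_sequences_def by blast
  qed
  then have "(\<lambda>(P,es,fs,S). S) ` set linked_instances \<subseteq> {S \<in> score_sequences 8. has_intrinsically_linked_representative S}" by blast
  from card_mono[OF fin this] have "card ((\<lambda>(P,es,fs,S). S) ` set linked_instances) \<le> card {S \<in> score_sequences 8. has_intrinsically_linked_representative S}" .
  moreover have "card ((\<lambda>(P,es,fs,S). S) ` set linked_instances) = 15" unfolding linked_instances_def by simp
  ultimately show "card {S \<in> score_sequences 8. has_intrinsically_linked_representative S} \<ge> 15" by simp
qed

end
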